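(* Let $G/K$ be a homogeneous space of a real Banach--Lie group $G$, let $\mathfrak g=\mathrm{Lie}(G)$ and $\mathfrak k=\mathrm{Lie}(K)$, and let $\mathcal N:T(G/K)\to T(G/K)$ be the homogeneous vector bundle map induced by an admissible operator $N\in\mathcal A(G,K)\subset\mathcal B(\mathfrak g)$. Then $\mathcal N$ is a Nijenhuis operator on $G/K$ if and only if $$N[v,Nw]+N[Nv,w]-[Nv,Nw]-N^2[v,w]\in\mathfrak k\qquad\text{for all } v,w\in\mathfrak g .$$
   Context: Setting. $G$ is a real Banach--Lie group with Banach--Lie algebra $\mathfrak g$; $K$ is an immersed Banach--Lie subgroup of $G$ with Banach--Lie subalgebra $\mathfrak k\subset\mathfrak g$ (immersion: each differential is injective with closed range). $G/K=\{gK: g\in G\}$ is a homogeneous space of $G$, meaning that it has a Hausdorff Banach manifold structure such that the quotient map $\pi:G\to G/K$, $\pi(g)=gK$, is a submersion, i.e. its differential is surjective at every point (no splitting of kernels is required; $\mathfrak k$ need not be complemented in $\mathfrak g$). The base point is $p_0=\pi(1)$. For $g\in G$, $\alpha_g:G/K\to G/K$ is $\alpha_g(\pi(h))=\pi(gh)$. $f_*$ denotes the differential of $f$ and $f_{*m}$ the differential at $m$. $\mathrm{Ad}$ is the adjoint representation of $G$ on $\mathfrak g$; $\mathcal B(\mathfrak g)$ is the space of bounded linear operators on $\mathfrak g$. All vector bundle maps cover the identity. One has $\ker\pi_{*1}=\mathfrak k$. Admissible operators. $\mathcal A(G,K)=\{N\in\mathcal B(\mathfrak g): N\mathfrak k\subset\mathfrak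 k,\ \mathrm{Ran}(\mathrm{Ad}_kN-N\mathrm{Ad}_k)\subset\mathfrak k\ \ \forall k\in K\}$. Induced map. For $N\in\mathcal A(G,K)$, the homogeneous vector bundle map induced by $N$ is the smooth vector bundle map $\mathcal N:T(G/K)\to T(G/K)$ given by $\mathcal N_{p_0}\pi_{*1}v=\pi_{*1}Nv$ for $v\in\mathfrak g$, and $\mathcal N_p=(\alpha_g)_*\mathcal N_{p_0}(\alpha_g)_*^{-1}$ for $p=\pi(g)$ (this is well defined). Nijenhuis torsion. For a smooth vector bundle map $\mathcal N$ of the tangent bundle of a manifold and vector fields $X,Y$, $\Omega_{\mathcal N}(X,Y)=\mathcal N[\mathcal NX,Y]+\mathcal N[X,\mathcal NY]-[\mathcal NX,\mathcal NY]-\mathcal N^2[X,Y]$. $\mathcal N$ is a Nijenhuis operator if $\Omega_{\mathcal N}\equiv0$. *)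

theory Defs
  imports "HOL-Analysis.Analysis" "HOL-Algebra.Coset"
begin

text \<open>An \<open>n\<close>-linear map is represented as a function on lists, looked at only on lists of length \<open>n\<close>.\<close>

definition bounded_multilinear ::
    "nat \<Rightarrow> ('a::real_normed_vector list \<Rightarrow> 'b::real_normed_vector) \<Rightarrow> bool" where
  "bounded_multilinear n M \<longleftrightarrow>
     (\<forall>i<n. \<forall>vs. length vs = n \<longrightarrow> linear (\<lambda>v. M (vs[i := v]))) \<and>
     (\<exists>C. \<forall>vs. length vs = n \<longrightarrow> norm (M vs) \<le> C * prod_list (map norm vs))"

text \<open>
  \<open>C\<^sup>\<infinity>\<close> in the Frechet sense. The restriction of \<open>D x\<close> to lists of length \<open>n\<close> is the
  \<open>n\<close>-th derivative of \<open>f\<close> at \<open>x\<close>, a bounded \<open>n\<close>-linear map. The last clause says that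
  \<open>x \<mapsto> D\<^sup>n f(x)\<close> is Frechet differentiable at \<open>x\<close> with respect to the operator norm on
  \<open>n\<close>-linear maps, with derivative \<open>D\<^sup>n\<^sup>+\<^sup>1 f(x)\<close>. All derivatives are displayed at once because
  their types depend on \<open>n\<close>, which rules out a recursion on \<open>n\<close>.
  Openness of the domain is part of the notion.
\<close>

definition smooth_on ::
    "'a::real_normed_vector set \<Rightarrow> ('a \<Rightarrow> 'b::real_normed_vector) \<Rightarrow> bool" where
  "smooth_on S f \<longleftrightarrow> open S \<and>
     (\<exists>D :: 'a \<Rightarrow> 'a list \<Rightarrow> 'b.
        (\<forall>x\<in>S. D x [] = f x) \<and>
        (\<forall>n. \<forall>x\<in>S. bounded_multilinear n (D x)) \<and>
        (\<forall>n. \<forall>x\<in>S. \<forall>e>0. \<exists>d>0. \<forall>y\<in>S. norm (y - x) < d \<longrightarrow>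
           (\<forall>vs. length vs = n \<longrightarrow>
              norm (D y vs - D x vs - D x ((y - x) # vs))
                \<le> e * norm (y - x) * prod_list (map norm vs))))"

text \<open>
  A Banach manifold is given by an atlas on a set (Lang's definition): its underlying set is
  \<open>points A\<close> and its topology is the one determined by the charts. All charts take values in one
  Banach space \<open>'e\<close>; this loses nothing for Lie groups and homogeneous spaces, whose tangent spaces
  are all isomorphic.
\<close>

type_synonym ('p, 'e) chart = "'p set \<times> ('p \<Rightarrow> 'e)"

definition chart_inv :: "('p, 'e) chart \<Rightarrow> 'e \<Rightarrow> 'p" where
  "chart_inv c = inv_into (fst c) (snd c)"

definition points :: "('p, 'e) chart set \<Rightarrow> 'p set" where
  "points A = \<Union> (fst ` A)"

definition banach_atlas :: "('p, 'e::banach) chart set \<Rightarrow> bool" where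
  "banach_atlas A \<longleftrightarrow>
     (\<forall>c\<in>A. inj_on (snd c) (fst c)) \<and>
     (\<forall>c\<in>A. \<forall>d\<in>A. smooth_on (snd c ` (fst c \<inter> fst d)) (snd d \<circ> chart_inv c))"

definition manifold_topology :: "('p, 'e::banach) chart set \<Rightarrow> 'p topology" where
  "manifold_topology A =
     topology (\<lambda>W. W \<subseteq> points A \<and> (\<forall>c\<in>A. open (snd c ` (W \<inter> fst c))))"

lemma openin_manifold_topology:
  fixes A :: "('p, 'e::banach) chart set"
  assumes "banach_atlas A"
  shows "openin (manifold_topology A) W \<longleftrightarrow>
           W \<subseteq> points A \<and> (\<forall>c\<in>A. open (snd c ` (W \<inter> fst c)))"
proof -
  have "istopology (\<lambda>W. W \<subseteq> points A \<and> (\<forall>c\<in>A. open (snd c ` (W \<inter> fst c))))"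
    unfolding istopology_def
  proof (intro conjI allI impI ballI)
    fix S T c assume S: "S \<subseteq> points A \<and> (\<forall>c\<in>A. open (snd c ` (S \<inter> fst c)))"
      and T: "T \<subseteq> points A \<and> (\<forall>c\<in>A. open (snd c ` (T \<inter> fst c)))" and c: "c \<in> A"
    have "inj_on (snd c) (fst c)"
      using assms c by (auto simp: banach_atlas_def)
    then have "snd c ` (S \<inter> T \<inter> fst c) = snd c ` (S \<inter> fst c) \<inter> snd c ` (T \<inter> fst c)"
      by (auto simp: inj_on_def)
    then show "open (snd c ` (S \<inter> T \<inter> fst c))"
      using S T c by auto
  next
    fix K c assume K: "\<forall>S\<in>K. S \<subseteq> points A \<and> (\<forall>c\<in>A. open (snd c ` (S \<inter> fst c)))" and c: "c \<in> A"
    have "snd c ` (\<Union>K \<inter> fst c) = (\<Union>S\<in>K. snd c ` (S \<inter> fst c))"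
      by auto
    then show "open (snd c ` (\<Union>K \<inter> fst c))"
      using K c by auto
  qed blast+
  then show ?thesis
    by (simp add: manifold_topology_def topology_inverse')
qed

definition banach_manifold :: "('p, 'e::banach) chart set \<Rightarrow> bool" where
  "banach_manifold A \<longleftrightarrow> banach_atlas A \<and> Hausdorff_space (manifold_topology A)"

text \<open>Openness of the sets \<open>snd c ` (fst c \<inter> f -` fst d)\<close>, contained in \<open>smooth_on\<close>, makes \<open>f\<close>
  continuous.\<close>

definition smooth_map ::
    "('p, 'e::banach) chart set \<Rightarrow> ('q, 'f::banach) chart set \<Rightarrow> ('p \<Rightarrow> 'q) \<Rightarrow> bool" where
  "smooth_map A B f \<longleftrightarrow> f ` points A \<subseteq> points B \<and>
     (\<forall>c\<in>A. \<forall>d\<in>B. smooth_on (snd c ` (fst c \<inter> f -` fst d)) (snd d \<circ> f \<circ> chart_inv c))"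

definition prod_atlas ::
    "('p, 'e) chart set \<Rightarrow> ('q, 'f) chart set \<Rightarrow> ('p \<times> 'q, 'e \<times> 'f) chart set" where
  "prod_atlas A B = {(fst c \<times> fst d, map_prod (snd c) (snd d)) | c d. c \<in> A \<and> d \<in> B}"

text \<open>
  The tangent space at every point \<open>p\<close> is identified with the model space \<open>'e\<close> by means of one
  chosen chart \<open>chart_at A p\<close> around \<open>p\<close>. A vector field is thus a function \<open>X\<close> of type \<open>'p \<Rightarrow> 'e\<close>,
  where \<open>X p\<close> is the component of the tangent vector at \<open>p\<close> in the chart \<open>chart_at A p\<close>, and a
  bundle map covering the identity is a function of type \<open>'p \<Rightarrow> 'e \<Rightarrow> 'e\<close>. Since the chosen chart
  varies with the point in an uncontrolled way, smoothness has to be expressed after passing to the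
  components in a fixed chart by \<open>chart_change\<close>.
\<close>

definition chart_at :: "('p, 'e) chart set \<Rightarrow> 'p \<Rightarrow> ('p, 'e) chart" where
  "chart_at A p = (SOME c. c \<in> A \<and> p \<in> fst c)"

definition chart_change ::
    "('p, 'e::real_normed_vector) chart \<Rightarrow> ('p, 'e) chart \<Rightarrow> 'p \<Rightarrow> 'e \<Rightarrow> 'e" where
  "chart_change c d p = frechet_derivative (snd d \<circ> chart_inv c) (at (snd c p))"

definition mderiv ::
    "('p, 'e::banach) chart set \<Rightarrow> ('q, 'f::banach) chart set \<Rightarrow> ('p \<Rightarrow> 'q) \<Rightarrow> 'p \<Rightarrow> 'e \<Rightarrow> 'f" where
  "mderiv A B f p =
     frechet_derivative (snd (chart_at B (f p)) \<circ> f \<circ> chart_inv (chart_at A p))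
       (at (snd (chart_at A p) p))"

definition in_chart ::
    "('p, 'e::banach) chart set \<Rightarrow> ('p, 'e) chart \<Rightarrow> ('p \<Rightarrow> 'e) \<Rightarrow> 'e \<Rightarrow> 'e" where
  "in_chart A c X x = (let p = chart_inv c x in chart_change (chart_at A p) c p (X p))"

definition smooth_vector_field :: "('p, 'e::banach) chart set \<Rightarrow> ('p \<Rightarrow> 'e) \<Rightarrow> bool" where
  "smooth_vector_field A X \<longleftrightarrow> (\<forall>c\<in>A. smooth_on (snd c ` fst c) (in_chart A c X))"

definition lie_bracket ::
    "('p, 'e::banach) chart set \<Rightarrow> ('p \<Rightarrow> 'e) \<Rightarrow> ('p \<Rightarrow> 'e) \<Rightarrow> 'p \<Rightarrow> 'e" where
  "lie_bracket A X Y p =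
     (let c = chart_at A p; x = snd c p in
        frechet_derivative (in_chart A c Y) (at x) (in_chart A c X x)
        - frechet_derivative (in_chart A c X) (at x) (in_chart A c Y x))"

definition smooth_bundle_map :: "('p, 'e::banach) chart set \<Rightarrow> ('p \<Rightarrow> 'e \<Rightarrow> 'e) \<Rightarrow> bool" where
  "smooth_bundle_map A \<N> \<longleftrightarrow>
     (\<forall>p\<in>points A. linear (\<N> p)) \<and>
     (\<forall>c\<in>A. smooth_on ((snd c ` fst c) \<times> UNIV)
        (\<lambda>(x, u). let p = chart_inv c x in
           chart_change (chart_at A p) c p (\<N> p (chart_change c (chart_at A p) p u))))"

definition nijenhuis_torsion ::
    "('p, 'e::banach) chart set \<Rightarrow> ('p \<Rightarrow> 'e \<Rightarrow> 'e) \<Rightarrow> ('p \<Rightarrow> 'e) \<Rightarrow> ('p \<Rightarrow> 'e) \<Rightarrow> 'p \<Rightarrow> 'e" where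
  "nijenhuis_torsion A \<N> X Y p =
     \<N> p (lie_bracket A (\<lambda>q. \<N> q (X q)) Y p)
     + \<N> p (lie_bracket A X (\<lambda>q. \<N> q (Y q)) p)
     - lie_bracket A (\<lambda>q. \<N> q (X q)) (\<lambda>q. \<N> q (Y q)) p
     - \<N> p (\<N> p (lie_bracket A X Y p))"

definition nijenhuis_operator :: "('p, 'e::banach) chart set \<Rightarrow> ('p \<Rightarrow> 'e \<Rightarrow> 'e) \<Rightarrow> bool" where
  "nijenhuis_operator A \<N> \<longleftrightarrow> smooth_bundle_map A \<N> \<and>
     (\<forall>X Y. smooth_vector_field A X \<longrightarrow> smooth_vector_field A Y \<longrightarrow>
        (\<forall>p\<in>points A. nijenhuis_torsion A \<N> X Y p = 0))"

definition banach_lie_group ::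
    "('a, 's) monoid_scheme \<Rightarrow> ('a, 'g::banach) chart set \<Rightarrow> bool" where
  "banach_lie_group G A \<longleftrightarrow> group G \<and> banach_manifold A \<and> points A = carrier G \<and>
     smooth_map (prod_atlas A A) A (\<lambda>(g, h). g \<otimes>\<^bsub>G\<^esub> h) \<and>
     smooth_map A A (m_inv G)"

text \<open>The Lie algebra is the tangent space at the unit element, i.e. the type \<open>'g\<close> itself (the norm
  is that of the chosen chart; another chart gives an equivalent one), with the bracket of
  left-invariant vector fields.\<close>

definition left_invariant_field ::
    "('a, 's) monoid_scheme \<Rightarrow> ('a, 'g::banach) chart set \<Rightarrow> 'g \<Rightarrow> 'a \<Rightarrow> 'g" where
  "left_invariant_field G A v g = mderiv A A (\<lambda>h. g \<otimes>\<^bsub>G\<^esub> h) \<one>\<^bsub>G\<^esub> v"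

definition lie_algebra_bracket ::
    "('a, 's) monoid_scheme \<Rightarrow> ('a, 'g::banach) chart set \<Rightarrow> 'g \<Rightarrow> 'g \<Rightarrow> 'g" where
  "lie_algebra_bracket G A v w =
     lie_bracket A (left_invariant_field G A v) (left_invariant_field G A w) \<one>\<^bsub>G\<^esub>"

definition Ad ::
    "('a, 's) monoid_scheme \<Rightarrow> ('a, 'g::banach) chart set \<Rightarrow> 'a \<Rightarrow> 'g \<Rightarrow> 'g" where
  "Ad G A g = mderiv A A (\<lambda>h. g \<otimes>\<^bsub>G\<^esub> h \<otimes>\<^bsub>G\<^esub> m_inv G g) \<one>\<^bsub>G\<^esub>"

definition immersed_lie_subgroup ::
    "('a, 's) monoid_scheme \<Rightarrow> ('a, 'g::banach) chart set \<Rightarrow> 'a set \<Rightarrow>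
     ('a, 'k::banach) chart set \<Rightarrow> bool" where
  "immersed_lie_subgroup G A K B \<longleftrightarrow>
     subgroup K G \<and> banach_lie_group (G\<lparr>carrier := K\<rparr>) B \<and>
     smooth_map B A (\<lambda>k. k) \<and>
     (\<forall>k\<in>K. inj (mderiv B A (\<lambda>k. k) k) \<and> closed (range (mderiv B A (\<lambda>k. k) k)))"

definition lie_subalgebra ::
    "('a, 's) monoid_scheme \<Rightarrow> ('a, 'g::banach) chart set \<Rightarrow> ('a, 'k::banach) chart set \<Rightarrow> 'g set" where
  "lie_subalgebra G A B = range (mderiv B A (\<lambda>k. k) \<one>\<^bsub>G\<^esub>)"

definition coset_proj :: "('a, 's) monoid_scheme \<Rightarrow> 'a set \<Rightarrow> 'a \<Rightarrow> 'a set" where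
  "coset_proj G K g = g <#\<^bsub>G\<^esub> K"

definition homogeneous_space ::
    "('a, 's) monoid_scheme \<Rightarrow> ('a, 'g::banach) chart set \<Rightarrow> 'a set \<Rightarrow>
     ('a set, 'm::banach) chart set \<Rightarrow> bool" where
  "homogeneous_space G A K Q \<longleftrightarrow>
     banach_manifold Q \<and> points Q = coset_proj G K ` carrier G \<and>
     smooth_map A Q (coset_proj G K) \<and>
     (\<forall>g\<in>carrier G. surj (mderiv A Q (coset_proj G K) g))"

definition admissible_ops ::
    "('a, 's) monoid_scheme \<Rightarrow> ('a, 'g::banach) chart set \<Rightarrow> 'a set \<Rightarrow>
     ('a, 'k::banach) chart set \<Rightarrow> ('g \<Rightarrow> 'g) set" where
  "admissible_ops G A K B =
     {N. bounded_linear N \<and>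
         N ` lie_subalgebra G A B \<subseteq> lie_subalgebra G A B \<and>
         (\<forall>k\<in>K. range (\<lambda>v. Ad G A k (N v) - N (Ad G A k v)) \<subseteq> lie_subalgebra G A B)}"

text \<open>The value \<open>\<N>\<^sub>p\<^sub>0 u\<close> is \<open>\<pi>\<^sub>*\<^sub>1 (N v)\<close> for a chosen \<open>v\<close> with \<open>\<pi>\<^sub>*\<^sub>1 v = u\<close>, and \<open>\<N>\<^sub>p\<close> is
  obtained from it using a chosen \<open>g\<close> with \<open>\<pi> g = p\<close>; for admissible \<open>N\<close> the result does not depend
  on the choices. The action \<open>\<alpha>\<^sub>g\<close> is left translation of cosets.\<close>

definition induced_map_base ::
    "('a, 's) monoid_scheme \<Rightarrow> ('a, 'g::banach) chart set \<Rightarrow> 'a set \<Rightarrow>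
     ('a set, 'm::banach) chart set \<Rightarrow> ('g \<Rightarrow> 'g) \<Rightarrow> 'm \<Rightarrow> 'm" where
  "induced_map_base G A K Q N u =
     (let P = mderiv A Q (coset_proj G K) \<one>\<^bsub>G\<^esub> in P (N (SOME v. P v = u)))"

definition induced_map ::
    "('a, 's) monoid_scheme \<Rightarrow> ('a, 'g::banach) chart set \<Rightarrow> 'a set \<Rightarrow>
     ('a set, 'm::banach) chart set \<Rightarrow> ('g \<Rightarrow> 'g) \<Rightarrow> 'a set \<Rightarrow> 'm \<Rightarrow> 'm" where
  "induced_map G A K Q N p =
     (let g = (SOME g. g \<in> carrier G \<and> coset_proj G K g = p);
          L = mderiv Q Q (\<lambda>q. g <#\<^bsub>G\<^esub> q) (coset_proj G K \<one>\<^bsub>G\<^esub>)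
      in L \<circ> induced_map_base G A K Q N \<circ> inv_into UNIV L)"

end

theory Submission
  imports Defs
begin

text \<open>
  Left translation of \<open>\<g>\<close> followed by \<open>\<pi>\<^sub>*\<close> gives surjections \<open>\<Theta> g : \<g> \<rightarrow> T\<^bsub>gK\<^esub>(G/K)\<close> with
  \<open>\<N> (\<Theta> g v) = \<Theta> g (N v)\<close>. Differentiating this identity along \<open>G\<close> expresses the derivative of
  \<open>\<N>\<close> through derivatives of the frame, and the frame has the brackets of \<open>\<g>\<close> by symmetry of the
  second derivative of \<open>\<pi>\<close>; since the torsion is tensorial, it takes the value
  \<open>\<Theta> g (N[v,Nw] + N[Nv,w] - [Nv,Nw] - N\<^sup>2[v,w])\<close> on \<open>\<Theta> g v\<close> and \<open>\<Theta> g w\<close>. Enough global vector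
  fields exist because every \<open>v\<close> in \<open>\<g>\<close> induces a fundamental field on \<open>G/K\<close>.

  Smoothness of \<open>\<N>\<close> and of the fundamental fields is where the missing complement of \<open>\<k>\<close> matters:
  there are no local sections of \<open>\<pi>\<close>. Instead, \<open>f\<close> is smooth as soon as \<open>f \<circ> P\<close> is, for any
  submersion \<open>P\<close>: by Graves' theorem \<open>P\<close> is locally Lipschitz-open, which makes \<open>f\<close> differentiable
  with \<open>Tf \<circ> TP = T(f \<circ> P)\<close>, and \<open>TP\<close> is again a submersion, so the order of differentiability can
  be raised by induction over all pairs \<open>(f, P)\<close> at once.
\<close>

text \<open>Graves' theorem yields preimages of controlled norm, but no linear or continuous choice
  among them. Hence no map into \<open>G/K\<close> is ever lifted to \<open>G\<close>; statements
  about \<open>G/K\<close> are proved for pull-backs along \<pi> and descended. Descent has to treat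
  whole tangent maps: \<open>Tf \<circ> TP\<close> has again the form "function after submersion",
  whereas the higher derivatives of \<open>f \<circ> P\<close> mix those of \<open>f\<close> with
  those of \<open>P\<close>. The price is that \<open>smooth_on\<close>, which displays all
  derivatives with operator-norm estimates, must be matched with joint continuity of iterated
  tangent maps. At a fixed order the two differ, but local bounds two orders higher restore the
  uniform estimates.

  The vector \<open>\<Theta> g v\<close> depends on \<open>g\<close> and not just on
  \<open>gK\<close>, so \<open>v\<close> does not define a vector field on \<open>G/K\<close> in
  this way. The torsion is therefore computed on \<open>G\<close>, pulled back by left translation
  to a chart at the unit, where the bracket of the Lie algebra is defined. Fundamental fields come
  from multiplication on the other side and are used where they agree with the frame, at the base
  point.\<close>

section \<open>Differentiability classes via the tangent functor\<close>

text \<open>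
  The iterated tangent maps \<open>f, Tf, TTf, \<dots>\<close> live on \<open>E, E \<times> E, \<dots>\<close>, so a recursion on the order of
  differentiability leaves the type of \<open>f\<close>. The space of bounded sequences in \<open>E\<close> contains \<open>E\<close> as
  its coordinate \<open>0\<close> and is isomorphic to its own square (even and odd coordinates), so that all
  tangent maps of a function on it are again functions on it.
\<close>

type_synonym 'a seq = "nat \<Rightarrow>\<^sub>C 'a"

definition reindex :: "(nat \<Rightarrow> nat) \<Rightarrow> 'a::real_normed_vector seq \<Rightarrow> 'a seq" where
  "reindex h f = Bcontfun (\<lambda>n. f (h n))"

definition pairS :: "'a::real_normed_vector seq \<Rightarrow> 'a seq \<Rightarrow> 'a seq" where
  "pairS f g = Bcontfun (\<lambda>n. if even n then f (n div 2) else g (n div 2))"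

definition single :: "'a::real_normed_vector \<Rightarrow> 'a seq" where
  "single v = Bcontfun (\<lambda>n. if n = 0 then v else 0)"

lemma apply_Bcontfun_nat:
  fixes f :: "nat \<Rightarrow> 'a::real_normed_vector"
  assumes "\<And>n. norm (f n) \<le> b"
  shows "apply_bcontfun (Bcontfun f) = f"
  using assms by (intro Bcontfun_inverse bcontfun_normI) auto

lemma reindex_apply [simp]: "reindex h f n = f (h n)"
  unfolding reindex_def by (subst apply_Bcontfun_nat[where b="norm f"]) (auto simp: norm_bounded)

lemma pairS_apply [simp]: "pairS f g n = (if even n then f (n div 2) else g (n div 2))"
  unfolding pairS_def
  by (subst apply_Bcontfun_nat[where b="max (norm f) (norm g)"])
    (auto simp: norm_bounded intro: order_trans[OF norm_bounded])

lemma single_apply [simp]: "single v n = (if n = 0 then v else 0)"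
  unfolding single_def by (subst apply_Bcontfun_nat[where b="norm v"]) auto

definition fstS :: "'a::real_normed_vector seq \<Rightarrow> 'a seq" where "fstS = reindex (\<lambda>n. 2 * n)"
definition sndS :: "'a::real_normed_vector seq \<Rightarrow> 'a seq" where "sndS = reindex (\<lambda>n. Suc (2 * n))"

lemma fstS_apply [simp]: "fstS z n = z (2 * n)"
  and sndS_apply [simp]: "sndS z n = z (Suc (2 * n))"
  by (simp_all add: fstS_def sndS_def)

lemma fstS_pairS [simp]: "fstS (pairS x y) = x"
  and sndS_pairS [simp]: "sndS (pairS x y) = y"
  by (auto intro!: bcontfun_eqI)

lemma pairS_surj: "pairS (fstS z) (sndS z) = z"
  by (auto intro!: bcontfun_eqI elim: evenE oddE)

lemma bounded_linear_apply: "bounded_linear (\<lambda>z::'a::real_normed_vector seq. z n)"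
  by (rule bounded_linear_intro[where K=1]) (auto simp: norm_bounded)

lemma bounded_linear_reindex: "bounded_linear (reindex h)"
  by (rule bounded_linear_intro[where K=1])
    (auto intro!: bcontfun_eqI norm_bound norm_bounded)

lemma bounded_linear_fstS: "bounded_linear fstS" and bounded_linear_sndS: "bounded_linear sndS"
  by (simp_all add: fstS_def sndS_def bounded_linear_reindex)

lemma bounded_linear_single: "bounded_linear single"
  by (rule bounded_linear_intro[where K=1]) (auto intro!: bcontfun_eqI norm_bound)

lemma bounded_linear_pairS: "bounded_linear (\<lambda>(x, y). pairS x y)"
proof (rule bounded_linear_intro[where K=1])
  fix z :: "'a seq \<times> 'a seq"
  obtain x y where z: "z = (x, y)" by force
  show "norm (case z of (x, y) \<Rightarrow> pairS x y) \<le> norm z * 1"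
    unfolding z using norm_fst_le[of x y] norm_snd_le[of y x]
    by (auto intro!: norm_bound intro: order_trans[OF norm_bounded])
qed (auto intro!: bcontfun_eqI)

text \<open>The derivative enters as one function of point and direction, stored in the even and odd
  coordinates of \<open>z\<close>. Its continuity is joint continuity, not continuity in operator
  norm, so a fixed \<open>k\<close> means slightly less than the usual class; the difference
  disappears once all \<open>k\<close> are required. The base component of the tangent map need not
  be recorded, since it is \<open>f\<close> composed with a projection.\<close>

primrec Ck :: "nat \<Rightarrow> 'a::real_normed_vector seq set \<Rightarrow> ('a seq \<Rightarrow> 'b::real_normed_vector) \<Rightarrow> bool" where
  "Ck 0 U f = continuous_on U f"
| "Ck (Suc k) U f = ((\<forall>x\<in>U. f differentiable (at x)) \<and>
     Ck k (fstS -` U) (\<lambda>z. frechet_derivative f (at (fstS z)) (sndS z)))"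

lemma open_vimage_linear: "bounded_linear l \<Longrightarrow> open U \<Longrightarrow> open (l -` U)"
  by (simp add: linear_continuous_on open_vimage)

lemmas open_fstS = open_vimage_linear[OF bounded_linear_fstS]

lemma has_derivative_open_cong:
  assumes "open U" "x \<in> U" "\<And>y. y \<in> U \<Longrightarrow> f y = g y"
  shows "(f has_derivative f') (at x) \<longleftrightarrow> (g has_derivative f') (at x)"
  using has_derivative_transform_within_open[of f f' x UNIV U g]
    has_derivative_transform_within_open[of g f' x UNIV U f] assms by auto

lemma frechet_derivative_open_cong:
  assumes "open U" "x \<in> U" "\<And>y. y \<in> U \<Longrightarrow> f y = g y"
  shows "frechet_derivative f (at x) = frechet_derivative g (at x)"
  using has_derivative_open_cong[OF assms] by (simp add: frechet_derivative_def)

lemma differentiable_open_cong: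
  assumes "open U" "x \<in> U" "\<And>y. y \<in> U \<Longrightarrow> f y = g y"
  shows "f differentiable (at x) \<longleftrightarrow> g differentiable (at x)"
  using has_derivative_open_cong[OF assms] by (simp add: differentiable_def)

lemma Ck_cong:
  assumes "open U" "\<And>y. y \<in> U \<Longrightarrow> f y = g y"
  shows "Ck k U f \<longleftrightarrow> Ck k U g"
  using assms
proof (induction k arbitrary: U f g)
  case 0 then show ?case by (auto intro: continuous_on_cong)
next
  case (Suc k)
  have d: "frechet_derivative f (at x) = frechet_derivative g (at x)"
     "f differentiable (at x) \<longleftrightarrow> g differentiable (at x)" if "x \<in> U" for x
    using frechet_derivative_open_cong[of U x f g] differentiable_open_cong[of U x f g] that Suc
    by auto
  show ?case
    using Suc.IH[of "fstS -` U" "\<lambda>z. frechet_derivative f (at (fstS z)) (sndS z)"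
        "\<lambda>z. frechet_derivative g (at (fstS z)) (sndS z)"] Suc.prems d
    by (auto simp: open_fstS)
qed

lemma Ck_SucI:
  assumes "open U" "\<And>x. x \<in> U \<Longrightarrow> (f has_derivative f' x) (at x)"
    "Ck k (fstS -` U) (\<lambda>z. f' (fstS z) (sndS z))"
  shows "Ck (Suc k) U f"
proof -
  have "frechet_derivative f (at x) = f' x" if "x \<in> U" for x
    using frechet_derivative_at[OF assms(2)[OF that]] by simp
  then have "Ck k (fstS -` U) (\<lambda>z. frechet_derivative f (at (fstS z)) (sndS z))"
    using assms(3) Ck_cong[of "fstS -` U" "\<lambda>z. frechet_derivative f (at (fstS z)) (sndS z)"
        "\<lambda>z. f' (fstS z) (sndS z)" k] open_fstS[OF assms(1)] by auto
  then show ?thesis using assms(2) by (auto simp: differentiable_def)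
qed

lemma Ck_SucE:
  assumes "Ck (Suc k) U f"
  obtains f' where "\<And>x. x \<in> U \<Longrightarrow> (f has_derivative f' x) (at x)"
    "Ck k (fstS -` U) (\<lambda>z. f' (fstS z) (sndS z))"
  using assms by (auto simp: frechet_derivative_works intro: that[of "\<lambda>x. frechet_derivative f (at x)"])

lemma Ck_Suc_imp: "Ck (Suc k) U f \<Longrightarrow> Ck k U f"
proof (induction k arbitrary: U f)
  case 0 then show ?case
    by (auto intro!: continuous_at_imp_continuous_on differentiable_imp_continuous_within)
qed auto

lemma Ck_subset: "Ck k U f \<Longrightarrow> V \<subseteq> U \<Longrightarrow> Ck k V f"
proof (induction k arbitrary: U V f)
  case (Suc k)
  have "fstS -` V \<subseteq> fstS -` U" using Suc by auto
  then show ?case using Suc by (auto)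
qed (auto intro: continuous_on_subset)

lemma Ck_local:
  assumes "\<And>x. x \<in> U \<Longrightarrow> \<exists>V. open V \<and> x \<in> V \<and> Ck k V f"
  shows "Ck k U f"
  using assms
proof (induction k arbitrary: U f)
  case 0
  show ?case unfolding Ck.simps
    by (rule continuous_at_imp_continuous_on) (metis 0 Ck.simps(1) continuous_on_eq_continuous_at)
next
  case (Suc k)
  have "Ck k (fstS -` U) (\<lambda>z. frechet_derivative f (at (fstS z)) (sndS z))"
  proof (rule Suc.IH)
    fix z assume "z \<in> fstS -` U"
    then obtain V where "open V" "fstS z \<in> V" "Ck (Suc k) V f" using Suc.prems by auto
    then show "\<exists>V. open V \<and> z \<in> V \<and> Ck k V (\<lambda>z. frechet_derivative f (at (fstS z)) (sndS z))"
      by (intro exI[of _ "fstS -` V"]) (auto simp: open_fstS)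
  qed
  moreover have "\<forall>x\<in>U. f differentiable (at x)" using Suc.prems by fastforce
  ultimately show ?case by simp
qed

lemma Ck_linear_outer:
  assumes "bounded_linear l" "open U" "Ck k U f"
  shows "Ck k U (\<lambda>x. l (f x))"
  using assms(2,3)
proof (induction k arbitrary: U f)
  case 0 then show ?case
    using continuous_on_compose2[OF linear_continuous_on[OF assms(1), of UNIV]] by auto
next
  case (Suc k)
  from Suc.prems(2) obtain f' where f': "\<And>x. x \<in> U \<Longrightarrow> (f has_derivative f' x) (at x)"
    "Ck k (fstS -` U) (\<lambda>z. f' (fstS z) (sndS z))" by (rule Ck_SucE) blast
  show ?case
  proof (rule Ck_SucI)
    show "((\<lambda>x. l (f x)) has_derivative (\<lambda>h. l (f' x h))) (at x)" if "x \<in> U" for x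
      using bounded_linear.has_derivative[OF assms(1) f'(1)[OF that]] .
    show "Ck k (fstS -` U) (\<lambda>z. l (f' (fstS z) (sndS z)))"
      using Suc.IH[OF open_fstS f'(2)] Suc.prems by auto
  qed (fact Suc)
qed

text \<open>This precedes \<open>Ck_compose\<close> because the induction there needs
  \<open>g \<circ> fstS\<close> to be of class \<open>Ck k\<close>. The tangent map of
  \<open>m\<close> is \<open>m\<close> on each half, again a linear map between sequence spaces, so
  the induction runs over all \<open>m\<close>.\<close>

lemma Ck_linear_inner:
  fixes m :: "'c::real_normed_vector seq \<Rightarrow> 'a::real_normed_vector seq"
  assumes "bounded_linear m" "open U" "Ck k U f"
  shows "Ck k (m -` U) (\<lambda>x. f (m x))"
  using assms
proof (induction k arbitrary: U f m)
  case 0 then show ?case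
    by (auto intro!: continuous_on_compose2[of U f] simp: linear_continuous_on)
next
  case (Suc k)
  from Suc.prems(3) obtain f' where f': "\<And>x. x \<in> U \<Longrightarrow> (f has_derivative f' x) (at x)"
    "Ck k (fstS -` U) (\<lambda>z. f' (fstS z) (sndS z))" by (rule Ck_SucE) blast
  note lin = Suc.prems(1)
  let ?m = "\<lambda>z. pairS (m (fstS z)) (m (sndS z))"
  have lm: "bounded_linear ?m"
    using bounded_linear_compose[OF bounded_linear_pairS
        bounded_linear_Pair[OF bounded_linear_compose[OF lin bounded_linear_fstS]
          bounded_linear_compose[OF lin bounded_linear_sndS]]] by simp
  show ?case
  proof (rule Ck_SucI)
    show "((\<lambda>x. f (m x)) has_derivative (\<lambda>h. f' (m x) (m h))) (at x)" if "x \<in> m -` U" for x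
      using has_derivative_compose[OF bounded_linear_imp_has_derivative[OF lin], of f "f' (m x)" x] f'(1)[of "m x"] that
      by auto
    show "Ck k (fstS -` (m -` U)) (\<lambda>z. f' (m (fstS z)) (m (sndS z)))"
      using Suc.IH[OF lm open_fstS f'(2)] Suc.prems by (auto simp: vimage_def)
  qed (use Suc lin open_vimage_linear in blast)
qed

lemma Ck_Pair:
  assumes "open U" "Ck k U f" "Ck k U g"
  shows "Ck k U (\<lambda>x. (f x, g x))"
  using assms
proof (induction k arbitrary: U f g)
  case 0 then show ?case by (auto intro!: continuous_intros)
next
  case (Suc k)
  from Suc.prems(2) obtain f' where f': "\<And>x. x \<in> U \<Longrightarrow> (f has_derivative f' x) (at x)"
    "Ck k (fstS -` U) (\<lambda>z. f' (fstS z) (sndS z))" by (rule Ck_SucE) blast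
  from Suc.prems(3) obtain g' where g': "\<And>x. x \<in> U \<Longrightarrow> (g has_derivative g' x) (at x)"
    "Ck k (fstS -` U) (\<lambda>z. g' (fstS z) (sndS z))" by (rule Ck_SucE) blast
  show ?case
    by (rule Ck_SucI[where f'="\<lambda>x h. (f' x h, g' x h)"])
      (rule Suc.prems has_derivative_Pair f' g' Suc.IH open_fstS | assumption)+
qed

lemma Ck_const: "open U \<Longrightarrow> Ck k U (\<lambda>_. c)"
proof (induction k arbitrary: U c)
  case (Suc k)
  show ?case by (rule Ck_SucI[where f'="\<lambda>x h. 0"]) (use Suc open_fstS in auto)
qed auto

lemma Ck_linear:
  assumes "open U" "bounded_linear l"
  shows "Ck k U l"
proof (cases k)
  case 0 then show ?thesis using assms by (simp add: linear_continuous_on)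
next
  case (Suc j)
  have "Ck j V m" if "open V" "bounded_linear m" for V and m :: "'a seq \<Rightarrow> 'b"
    using that
  proof (induction j arbitrary: V m)
    case 0 then show ?case by (simp add: linear_continuous_on)
  next
    case (Suc j)
    show ?case
      by (rule Ck_SucI[where f'="\<lambda>x. m"])
        (use Suc open_fstS in \<open>auto intro!: bounded_linear_imp_has_derivative Suc bounded_linear_compose[OF _ bounded_linear_sndS]\<close>)
  qed
  from this[OF open_fstS[OF assms(1)] bounded_linear_compose[OF assms(2) bounded_linear_sndS]]
  show ?thesis unfolding Suc
    by (intro Ck_SucI[where f'="\<lambda>x. l"]) (use assms in \<open>auto intro!: bounded_linear_imp_has_derivative\<close>)
qed

text \<open>The chain rule in the form T(f \<circ> g) = Tf \<circ> Tg: the derivative of the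
  composite is the derivative function of \<open>f\<close> composed with the tangent map
  \<open>?G\<close> of \<open>g\<close>, which is one order lower on both sides.\<close>

lemma Ck_compose:
  fixes g :: "'a::real_normed_vector seq \<Rightarrow> 'b::real_normed_vector seq"
  assumes "open U" "open V" "g ` U \<subseteq> V" "Ck k V f" "Ck k U g"
  shows "Ck k U (\<lambda>x. f (g x))"
  using assms
proof (induction k arbitrary: U V f g)
  case 0 then show ?case by (auto intro!: continuous_on_compose2[of V f])
next
  case (Suc k)
  from Suc.prems(4) obtain f' where f': "\<And>x. x \<in> V \<Longrightarrow> (f has_derivative f' x) (at x)"
    "Ck k (fstS -` V) (\<lambda>z. f' (fstS z) (sndS z))" by (rule Ck_SucE) blast
  from Suc.prems(5) obtain g' where g': "\<And>x. x \<in> U \<Longrightarrow> (g has_derivative g' x) (at x)"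
    "Ck k (fstS -` U) (\<lambda>z. g' (fstS z) (sndS z))" by (rule Ck_SucE) blast
  let ?G = "\<lambda>z. pairS (g (fstS z)) (g' (fstS z) (sndS z))"
  have "Ck k (fstS -` U) (\<lambda>z. g (fstS z))"
    using Ck_linear_inner[OF bounded_linear_fstS] Suc.prems Ck_Suc_imp by blast
  from Ck_linear_outer[OF bounded_linear_pairS _ Ck_Pair[OF _ this g'(2)]]
  have G: "Ck k (fstS -` U) ?G" using Suc.prems open_fstS by auto
  show ?case
  proof (rule Ck_SucI)
    show "((\<lambda>x. f (g x)) has_derivative (\<lambda>h. f' (g x) (g' x h))) (at x)" if "x \<in> U" for x
      using has_derivative_compose[OF g'(1)[OF that], of f "f' (g x)"] f'(1)[of "g x"] that Suc.prems
      by auto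
    show "Ck k (fstS -` U) (\<lambda>z. f' (g (fstS z)) (g' (fstS z) (sndS z)))"
    proof -
      have "?G ` (fstS -` U) \<subseteq> fstS -` V" using Suc.prems(3) by auto
      from Suc.IH[OF open_fstS open_fstS this f'(2) G] Suc.prems(1,2) show ?thesis by simp
    qed
  qed (use Suc in auto)
qed

section \<open>Smoothness and the tangent functor\<close>

abbreviation coord0 :: "'a::real_normed_vector seq \<Rightarrow> 'a" where
  "coord0 z \<equiv> apply_bcontfun z 0"

lemma Ck_add:
  assumes "open U" "Ck k U f" "Ck k U g"
  shows "Ck k U (\<lambda>x. f x + g x)"
  using Ck_linear_outer[OF bounded_linear_add[OF bounded_linear_fst bounded_linear_snd] assms(1) Ck_Pair[OF assms]]
  by simp

lemma Ck_sum:
  assumes "open U" "\<And>i. i \<in> I \<Longrightarrow> Ck k U (f i)"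
  shows "Ck k U (\<lambda>x. \<Sum>i\<in>I. f i x)"
  using assms(2)
  by (induction I rule: infinite_finite_induct) (auto intro!: Ck_const Ck_add assms(1))

text \<open>
  Differentiability at \<open>z0\<close>, in operator norm, of a family \<open>H\<close> of \<open>n\<close>-linear maps. Inserting a
  linear function of \<open>z\<close> into the first argument lowers \<open>n\<close> by one, which differentiates
  \<open>z \<mapsto> H z [q\<^sub>1 z, \<dots>, q\<^sub>n z]\<close> by induction.
\<close>

definition multilinear_family_diff ::
    "nat \<Rightarrow> ('z::real_normed_vector \<Rightarrow> 'a::real_normed_vector list \<Rightarrow> 'b::real_normed_vector) \<Rightarrow>
     ('z \<Rightarrow> 'a list \<Rightarrow> 'b) \<Rightarrow> 'z \<Rightarrow> bool" where
  "multilinear_family_diff n H H' z0 \<longleftrightarrow>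
     (\<forall>e>0. \<exists>d>0. \<forall>z. norm (z - z0) < d \<longrightarrow> (\<forall>vs. length vs = n \<longrightarrow>
        norm (H z vs - H z0 vs - H' (z - z0) vs) \<le> e * norm (z - z0) * prod_list (map norm vs))) \<and>
     bounded_multilinear n (H z0) \<and>
     (\<forall>h. \<forall>i<n. \<forall>vs. length vs = n \<longrightarrow> linear (\<lambda>v. H' h (vs[i := v]))) \<and>
     (\<forall>vs. length vs = n \<longrightarrow> linear (\<lambda>h. H' h vs)) \<and>
     (\<exists>C. \<forall>h vs. length vs = n \<longrightarrow> norm (H' h vs) \<le> C * norm h * prod_list (map norm vs))"

lemma prod_list_norm_nonneg [simp]: "0 \<le> prod_list (map norm vs)"
  by (induction vs) auto

text \<open>With h = z - z0, the error of the product rule is the error of \<open>H\<close> itself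
  at the argument \<open>q z\<close>, plus the term \<open>H' h (q h # us)\<close>, which is
  quadratic in h. Each is kept below half of the allowed bound.\<close>

lemma multilinear_family_diff_peel:
  fixes H :: "'z::real_normed_vector \<Rightarrow> 'a::real_normed_vector list \<Rightarrow> 'b::real_normed_vector"
  assumes UD: "multilinear_family_diff (Suc n) H H' z0" and q: "bounded_linear q"
  shows "multilinear_family_diff n (\<lambda>z us. H z (q z # us)) (\<lambda>h us. H' h (q z0 # us) + H z0 (q h # us)) z0"
proof -
  obtain Kq where Kq: "Kq > 0" "\<And>x. norm (q x) \<le> norm x * Kq"
    using bounded_linear.pos_bounded[OF q] by blast
  note lq = bounded_linear.linear[OF q]
  obtain C0 where C0: "\<And>vs. length vs = Suc n \<Longrightarrow> norm (H z0 vs) \<le> C0 * prod_list (map norm vs)"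
    using UD by (auto simp: multilinear_family_diff_def bounded_multilinear_def)
  obtain C1 where C1: "\<And>h vs. length vs = Suc n \<Longrightarrow> norm (H' h vs) \<le> C1 * norm h * prod_list (map norm vs)"
    using UD by (auto simp: multilinear_family_diff_def)
  have linH: "linear (\<lambda>v. H z0 (vs[i := v]))" if "i < Suc n" "length vs = Suc n" for vs i
    using UD that by (auto simp: multilinear_family_diff_def bounded_multilinear_def)
  have linH': "linear (\<lambda>v. H' h (vs[i := v]))" if "i < Suc n" "length vs = Suc n" for vs i h
    using UD that by (auto simp: multilinear_family_diff_def bounded_multilinear_def)
  have linh: "linear (\<lambda>h. H' h vs)" if "length vs = Suc n" for vs
    using UD that by (auto simp: multilinear_family_diff_def)
  have lin0: "linear (\<lambda>v. H z0 (v # us))" "linear (\<lambda>v. H' h (v # us))" if "length us = n" for us h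
    using linH[of 0 "0 # us"] linH'[of 0 "0 # us" h] that by auto
  have linS: "linear (\<lambda>v. H z0 (a # us[i := v]))" "linear (\<lambda>v. H' h (a # us[i := v]))"
    if "length us = n" "i < n" for us i h a
    using linH[of "Suc i" "a # us"] linH'[of "Suc i" "a # us" h] that by auto
  have diff: "\<exists>d>0. \<forall>z. norm (z - z0) < d \<longrightarrow> (\<forall>vs. length vs = n \<longrightarrow>
        norm (H z (q z # vs) - H z0 (q z0 # vs) - (H' (z - z0) (q z0 # vs) + H z0 (q (z - z0) # vs)))
        \<le> e * norm (z - z0) * prod_list (map norm vs))" if "e > 0" for e
  proof -
    define B where "B = norm (q z0) + Kq"
    have B: "B > 0" using Kq by (simp add: B_def add_nonneg_pos)
    define C where "C = max C1 1"
    have C: "C > 0" "C1 \<le> C" by (auto simp: C_def)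
    from B that have "e / (2 * B) > 0" by simp
    then obtain d where d: "d > 0" "\<And>z vs. norm (z - z0) < d \<Longrightarrow> length vs = Suc n \<Longrightarrow>
        norm (H z vs - H z0 vs - H' (z - z0) vs) \<le> e / (2 * B) * norm (z - z0) * prod_list (map norm vs)"
      using UD unfolding multilinear_family_diff_def by metis
    \<comment> \<open>The bound \<open>d\<close> controls the error of \<open>H\<close>, the bound 1
      gives \<open>norm (q z) \<le> B\<close>, and the last one turns the quadratic term, at most C
      * Kq * (norm h)^2 times the norms of the other arguments, into \<open>e / 2 * norm h\<close>
      times them.\<close>
    define r where "r = min d (min 1 (e / (2 * C * Kq)))"
    have r: "r > 0" using d C Kq that by (simp add: r_def)
    show ?thesis
    proof (intro exI[of _ r] conjI r allI impI)
      fix z vs assume z: "norm (z - z0) < r" and vs: "length (vs::'a list) = n"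
      define h where "h = z - z0"
      define w where "w = prod_list (map norm vs)"
      have w: "w \<ge> 0" by (simp add: w_def)
      have zz: "z = z0 + h" by (simp add: h_def)
      have qz: "q z = q z0 + q h" by (simp add: zz linear_add[OF lq])
      have "norm (q z) \<le> norm (q z0) + norm h * Kq"
        unfolding qz using Kq(2)[of h] norm_triangle_ineq[of "q z0" "q h"] by linarith
      also have "\<dots> \<le> B"
      proof -
        have "norm h * Kq \<le> 1 * Kq" using z Kq by (intro mult_right_mono) (auto simp: h_def r_def)
        then show ?thesis by (simp add: B_def)
      qed
      finally have nqz: "norm (q z) \<le> B" .
      have t1: "norm (H z (q z # vs) - H z0 (q z # vs) - H' h (q z # vs)) \<le> e / 2 * norm h * w"
      proof -
        have "norm (H z (q z # vs) - H z0 (q z # vs) - H' h (q z # vs))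
            \<le> e / (2 * B) * norm h * (norm (q z) * w)"
          using d(2)[of z "q z # vs"] z vs by (simp add: r_def h_def w_def)
        also have "\<dots> \<le> e / (2 * B) * norm h * (B * w)"
          using that B w nqz by (intro mult_left_mono mult_right_mono) auto
        also have "\<dots> = e / 2 * norm h * w" using B by simp
        finally show ?thesis .
      qed
      have t2: "norm (H' h (q h # vs)) \<le> e / 2 * norm h * w"
      proof -
        have "norm (H' h (q h # vs)) \<le> C1 * norm h * (norm (q h) * w)"
          using C1[of "q h # vs" h] vs by (simp add: w_def)
        also have "\<dots> \<le> C * norm h * (norm (q h) * w)"
          using C w by (intro mult_right_mono) auto
        also have "\<dots> \<le> C * norm h * (norm h * Kq * w)"
          using C w Kq by (intro mult_left_mono mult_right_mono) auto
        also have "\<dots> \<le> C * norm h * (e / (2 * C * Kq) * Kq * w)"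
          using C w Kq z by (intro mult_left_mono mult_right_mono) (auto simp: r_def h_def)
        also have "\<dots> = e / 2 * norm h * w" using C Kq by simp
        finally show ?thesis .
      qed
      have e1: "H z0 (q z # vs) = H z0 (q z0 # vs) + H z0 (q h # vs)"
        "H' h (q z # vs) = H' h (q z0 # vs) + H' h (q h # vs)"
        using linear_add[OF lin0(1)[OF vs], of "q z0" "q h"] linear_add[OF lin0(2)[OF vs], of h "q z0" "q h"]
        by (simp_all add: qz)
      have "H z (q z # vs) - H z0 (q z0 # vs) - (H' h (q z0 # vs) + H z0 (q h # vs))
        = (H z (q z # vs) - H z0 (q z # vs) - H' h (q z # vs)) + H' h (q h # vs)"
        by (simp add: e1)
      also have "norm \<dots> \<le> e / 2 * norm h * w + e / 2 * norm h * w"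
        by (intro norm_triangle_le add_mono t1 t2)
      finally show "norm (H z (q z # vs) - H z0 (q z0 # vs) - (H' (z - z0) (q z0 # vs) + H z0 (q (z - z0) # vs)))
        \<le> e * norm (z - z0) * prod_list (map norm vs)"
        by (simp add: h_def w_def mult_ac)
    qed
  qed
  moreover have "bounded_multilinear n (\<lambda>us. H z0 (q z0 # us))"
    unfolding bounded_multilinear_def
  proof (intro conjI allI impI exI[of _ "C0 * norm (q z0)"])
    fix vs :: "'a list" assume "length vs = n"
    then show "norm (H z0 (q z0 # vs)) \<le> C0 * norm (q z0) * prod_list (map norm vs)"
      using C0[of "q z0 # vs"] by (simp add: mult.assoc)
  qed (use linS in auto)
  moreover have "linear (\<lambda>v. H' h (q z0 # us[i := v]) + H z0 (q h # us[i := v]))"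
    if "length us = n" "i < n" for us i h
    using linS that by (intro linear_compose_add) auto
  moreover have "linear (\<lambda>h. H' h (q z0 # us) + H z0 (q h # us))" if "length us = n" for us
    using linh[of "q z0 # us"] that linear_compose[OF lq lin0(1)[OF that]]
    by (intro linear_compose_add) (auto simp: o_def)
  moreover have "\<exists>C. \<forall>h us. length us = n \<longrightarrow>
      norm (H' h (q z0 # us) + H z0 (q h # us)) \<le> C * norm h * prod_list (map norm us)"
  proof (intro exI[of _ "C1 * norm (q z0) + \<bar>C0\<bar> * Kq"] allI impI)
    fix h us assume us: "length (us :: 'a list) = n"
    let ?w = "prod_list (map norm us)"
    have "norm (H z0 (q h # us)) \<le> C0 * (norm (q h) * ?w)" using C0[of "q h # us"] us by simp
    also have "\<dots> \<le> \<bar>C0\<bar> * (norm (q h) * ?w)" by (intro mult_right_mono) auto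
    also have "\<dots> \<le> \<bar>C0\<bar> * (norm h * Kq * ?w)" using Kq by (intro mult_left_mono mult_right_mono) auto
    finally have a: "norm (H z0 (q h # us)) \<le> \<bar>C0\<bar> * (norm h * Kq * ?w)" .
    have "norm (H' h (q z0 # us)) \<le> C1 * norm h * (norm (q z0) * ?w)" using C1[of "q z0 # us" h] us by simp
    with a norm_triangle_ineq[of "H' h (q z0 # us)" "H z0 (q h # us)"]
    show "norm (H' h (q z0 # us) + H z0 (q h # us)) \<le> (C1 * norm (q z0) + \<bar>C0\<bar> * Kq) * norm h * ?w"
      by (simp add: algebra_simps)
  qed
  ultimately show ?thesis unfolding multilinear_family_diff_def by blast
qed

lemma multilinear_family_diff_has_derivative:
  fixes H :: "'z::real_normed_vector \<Rightarrow> 'a::real_normed_vector list \<Rightarrow> 'b::real_normed_vector"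
  assumes "multilinear_family_diff (length qs) H H' z0" "\<forall>q\<in>set qs. bounded_linear q"
  shows "((\<lambda>z. H z (map (\<lambda>q. q z) qs)) has_derivative
     (\<lambda>h. H' h (map (\<lambda>q. q z0) qs) +
        (\<Sum>i<length qs. H z0 ((map (\<lambda>q. q z0) qs)[i := (qs ! i) h])))) (at z0)"
  using assms
proof (induction qs arbitrary: H H')
  case Nil
  obtain C where C: "\<And>h. norm (H' h []) \<le> C * norm h"
    using Nil(1) by (auto simp: multilinear_family_diff_def)
  have bl: "bounded_linear (\<lambda>h. H' h [])"
    using Nil(1) C by (intro linear_conv_bounded_linear[THEN iffD1] bounded_linear.intro
        bounded_linear_axioms.intro exI[of _ C]) (auto simp: multilinear_family_diff_def mult.commute)
  show ?case
    unfolding has_derivative_at_alt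
  proof (intro conjI allI impI)
    fix e :: real assume "e > 0"
    then obtain d where "d > 0" "\<And>z vs. norm (z - z0) < d \<Longrightarrow> length (vs::'a list) = 0 \<Longrightarrow>
        norm (H z vs - H z0 vs - H' (z - z0) vs) \<le> e * norm (z - z0) * prod_list (map norm vs)"
      using Nil(1) unfolding multilinear_family_diff_def by (metis list.size(3))
    from this(1) this(2)[of _ "[]"] show "\<exists>d>0. \<forall>y. norm (y - z0) < d \<longrightarrow>
       norm (H y (map (\<lambda>q. q y) []) - H z0 (map (\<lambda>q. q z0) []) -
         (H' (y - z0) (map (\<lambda>q. q z0) []) + (\<Sum>i<length []. H z0 ((map (\<lambda>q. q z0) [])[i := ([] ! i) (y - z0)]))))
       \<le> e * norm (y - z0)" by auto
  qed (use bl in auto)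
next
  case (Cons q qs)
  have "multilinear_family_diff (length qs) (\<lambda>z us. H z (q z # us)) (\<lambda>h us. H' h (q z0 # us) + H z0 (q h # us)) z0"
    using Cons.prems by (intro multilinear_family_diff_peel) auto
  from Cons.IH[OF this] Cons.prems show ?case
    by (simp add: sum.lessThan_Suc_shift add.assoc del: sum.lessThan_Suc)
qed

text \<open>The linear functions \<open>p\<close> and \<open>qs\<close> make the claim stable under
  differentiation. The derivative is a sum of expressions of the same shape: one with the new slot
  \<open>p h\<close> in front, and for each i one with slot i replaced by \<open>(qs ! i) h\<close>.
  On the doubled space every slot is again a linear function, composed with \<open>fstS\<close> or
  \<open>sndS\<close>.\<close>

lemma Ck_multilinear_eval:
  fixes D :: "'a::real_normed_vector \<Rightarrow> 'a list \<Rightarrow> 'b::real_normed_vector"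
    and p :: "'a seq \<Rightarrow> 'a"
  assumes S: "open S"
    and ml: "\<And>n x. x \<in> S \<Longrightarrow> bounded_multilinear n (D x)"
    and df: "\<And>n x e. x \<in> S \<Longrightarrow> e > 0 \<Longrightarrow> \<exists>d>0. \<forall>y\<in>S. norm (y - x) < d \<longrightarrow>
           (\<forall>vs. length vs = n \<longrightarrow>
              norm (D y vs - D x vs - D x ((y - x) # vs))
                \<le> e * norm (y - x) * prod_list (map norm vs))"
    and p: "bounded_linear p" and qs: "\<forall>q\<in>set qs. bounded_linear q"
  shows "Ck k (p -` S) (\<lambda>z. D (p z) (map (\<lambda>q. q z) qs))"
proof -
  let ?V = "\<lambda>p qs z h. D (p z) (p h # map (\<lambda>q. q z) qs) +
        (\<Sum>i<length qs. D (p z) ((map (\<lambda>q. q z) qs)[i := (qs ! i) h]))"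
  have der: "((\<lambda>z. D (p z) (map (\<lambda>q. q z) qs)) has_derivative ?V p qs z0) (at z0)"
    if "bounded_linear p" "\<forall>q\<in>set qs. bounded_linear q" "z0 \<in> p -` S" for p :: "'a seq \<Rightarrow> 'a" and qs z0
  proof -
    define n where "n = length qs"
    have x: "p z0 \<in> S" using that by simp
    note bp = that(1)
    note lp = bounded_linear.linear[OF bp]
    obtain K where K: "K > 0" "\<And>x. norm (p x) \<le> norm x * K"
      using bounded_linear.pos_bounded[OF bp] by blast
    obtain r where r: "r > 0" "\<And>y. norm (y - p z0) < r \<Longrightarrow> y \<in> S"
      using S x by (metis open_dist dist_norm)
    obtain C where C: "\<And>vs. length vs = Suc n \<Longrightarrow> norm (D (p z0) vs) \<le> C * prod_list (map norm vs)"
      using ml[OF x, of "Suc n"] by (auto simp: bounded_multilinear_def)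
    have lin: "linear (\<lambda>v. D (p z0) (vs[i := v]))" if "i < m" "length vs = m" for vs i m
      using ml[OF x, of m] that by (auto simp: bounded_multilinear_def)
    have "multilinear_family_diff n (\<lambda>z. D (p z)) (\<lambda>h vs. D (p z0) (p h # vs)) z0"
      unfolding multilinear_family_diff_def
    proof (intro conjI allI impI)
      fix e :: real assume e: "e > 0"
      then have "e / K > 0" using K by simp
      from df[OF x this, of n] obtain d where d: "d > 0" "\<And>y vs. y \<in> S \<Longrightarrow> norm (y - p z0) < d \<Longrightarrow> length vs = n \<Longrightarrow>
            norm (D y vs - D (p z0) vs - D (p z0) ((y - p z0) # vs)) \<le> e / K * norm (y - p z0) * prod_list (map norm vs)"
        by metis
      show "\<exists>d>0. \<forall>z. norm (z - z0) < d \<longrightarrow> (\<forall>vs. length vs = n \<longrightarrow>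
        norm (D (p z) vs - D (p z0) vs - D (p z0) (p (z - z0) # vs)) \<le> e * norm (z - z0) * prod_list (map norm vs))"
      proof (intro exI[of _ "min d r / K"] conjI allI impI)
        show "0 < min d r / K" using d r K by simp
        fix z vs assume z: "norm (z - z0) < min d r / K" and vs: "length (vs::'a list) = n"
        have "norm (p (z - z0)) \<le> norm (z - z0) * K" by (rule K)
        moreover have "norm (z - z0) * K < min d r" using z K by (simp add: pos_less_divide_eq)
        moreover have eq: "p z - p z0 = p (z - z0)" using linear_diff[OF lp] by simp
        ultimately have "norm (p z - p z0) < d" "p z \<in> S" using r by auto
        from d(2)[OF this(2,1) vs]
        have "norm (D (p z) vs - D (p z0) vs - D (p z0) (p (z - z0) # vs)) \<le> e / K * norm (p (z - z0)) * prod_list (map norm vs)"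
          by (simp add: eq)
        also have "\<dots> \<le> e / K * (norm (z - z0) * K) * prod_list (map norm vs)"
          using K e by (intro mult_left_mono mult_right_mono) auto
        also have "\<dots> = e * norm (z - z0) * prod_list (map norm vs)" using K by simp
        finally show "norm (D (p z) vs - D (p z0) vs - D (p z0) (p (z - z0) # vs)) \<le> e * norm (z - z0) * prod_list (map norm vs)" .
      qed
    next
      show "bounded_multilinear n (D (p z0))" by (rule ml[OF x])
    next
      fix h i and vs :: "'a list" assume "i < n" "length vs = n"
      then show "linear (\<lambda>v. D (p z0) (p h # vs[i := v]))" using lin[of "Suc i" "Suc n" "p h # vs"] by simp
    next
      fix vs :: "'a list" assume "length vs = n"
      then show "linear (\<lambda>h. D (p z0) (p h # vs))"
        using linear_compose[OF lp lin[of 0 "Suc n" "0 # vs"]] by (simp add: o_def)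
    next
      show "\<exists>C. \<forall>h vs. length vs = n \<longrightarrow>
          norm (D (p z0) (p h # vs)) \<le> C * norm h * prod_list (map norm vs)"
      proof (intro exI[of _ "\<bar>C\<bar> * K"] allI impI)
      fix h and vs :: "'a list" assume "length vs = n"
      then have "norm (D (p z0) (p h # vs)) \<le> C * (norm (p h) * prod_list (map norm vs))"
        using C[of "p h # vs"] by simp
      also have "\<dots> \<le> \<bar>C\<bar> * (norm (p h) * prod_list (map norm vs))" by (intro mult_right_mono) auto
      also have "\<dots> \<le> \<bar>C\<bar> * (norm h * K * prod_list (map norm vs))"
        using K by (intro mult_left_mono mult_right_mono) auto
      finally show "norm (D (p z0) (p h # vs)) \<le> \<bar>C\<bar> * K * norm h * prod_list (map norm vs)"
        by (simp add: mult_ac)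
      qed
    qed
    then show ?thesis using multilinear_family_diff_has_derivative[of qs "\<lambda>z. D (p z)"] that(2)
      by (simp add: n_def)
  qed
  show ?thesis using p qs
  proof (induction k arbitrary: p qs)
    case 0
    then show ?case
      using der[OF 0] by (auto intro!: continuous_at_imp_continuous_on has_derivative_continuous)
  next
    case (Suc k)
    have op: "open (fstS -` (p -` S))"
      by (intro open_fstS open_vimage_linear S Suc.prems)
    have lf: "bounded_linear (\<lambda>z. q (fstS z))" "bounded_linear (\<lambda>z. q (sndS z))"
      if "bounded_linear q" for q :: "'a seq \<Rightarrow> 'a"
      using that bounded_linear_compose bounded_linear_fstS bounded_linear_sndS by blast+
    let ?qf = "map (\<lambda>q z. q (fstS z)) qs"
    have lqf: "\<forall>q\<in>set ?qf. bounded_linear q" using Suc.prems(2) lf by auto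
    show ?case
    proof (rule Ck_SucI)
      show "open (p -` S)" using open_vimage_linear S Suc.prems by blast
      show "((\<lambda>z. D (p z) (map (\<lambda>q. q z) qs)) has_derivative ?V p qs z) (at z)" if "z \<in> p -` S" for z
        by (rule der[OF Suc.prems that])
      have "Ck k ((\<lambda>z. p (fstS z)) -` S) (\<lambda>z. D (p (fstS z)) (map (\<lambda>q. q z) ((\<lambda>z. p (sndS z)) # ?qf)))"
        by (intro Suc.IH) (use Suc.prems(1) lf lqf in auto)
      moreover have "Ck k ((\<lambda>z. p (fstS z)) -` S)
          (\<lambda>z. D (p (fstS z)) (map (\<lambda>q. q z) (?qf[i := \<lambda>z. (qs ! i) (sndS z)])))" if "i < length qs" for i
        using Suc.prems that lf lqf set_update_subset_insert[of ?qf i "\<lambda>z. (qs ! i) (sndS z)"]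
        by (intro Suc.IH) auto
      ultimately show "Ck k (fstS -` p -` S) (\<lambda>z. ?V p qs (fstS z) (sndS z))"
        by (intro Ck_add Ck_sum op) (auto simp: map_update comp_def vimage_def)
    qed
  qed
qed

lemma smooth_on_imp_Ck:
  fixes f :: "'a::real_normed_vector \<Rightarrow> 'b::real_normed_vector"
  assumes "smooth_on S f"
  shows "Ck k (coord0 -` S) (\<lambda>z. f (z 0))"
proof -
  obtain D where S: "open S" and D: "\<forall>x\<in>S. D x [] = f x" "\<And>n x. x \<in> S \<Longrightarrow> bounded_multilinear n (D x)"
    "\<And>n x e. x \<in> S \<Longrightarrow> e > 0 \<Longrightarrow> \<exists>d>0. \<forall>y\<in>S. norm (y - x) < d \<longrightarrow>
           (\<forall>vs. length vs = n \<longrightarrow>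
              norm (D y vs - D x vs - D x ((y - x) # vs))
                \<le> e * norm (y - x) * prod_list (map norm vs))"
    using assms unfolding smooth_on_def by metis
  have "Ck k (coord0 -` S) (\<lambda>z. D (coord0 z) (map (\<lambda>q. q z) ([] :: ('a seq \<Rightarrow> 'a) list)))"
    by (rule Ck_multilinear_eval[OF S D(2,3) bounded_linear_apply]) auto
  then show ?thesis
    by (rule Ck_cong[THEN iffD1, rotated -1])
      (use D(1) open_vimage_linear[OF bounded_linear_apply S] in auto)
qed


section \<open>From iterated tangent maps back to bounded multilinear derivatives\<close>

lemma single_0 [simp]: "single 0 = 0"
  by (auto intro!: bcontfun_eqI)

text \<open>The head of the list is the direction of the last differentiation, as in the term
  \<open>D x ((y - x) # vs)\<close> of \<open>smooth_on\<close>.\<close>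

primrec iter_deriv :: "('a::real_normed_vector \<Rightarrow> 'b::real_normed_vector) \<Rightarrow> 'a list \<Rightarrow> 'a \<Rightarrow> 'b" where
  "iter_deriv f [] = f"
| "iter_deriv f (v # vs) = (\<lambda>x. frechet_derivative (iter_deriv f vs) (at x) v)"

definition seq_of_list :: "'a::real_normed_vector list \<Rightarrow> 'a seq" where
  "seq_of_list xs = Bcontfun (\<lambda>i. if i < length xs then xs ! i else 0)"

lemma seq_of_list_apply [simp]: "seq_of_list xs i = (if i < length xs then xs ! i else 0)"
  unfolding seq_of_list_def
  by (subst apply_Bcontfun_nat[where b="sum_list (map norm xs)"])
    (auto intro!: member_le_sum_list sum_list_nonneg)

text \<open>Linear dependence on a parameter survives differentiation in another variable. This
  carries linearity in the later slots of \<open>iter_deriv\<close> through the outer derivatives,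
  while linearity in the head is that of the derivative itself.\<close>

lemma linear_frechet_derivative_param:
  assumes "open S" "x \<in> S" "\<And>y. y \<in> S \<Longrightarrow> linear (\<lambda>v. F v y)"
    "\<And>v. F v differentiable (at x)"
  shows "linear (\<lambda>v. frechet_derivative (F v) (at x) a)"
proof (rule linearI)
  fix v w c
  have d: "(F v has_derivative frechet_derivative (F v) (at x)) (at x)" for v
    using assms(4) frechet_derivative_works by blast
  have "((\<lambda>y. F v y + F w y) has_derivative (\<lambda>h. frechet_derivative (F v) (at x) h + frechet_derivative (F w) (at x) h)) (at x)"
    by (intro derivative_intros d)
  then have "(F (v + w) has_derivative (\<lambda>h. frechet_derivative (F v) (at x) h + frechet_derivative (F w) (at x) h)) (at x)"
    by (rule has_derivative_open_cong[OF assms(1,2), THEN iffD1, rotated])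
      (use linear_add[OF assms(3)] in auto)
  from frechet_derivative_at[OF this]
  show "frechet_derivative (F (v + w)) (at x) a = frechet_derivative (F v) (at x) a + frechet_derivative (F w) (at x) a"
    by metis
  have "((\<lambda>y. c *\<^sub>R F v y) has_derivative (\<lambda>h. c *\<^sub>R frechet_derivative (F v) (at x) h)) (at x)"
    by (intro derivative_intros d)
  then have "(F (c *\<^sub>R v) has_derivative (\<lambda>h. c *\<^sub>R frechet_derivative (F v) (at x) h)) (at x)"
    by (rule has_derivative_open_cong[OF assms(1,2), THEN iffD1, rotated])
      (use linear_scale[OF assms(3)] in auto)
  from frechet_derivative_at[OF this]
  show "frechet_derivative (F (c *\<^sub>R v)) (at x) a = c *\<^sub>R frechet_derivative (F v) (at x) a"
    by metis
qed

lemma multilinear_scale: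
  assumes "\<And>i vs. i < n \<Longrightarrow> length vs = n \<Longrightarrow> linear (\<lambda>v. M (vs[i := v]))"
    "length us + length vs = n"
  shows "M (us @ map (\<lambda>v. c v *\<^sub>R v) vs) = prod_list (map c vs) *\<^sub>R M (us @ vs)"
  using assms(2)
proof (induction vs arbitrary: us)
  case (Cons v vs)
  have "M (us @ map (\<lambda>v. c v *\<^sub>R v) (v # vs)) = M ((us @ [c v *\<^sub>R v]) @ map (\<lambda>v. c v *\<^sub>R v) vs)" by simp
  also have "\<dots> = prod_list (map c vs) *\<^sub>R M (us @ (c v *\<^sub>R v) # vs)"
    using Cons.IH[of "us @ [c v *\<^sub>R v]"] Cons.prems by simp
  also have "M (us @ (c v *\<^sub>R v) # vs) = c v *\<^sub>R M (us @ v # vs)"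
    using linear_scale[OF assms(1)[of "length us" "us @ v # vs"], of "c v" v] Cons.prems
    by (simp add: list_update_append)
  finally show ?case by (simp add: mult.commute)
qed simp

text \<open>Coordinate 0 of \<open>z\<close> is the base point and coordinates 1 to n are the
  directions, so a single function on sequences carries the n-th derivative jointly in all its
  variables. Moving only the base point in it produces the next derivative.\<close>

lemma Ck_iter_deriv:
  fixes f :: "'a::real_normed_vector \<Rightarrow> 'b::real_normed_vector"
  assumes S: "open S" and f: "\<And>k. Ck k (coord0 -` S) (\<lambda>z. f (coord0 z))"
  shows "Ck k (coord0 -` S)
      (\<lambda>z. iter_deriv f (map (apply_bcontfun z) [1..<Suc n]) (coord0 z))" (is "Ck k ?U _")
    and "\<And>x vs. x \<in> S \<Longrightarrow> length vs = n \<Longrightarrow> iter_deriv f vs differentiable (at x)"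
proof -
  let ?phi = "\<lambda>n (z::'a seq). iter_deriv f (map z [1..<Suc n]) (z 0)"
  have opU: "open ?U" using open_vimage_linear[OF bounded_linear_apply S] .
  \<comment> \<open>Deletes coordinate 1: the base point stays and the directions from coordinate 2
    on move down by one.\<close>
  let ?r = "reindex (\<lambda>m. if m = 0 then 0 else Suc m) :: 'a seq \<Rightarrow> 'a seq"
  have map_r: "map (?r z) [1..<Suc n] = map z [2..<Suc (Suc n)]" for n z
    by (rule nth_equalityI) (auto simp del: upt_Suc)
  have der: "(iter_deriv f vs has_derivative (\<lambda>h. P' (single h))) (at x)"
    if P: "(?phi n has_derivative P') (at Z)" "Z 0 = x" "map Z [1..<Suc n] = vs" for n P' Z x vs
  proof -
    have "((\<lambda>y. Z + single (y - x)) has_derivative single) (at x)"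
      by (auto intro!: derivative_eq_intros bounded_linear.has_derivative[OF bounded_linear_single])
    then have "((\<lambda>y. ?phi n (Z + single (y - x))) has_derivative (\<lambda>h. P' (single h))) (at x)"
      by (rule has_derivative_compose[where g="?phi n"])
        (use P(1) in \<open>simp del: upt_Suc\<close>)
    moreover have "?phi n (Z + single (y - x)) = iter_deriv f vs y" for y
    proof -
      have "map (Z + single (y - x)) [1..<Suc n] = vs"
        unfolding that(3)[symmetric] by (rule map_cong) auto
      then show ?thesis using that(2) by simp
    qed
    ultimately show ?thesis by simp
  qed
  have diff: "iter_deriv f vs differentiable (at x)"
    if "Ck 1 ?U (?phi n)" "x \<in> S" "length vs = n" for n x vs
  proof -
    let ?Z = "seq_of_list (x # vs)"
    have "?phi n differentiable (at ?Z)" using that by simp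
    then obtain P' where "(?phi n has_derivative P') (at ?Z)" by (auto simp: differentiable_def)
    moreover have "map ?Z [1..<Suc n] = vs" by (rule nth_equalityI) (use that in \<open>auto simp del: upt_Suc\<close>)
    ultimately show ?thesis using der[of n P' ?Z x vs] by (auto simp: differentiable_def)
  qed
  have main: "Ck k ?U (?phi n)" for k n
  proof (induction n arbitrary: k)
    case 0 then show ?case using f by simp
  next
    case (Suc n)
    from Suc.IH[of "Suc k"] obtain P' where P': "\<And>z. z \<in> ?U \<Longrightarrow> (?phi n has_derivative P' z) (at z)"
      "Ck k (fstS -` ?U) (\<lambda>z. P' (fstS z) (sndS z))" by (rule Ck_SucE) blast
    \<comment> \<open>The point \<open>?r z\<close> holds the base point and the n inner directions,
      and the tangent vector \<open>single (z 1)\<close> moves the base point along the remaining,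
      outermost one. Differentiating \<open>?phi n\<close> there gives
      \<open>?phi (Suc n) z\<close>.\<close>
    let ?m = "\<lambda>z. pairS (?r z) (single (z 1))"
    have lm: "bounded_linear ?m"
      using bounded_linear_compose[OF bounded_linear_pairS bounded_linear_Pair[OF bounded_linear_reindex
        bounded_linear_compose[OF bounded_linear_single bounded_linear_apply]]] by simp
    have eq: "?phi (Suc n) z = P' (?r z) (single (z 1))" if "z \<in> ?U" for z
    proof -
      have "(iter_deriv f (map z [2..<Suc (Suc n)]) has_derivative (\<lambda>h. P' (?r z) (single h))) (at (z 0))"
        by (rule der[of n _ "?r z"]) (use P'(1)[of "?r z"] that map_r in auto)
      from frechet_derivative_at[OF this]
      have "frechet_derivative (iter_deriv f (map z [2..<Suc (Suc n)])) (at (z 0)) = (\<lambda>h. P' (?r z) (single h))"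
        by simp
      moreover have "map z [1..<Suc (Suc n)] = z 1 # map z [2..<Suc (Suc n)]"
        by (subst upt_conv_Cons) (auto simp: numeral_2_eq_2)
      ultimately show ?thesis by simp
    qed
    have "Ck k (?m -` fstS -` ?U) (\<lambda>z. P' (fstS (?m z)) (sndS (?m z)))"
      by (rule Ck_linear_inner[OF lm open_fstS[OF opU] P'(2)])
    also have "?m -` fstS -` ?U = ?U" by auto
    finally show ?case using Ck_cong[OF opU eq, where k=k] by simp
  qed
  show "Ck k ?U (?phi n)" by (rule main)
  show "\<And>x vs. x \<in> S \<Longrightarrow> length vs = n \<Longrightarrow> iter_deriv f vs differentiable (at x)"
    using diff main by blast
qed

text \<open>Joint continuity at a point with all directions 0 bounds a multilinear map for small
  directions, and homogeneity turns this into a bound on its norm, uniform near the point. With such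
  a bound for the derivative of order n + 2, two applications of the mean value inequality give
  differentiability of the n-th derivative in operator norm.\<close>

lemma smooth_onI_Ck:
  fixes f :: "'a::real_normed_vector \<Rightarrow> 'b::real_normed_vector"
  assumes S: "open S" and f: "\<And>k. Ck k (coord0 -` S) (\<lambda>z. f (coord0 z))"
  shows "smooth_on S f"
proof -
  note cont = Ck_iter_deriv(1)[OF S f, of 0, simplified]
  note diff = Ck_iter_deriv(2)[OF S f]
  have lin: "linear (\<lambda>v. iter_deriv f (vs[i := v]) x)" if "i < length vs" "x \<in> S" for vs i x
    using that
  proof (induction vs arbitrary: i x)
    case (Cons a vs)
    show ?case
    proof (cases i)
      case 0
      have "iter_deriv f vs differentiable (at x)" using diff Cons.prems by blast
      then show ?thesis unfolding 0 using linear_frechet_derivative by simp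
    next
      case (Suc j)
      have "linear (\<lambda>v. frechet_derivative (iter_deriv f (vs[j := v])) (at x) a)"
        by (rule linear_frechet_derivative_param[OF S]) (use Cons Suc diff in auto)
      then show ?thesis by (simp add: Suc)
    qed
  qed simp
  have bd: "\<exists>r>0. \<exists>C>0. ball x r \<subseteq> S \<and> (\<forall>y\<in>ball x r. \<forall>vs. length vs = n \<longrightarrow>
      norm (iter_deriv f vs y) \<le> C * prod_list (map norm vs))" if x: "x \<in> S" for x n
  proof -
    let ?phi = "\<lambda>z::'a seq. iter_deriv f (map (apply_bcontfun z) [1..<Suc n]) (z 0)"
    let ?U = "(\<lambda>z::'a seq. z 0) -` S"
    have "open ?U" using open_vimage_linear[OF bounded_linear_apply S] .
    moreover have "single x \<in> ?U" using x by simp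
    ultimately have "continuous (at (single x)) ?phi"
      using cont[of n] by (simp add: continuous_on_eq_continuous_at)
    then obtain d where d: "d > 0" "\<And>z. dist z (single x) < d \<Longrightarrow> dist (?phi z) (?phi (single x)) < 1"
      unfolding continuous_at_eps_delta by (metis dist_commute zero_less_one)
    obtain r0 where r0: "r0 > 0" "ball x r0 \<subseteq> S" using S x open_contains_ball by blast
    define e where "e = min (d / 2) r0"
    have e: "e > 0" "e < d" "e \<le> r0" using d r0 by (auto simp: e_def)
    define C0 where "C0 = norm (?phi (single x)) + 1"
    have C0: "C0 > 0" by (simp add: C0_def add_nonneg_pos)
    have small: "norm (iter_deriv f vs y) \<le> C0"
      if "dist x y < e" "length vs = n" "\<And>v. v \<in> set vs \<Longrightarrow> norm v \<le> e" for y vs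
    proof -
      let ?z = "seq_of_list (y # vs)"
      \<comment> \<open>The norm on sequences is the supremum norm, so the distance is controlled by
        the displacement of the base point and by each direction separately.\<close>
      have "norm (apply_bcontfun (?z - single x) i) \<le> e" for i
        using that e by (auto simp: nth_Cons' dist_norm norm_minus_commute)
      then have "norm (?z - single x) \<le> e" by (rule norm_bound)
      then have "dist ?z (single x) < d" using e by (simp add: dist_norm)
      from d(2)[OF this] have "norm (?phi ?z) \<le> C0"
        unfolding C0_def dist_norm using norm_triangle_sub[of "?phi ?z" "?phi (single x)"] by linarith
      moreover have "map ?z [1..<Suc n] = vs"
        by (rule nth_equalityI) (simp_all add: that(2) del: upt_Suc)
      ultimately show ?thesis by simp
    qed
    \<comment> \<open>Each of the n directions is rescaled to norm \<open>e\<close>, where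
      \<open>small\<close> applies. Lists containing 0 cannot be rescaled and are treated
      apart.\<close>
    define C where "C = C0 / e ^ n"
    have "norm (iter_deriv f vs y) \<le> C * prod_list (map norm vs)" if y: "y \<in> ball x e" and vs: "length vs = n" for y vs
    proof (cases "0 \<in> set vs")
      case True
      then obtain i where i: "i < n" "vs ! i = 0" using vs by (auto simp: in_set_conv_nth)
      have "y \<in> S" using y r0 e by auto
      from linear_0[OF lin[OF _ this, of i vs]] i vs have "iter_deriv f (vs[i := 0]) y = 0" by simp
      moreover have "vs[i := 0] = vs" using i by (metis list_update_id)
      moreover have "prod_list (map norm vs) = 0" using True by (force simp: prod_list_zero_iff)
      ultimately show ?thesis by simp
    next
      case False
      have "y \<in> S" using y r0 e by auto
      let ?c = "\<lambda>v. e / norm v"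
      have "norm (iter_deriv f (map (\<lambda>v. ?c v *\<^sub>R v) vs) y) \<le> C0"
        by (rule small) (use y vs e in auto)
      moreover have "iter_deriv f (map (\<lambda>v. ?c v *\<^sub>R v) vs) y = prod_list (map ?c vs) *\<^sub>R iter_deriv f vs y"
        using multilinear_scale[of n "\<lambda>vs. iter_deriv f vs y" "[]" vs ?c] lin \<open>y \<in> S\<close> vs by simp
      moreover have "prod_list (map ?c vs) = e ^ n / prod_list (map norm vs)"
        unfolding vs[symmetric] by (induction vs) auto
      moreover have "prod_list (map norm vs) > 0" using False by (induction vs) auto
      ultimately show ?thesis using e by (simp add: C_def field_simps)
    qed
    moreover have "C > 0" using C0 e by (simp add: C_def)
    moreover have "ball x e \<subseteq> S" using r0 e by auto
    ultimately show ?thesis using e by blast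
  qed
  have hd: "(iter_deriv f vs has_derivative (\<lambda>h. iter_deriv f (h # vs) x)) (at x)" if "x \<in> S" for x vs
    using diff[OF that, of vs] by (simp add: frechet_derivative_works)
  have unif: "\<exists>d>0. \<forall>y\<in>S. norm (y - x) < d \<longrightarrow> (\<forall>vs. length vs = n \<longrightarrow>
              norm (iter_deriv f vs y - iter_deriv f vs x - iter_deriv f ((y - x) # vs) x)
                \<le> e * norm (y - x) * prod_list (map norm vs))" if x: "x \<in> S" and e: "e > 0" for x n e
  proof -
    obtain r C where rC: "r > 0" "C > 0" "ball x r \<subseteq> S"
      "\<And>y vs. y \<in> ball x r \<Longrightarrow> length vs = Suc (Suc n) \<Longrightarrow> norm (iter_deriv f vs y) \<le> C * prod_list (map norm vs)"
      using bd[OF x, of "Suc (Suc n)"] by metis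
    show ?thesis
    \<comment> \<open>Here \<open>C\<close> bounds the derivative of order n + 2, and the remainder
      turns out to be at most C * (norm (y - x))^2 times the norms of \<open>vs\<close>.\<close>
    proof (intro exI[of _ "min r (e / C)"] conjI ballI allI impI)
      show "min r (e / C) > 0" using rC e by simp
      fix y vs assume y: "y \<in> S" "norm (y - x) < min r (e / C)" and vs: "length (vs :: 'a list) = n"
      let ?w = "prod_list (map norm vs)"
      define h where "h = y - x"
      have sub: "cball x (norm h) \<subseteq> ball x r" using y by (auto simp: h_def)
      have one: "norm (iter_deriv f (k # vs) z - iter_deriv f (k # vs) x) \<le> C * norm k * ?w * norm h"
        if z: "z \<in> cball x (norm h)" for z k
      proof -
        have "norm (iter_deriv f (k # vs) z - iter_deriv f (k # vs) x) \<le> (C * norm k * ?w) * norm (z - x)"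
        proof (rule differentiable_bound[where S="ball x r"])
          fix u assume u: "u \<in> ball x r"
          then show "(iter_deriv f (k # vs) has_derivative (\<lambda>h. iter_deriv f (h # k # vs) u)) (at u within ball x r)"
            using hd rC(3) has_derivative_at_withinI by blast
          show "onorm (\<lambda>h. iter_deriv f (h # k # vs) u) \<le> C * norm k * ?w"
            by (rule onorm_bound) (use rC(2) rC(4)[OF u, of "_ # k # vs"] vs in \<open>auto simp: mult_ac\<close>)
        qed (use z sub rC in auto)
        also have "\<dots> \<le> C * norm k * ?w * norm h"
          using z rC by (intro mult_left_mono) (auto simp: dist_norm norm_minus_commute)
        finally show ?thesis .
      qed
      \<comment> \<open>The n-th derivative minus its candidate linearisation at \<open>x\<close>;
        the derivative of this difference is small on the ball by \<open>one\<close>.\<close>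
      let ?F = "\<lambda>z. iter_deriv f vs z - iter_deriv f ((z - x) # vs) x"
      have "norm (?F y - ?F x) \<le> (C * ?w * norm h) * norm (y - x)"
      proof (rule differentiable_bound[where S="cball x (norm h)"])
        fix u assume u: "u \<in> cball x (norm h)"
        then have uS: "u \<in> S" using sub rC by auto
        have "((\<lambda>z. iter_deriv f ((z - x) # vs) x) has_derivative (\<lambda>k. iter_deriv f (k # vs) x)) (at u)"
        proof (rule has_derivative_compose[where g="\<lambda>k. iter_deriv f (k # vs) x" and f="\<lambda>z. z - x"])
          show "((\<lambda>z. z - x) has_derivative (\<lambda>k. k)) (at u)" by (auto intro!: derivative_eq_intros)
          show "((\<lambda>k. iter_deriv f (k # vs) x) has_derivative (\<lambda>k. iter_deriv f (k # vs) x)) (at (u - x))"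
            by (rule bounded_linear_imp_has_derivative) (rule has_derivative_bounded_linear[OF hd[OF x]])
        qed
        from has_derivative_at_withinI[OF has_derivative_diff[OF hd[OF uS] this]]
        show "(?F has_derivative (\<lambda>k. iter_deriv f (k # vs) u - iter_deriv f (k # vs) x)) (at u within cball x (norm h))" .
        show "onorm (\<lambda>k. iter_deriv f (k # vs) u - iter_deriv f (k # vs) x) \<le> C * ?w * norm h"
          by (rule onorm_bound) (use one[OF u] rC in \<open>auto simp: mult_ac\<close>)
      qed (auto simp: h_def dist_norm norm_minus_commute)
      moreover have "iter_deriv f (0 # vs) x = 0"
        using linear_0[OF bounded_linear.linear[OF has_derivative_bounded_linear[OF hd[OF x]]]] .
      then have "iter_deriv f vs y - iter_deriv f vs x - iter_deriv f ((y - x) # vs) x = ?F y - ?F x"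
        by (simp del: iter_deriv.simps)
      ultimately have "norm (iter_deriv f vs y - iter_deriv f vs x - iter_deriv f ((y - x) # vs) x)
          \<le> C * ?w * norm h * norm (y - x)"
        by (simp only:)
      also have "\<dots> = (C * norm h) * (norm (y - x) * ?w)" by (simp add: mult_ac)
      also have "\<dots> \<le> e * (norm (y - x) * ?w)"
        using y rC e by (intro mult_right_mono) (auto simp: h_def field_simps)
      finally show "norm (iter_deriv f vs y - iter_deriv f vs x - iter_deriv f ((y - x) # vs) x)
                \<le> e * norm (y - x) * ?w" by (simp add: mult.assoc)
    qed
  qed
  have "bounded_multilinear n (\<lambda>vs. iter_deriv f vs x)" if x: "x \<in> S" for n x
  proof -
    obtain r C where "r > 0" "\<forall>y\<in>ball x r. \<forall>vs. length vs = n \<longrightarrow>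
      norm (iter_deriv f vs y) \<le> C * prod_list (map norm vs)"
      using bd[OF x, of n] by blast
    then have "\<forall>vs. length vs = n \<longrightarrow> norm (iter_deriv f vs x) \<le> C * prod_list (map norm vs)"
      by simp
    then show ?thesis unfolding bounded_multilinear_def using lin x by blast
  qed
  then show ?thesis
    unfolding smooth_on_def using S unif
    by (intro conjI exI[of _ "\<lambda>x vs. iter_deriv f vs x"]) simp_all
qed

section \<open>Calculus of smooth maps on open sets\<close>

lemma smooth_on_open: "smooth_on S f \<Longrightarrow> open S"
  by (simp add: smooth_on_def)

lemma smooth_on_iff_Ck:
  "smooth_on S f \<longleftrightarrow> open S \<and> (\<forall>k. Ck k (coord0 -` S) (\<lambda>z. f (coord0 z)))"
  using smooth_onI_Ck[of S f] smooth_on_imp_Ck[of S f] smooth_on_open[of S f] by blast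

lemma open_coord0: "open S \<Longrightarrow> open (coord0 -` S)"
  for S :: "'a::real_normed_vector set"
  using open_vimage_linear[OF bounded_linear_apply] .

lemma smooth_on_cong:
  assumes "\<And>x. x \<in> S \<Longrightarrow> f x = g x"
  shows "smooth_on S f \<longleftrightarrow> smooth_on S g"
proof -
  have "Ck k (coord0 -` S) (\<lambda>z. f (coord0 z))
    \<longleftrightarrow> Ck k (coord0 -` S) (\<lambda>z. g (coord0 z))" if "open S" for k
    by (rule Ck_cong[OF open_coord0[OF that]]) (use assms in auto)
  then show ?thesis unfolding smooth_on_iff_Ck by blast
qed

lemma smooth_on_subset: "smooth_on S f \<Longrightarrow> open T \<Longrightarrow> T \<subseteq> S \<Longrightarrow> smooth_on T f"
  unfolding smooth_on_iff_Ck using Ck_subset[OF _ vimage_mono] by blast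

lemma smooth_on_local:
  assumes "\<And>x. x \<in> S \<Longrightarrow> \<exists>T. x \<in> T \<and> smooth_on T f"
    and "open S"
  shows "smooth_on S f"
  unfolding smooth_on_iff_Ck
proof (intro conjI allI Ck_local)
  fix k z assume "z \<in> coord0 -` S"
  then obtain T where "z 0 \<in> T" "smooth_on T f" using assms by auto
  then show "\<exists>V. open V \<and> z \<in> V \<and> Ck k V (\<lambda>z. f (coord0 z))"
    unfolding smooth_on_iff_Ck
    by (intro exI[of _ "coord0 -` T"]) (auto simp: open_coord0)
qed fact

lemma smooth_on_localI:
  assumes "\<And>x. x \<in> S \<Longrightarrow> \<exists>T. x \<in> T \<and> T \<subseteq> S \<and> smooth_on T f"
  shows "smooth_on S f"
proof (rule smooth_on_local)
  show "open S" by (subst open_subopen) (use assms smooth_on_open in blast)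
qed (use assms in blast)

lemma smooth_on_differentiable:
  fixes f :: "'a::real_normed_vector \<Rightarrow> 'b::real_normed_vector"
  assumes "smooth_on S f" "x \<in> S"
  shows "f differentiable (at x)"
proof -
  have "Ck 1 (coord0 -` S) (\<lambda>z. f (coord0 z))"
    using assms unfolding smooth_on_iff_Ck by blast
  then have "(\<lambda>z. f (coord0 z)) differentiable (at (single x))" using assms by simp
  moreover have "single differentiable (at x)"
    using bounded_linear_single by (rule bounded_linear_imp_differentiable)
  ultimately have "((\<lambda>z. f (coord0 z)) \<circ> single) differentiable (at x)"
    by (intro differentiable_chain_at)
  then show ?thesis by (simp add: o_def)
qed

lemma smooth_on_has_derivative:
  "smooth_on S f \<Longrightarrow> x \<in> S \<Longrightarrow> (f has_derivative frechet_derivative f (at x)) (at x)"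
  using smooth_on_differentiable frechet_derivative_works by blast

lemma smooth_on_compose:
  fixes f :: "'b::real_normed_vector \<Rightarrow> 'c::real_normed_vector"
    and g :: "'a::real_normed_vector \<Rightarrow> 'b"
  assumes "smooth_on T f" "smooth_on S g" "g ` S \<subseteq> T"
  shows "smooth_on S (\<lambda>x. f (g x))"
  unfolding smooth_on_iff_Ck
proof (intro conjI allI)
  fix k
  let ?g = "\<lambda>z. single (g (coord0 z))"
  have S: "open S" "open T" using assms smooth_on_open by auto
  have G: "Ck k (coord0 -` S) ?g"
    using assms(2) unfolding smooth_on_iff_Ck
    by (intro Ck_linear_outer[OF bounded_linear_single] open_coord0) auto
  have F: "Ck k (coord0 -` T) (\<lambda>z. f (coord0 z))"
    using assms(1) unfolding smooth_on_iff_Ck by blast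
  have "?g ` (coord0 -` S) \<subseteq> coord0 -` T" using assms(3) by auto
  from Ck_compose[OF open_coord0[OF S(1)] open_coord0[OF S(2)] this F G]
  show "Ck k (coord0 -` S) (\<lambda>z. f (g (coord0 z)))" by simp
qed (use assms smooth_on_open in blast)

lemma smooth_on_Pair:
  assumes "smooth_on S f" "smooth_on S g"
  shows "smooth_on S (\<lambda>x. (f x, g x))"
  using assms unfolding smooth_on_iff_Ck by (simp add: Ck_Pair open_coord0)

lemma smooth_on_bounded_linear:
  assumes "open S" "bounded_linear l"
  shows "smooth_on S l"
  unfolding smooth_on_iff_Ck
  using assms(1) bounded_linear_compose[OF assms(2) bounded_linear_apply]
  by (simp add: Ck_linear open_coord0)

lemma smooth_on_const: "open S \<Longrightarrow> smooth_on S (\<lambda>_. c)"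
  unfolding smooth_on_iff_Ck by (simp add: Ck_const open_coord0)

lemma smooth_on_derivative:
  fixes f :: "'a::real_normed_vector \<Rightarrow> 'b::real_normed_vector"
  assumes "smooth_on S f"
  shows "smooth_on (S \<times> UNIV) (\<lambda>(x, v). frechet_derivative f (at x) v)"
  unfolding smooth_on_iff_Ck
proof (intro conjI allI)
  have S: "open S" using assms by (rule smooth_on_open)
  then show "open (S \<times> (UNIV :: 'a set))" by (simp add: open_Times)
  fix k
  let ?U = "coord0 -` S"
  \<comment> \<open>Turns the one pair in coordinate 0 into a point of the doubled sequence space,
    whose halves are the base point and the direction.\<close>
  let ?m = "\<lambda>z :: ('a \<times> 'a) seq. pairS (single (fst (z 0))) (single (snd (z 0)))"
  have "Ck (Suc k) ?U (\<lambda>z. f (coord0 z))"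
    using assms unfolding smooth_on_iff_Ck by blast
  then obtain P' where P': "\<And>z. z \<in> ?U \<Longrightarrow> ((\<lambda>z. f (coord0 z)) has_derivative P' z) (at z)"
    "Ck k (fstS -` ?U) (\<lambda>z. P' (fstS z) (sndS z))" by (rule Ck_SucE) blast
  have lm: "bounded_linear ?m"
    using bounded_linear_compose[OF bounded_linear_pairS bounded_linear_Pair[OF
        bounded_linear_compose[OF bounded_linear_single bounded_linear_compose[OF bounded_linear_fst bounded_linear_apply]]
        bounded_linear_compose[OF bounded_linear_single bounded_linear_compose[OF bounded_linear_snd bounded_linear_apply]]]]
    by simp
  have d: "frechet_derivative f (at x) v = P' (single x) (single v)" if "x \<in> S" for x v
  proof -
    have "(single has_derivative single) (at x)"
      by (rule bounded_linear_imp_has_derivative) (rule bounded_linear_single)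
    from has_derivative_compose[OF this P'(1)] that
    have "(f has_derivative (\<lambda>h. P' (single x) (single h))) (at x)" by simp
    from frechet_derivative_at[OF this] show ?thesis by metis
  qed
  have "Ck k (?m -` fstS -` ?U) (\<lambda>z. P' (fstS (?m z)) (sndS (?m z)))"
    by (rule Ck_linear_inner[OF lm open_fstS[OF open_coord0[OF S]] P'(2)])
  also have "?m -` fstS -` ?U = coord0 -` (S \<times> UNIV)"
    by (auto simp: mem_Times_iff)
  finally show "Ck k (coord0 -` (S \<times> UNIV))
      (\<lambda>z. case coord0 z of (x, v) \<Rightarrow> frechet_derivative f (at x) v)"
    by (rule Ck_cong[THEN iffD1, rotated -1])
      (use open_coord0[OF \<open>open (S \<times> (UNIV :: 'a set))\<close>] d in \<open>auto split: prod.splits\<close>)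
qed

section \<open>Open mappings and submersions\<close>

text \<open>The iteration behind Graves' theorem: a correction of size K times the residual that
  halves the residual can be repeated, and the corrections form a geometric series with sum at most
  2 * K times the initial residual. It serves both a linear surjection, with approximate preimages,
  and a submersion, with preimages under a frozen derivative.\<close>

lemma newton_solve:
  fixes f :: "'a::banach \<Rightarrow> 'b::real_normed_vector"
  assumes cont: "continuous_on (cball x R) f"
    and step: "\<And>u. u \<in> cball x R \<Longrightarrow> norm (y - f u) \<le> norm (y - f x) \<Longrightarrow>
      \<exists>u'. norm (u' - u) \<le> K * norm (y - f u) \<and> norm (y - f u') \<le> norm (y - f u) / 2"
    and R: "2 * K * norm (y - f x) \<le> R" and K: "K \<ge> 0"
  shows "\<exists>x'. f x' = y \<and> norm (x' - x) \<le> 2 * K * norm (y - f x)"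
proof -
  define d where "d = norm (y - f x)"
  obtain s where s: "\<And>u. u \<in> cball x R \<Longrightarrow> norm (y - f u) \<le> d \<Longrightarrow>
      norm (s u - u) \<le> K * norm (y - f u) \<and> norm (y - f (s u)) \<le> norm (y - f u) / 2"
    using step unfolding d_def by metis
  define u where "u = (\<lambda>n. (s ^^ n) x)"
  have u0: "u 0 = x" and uS: "u (Suc n) = s (u n)" for n by (simp_all add: u_def)
  have d: "d \<ge> 0" by (simp add: d_def)
  \<comment> \<open>The factor 2 * (1 - (1/2)^n) is the partial sum of the geometric series; it
    keeps every iterate in the ball of radius \<open>R\<close>.\<close>
  have inv: "norm (u n - x) \<le> 2 * K * d * (1 - (1/2) ^ n) \<and> norm (y - f (u n)) \<le> d * (1/2) ^ n" for n
  proof (induction n)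
    case 0 show ?case by (simp add: u0 d_def)
  next
    case (Suc n)
    have "(1/2::real) ^ n \<le> 1" by (simp add: power_le_one)
    then have le: "d * (1/2) ^ n \<le> d" using d by (simp add: mult_left_le)
    have "2 * K * d * (1 - (1/2) ^ n) \<le> 2 * K * d" using K d by (simp add: mult_left_le)
    then have "u n \<in> cball x R" using Suc R by (simp add: dist_norm norm_minus_commute d_def)
    moreover have "norm (y - f (u n)) \<le> d" using Suc le by linarith
    ultimately have a: "norm (u (Suc n) - u n) \<le> K * norm (y - f (u n))"
      "norm (y - f (u (Suc n))) \<le> norm (y - f (u n)) / 2"
      using s uS by auto
    have "norm (u (Suc n) - u n) \<le> K * (d * (1/2) ^ n)"
      using a(1) Suc K by (meson mult_left_mono order_trans)
    then have "norm (u (Suc n) - x) \<le> K * (d * (1/2) ^ n) + 2 * K * d * (1 - (1/2) ^ n)"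
      using Suc norm_triangle_ineq[of "u (Suc n) - u n" "u n - x"] by simp
    also have "\<dots> = 2 * K * d * (1 - (1/2) ^ Suc n)" by (simp add: algebra_simps)
    finally show ?case using a(2) Suc by simp
  qed
  have mem: "u n \<in> cball x R" for n
  proof -
    have "2 * K * d * (1 - (1/2) ^ n) \<le> 2 * K * d" using K d by (simp add: mult_left_le)
    then show ?thesis using inv[of n] R by (simp add: dist_norm norm_minus_commute d_def)
  qed
  have le: "norm (y - f (u n)) \<le> d" for n
  proof -
    have "d * (1/2) ^ n \<le> d" using d by (simp add: mult_left_le power_le_one)
    then show ?thesis using inv[of n] by linarith
  qed
  have diff: "norm (u (Suc n) - u n) \<le> K * d * (1/2) ^ n" for n
  proof -
    have "norm (u (Suc n) - u n) \<le> K * norm (y - f (u n))" using s[OF mem le] uS by auto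
    also have "\<dots> \<le> K * (d * (1/2) ^ n)" using inv[of n] K by (intro mult_left_mono) auto
    finally show ?thesis by simp
  qed
  have "summable (\<lambda>n. u (Suc n) - u n)"
    by (rule summable_comparison_test'[where g="\<lambda>n. K * d * (1/2) ^ n" and N=0])
      (auto intro!: summable_mult summable_geometric diff)
  then have "convergent (\<lambda>n. \<Sum>i<n. u (Suc i) - u i)" by (simp add: summable_iff_convergent)
  then have "convergent (\<lambda>n. u n - u 0)" by (simp add: sum_lessThan_telescope)
  then obtain l where "(\<lambda>n. u n - u 0) \<longlonglongrightarrow> l" by (auto simp: convergent_def)
  then have lim: "u \<longlonglongrightarrow> x + l" using tendsto_add[OF tendsto_const, of "\<lambda>n. u n - u 0" l sequentially x]
    by (simp add: u0)
  have xl: "x + l \<in> cball x R"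
    by (rule Lim_in_closed_set[OF closed_cball _ _ lim]) (use mem in auto)
  have fl: "(\<lambda>n. f (u n)) \<longlonglongrightarrow> f (x + l)"
    using continuous_on_tendsto_compose[OF cont lim xl] mem by auto
  have "(\<lambda>n. d * (1/2::real) ^ n) \<longlonglongrightarrow> d * 0" by (intro tendsto_mult tendsto_const LIMSEQ_power_zero) auto
  moreover have "\<forall>n. norm (y - f (u n)) \<le> d * (1/2) ^ n" using inv by blast
  ultimately have "(\<lambda>n. y - f (u n)) \<longlonglongrightarrow> 0"
    using Lim_null_comparison[OF always_eventually, of "\<lambda>n. y - f (u n)" "\<lambda>n. d * (1/2::real) ^ n"] by simp
  then have "y - f (x + l) = 0"
    using LIMSEQ_unique[OF tendsto_diff[OF tendsto_const fl]] by blast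
  moreover have "norm (x + l - x) \<le> 2 * K * d"
  proof (rule LIMSEQ_le_const2)
    show "(\<lambda>n. norm (u n - x)) \<longlonglongrightarrow> norm (x + l - x)" by (intro tendsto_intros lim)
    have "2 * K * d * (1 - (1/2) ^ n) \<le> 2 * K * d" for n using K d by (simp add: mult_left_le)
    then show "\<exists>N. \<forall>n\<ge>N. norm (u n - x) \<le> 2 * K * d" using inv order_trans by blast
  qed
  ultimately show ?thesis by (intro exI[of _ "x + l"]) (simp add: d_def)
qed

text \<open>The closures of the images of balls around 0 cover the target, so by Baire one of them
  contains a ball around some \<open>y0\<close>. Subtracting approximate preimages of two points of
  that ball removes the centre \<open>y0\<close>.\<close>

lemma open_mapping_approx:
  fixes T :: "'a::real_normed_vector \<Rightarrow> 'b::banach"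
  assumes "bounded_linear T" "surj T"
  obtains K where "K > 0" "\<And>y e. e > 0 \<Longrightarrow> \<exists>x. norm x \<le> K * norm y \<and> norm (y - T x) \<le> e"
proof -
  note lT = bounded_linear.linear[OF assms(1)]
  define F where "F n = closure (T ` ball 0 (real (Suc n)))" for n
  have "(\<Union>n. F n) = UNIV"
  proof -
    have "y \<in> (\<Union>n. F n)" for y
    proof -
      obtain x where x: "T x = y" using assms(2) by (metis surjD)
      obtain n where "norm x < real (Suc n)" using reals_Archimedean2 by (metis less_Suc_eq of_nat_less_iff order_less_trans lessI)
      then have "y \<in> T ` ball 0 (real (Suc n))" using x by force
      then have "y \<in> F n" unfolding F_def by (rule subsetD[OF closure_subset])
      then show ?thesis by blast
    qed
    then show ?thesis by blast
  qed
  moreover have "interior (\<Union>(range F)) = {}" if i: "\<And>n. interior (F n) = {}"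
  proof -
    have "Met_TC.mtopology interior_of \<Union>(range F) = {}"
    proof (rule Met_TC.metric_Baire_category_alt)
      show "Met_TC.mcomplete TYPE('b)" by (simp add: complete_UNIV)
      fix T assume "T \<in> range F"
      then obtain n where "T = F n" by blast
      then show "closedin Met_TC.mtopology T \<and> Met_TC.mtopology interior_of T = {}"
        using i[of n] by (simp add: F_def)
    qed simp
    then show ?thesis by simp
  qed
  ultimately obtain n where "interior (F n) \<noteq> {}" by (metis interior_UNIV UNIV_not_empty)
  then obtain y0 r where r: "r > 0" "cball y0 r \<subseteq> F n"
    by (metis all_not_in_conv mem_interior_cball)
  define M where "M = real (Suc n)"
  have M: "M > 0" by (simp add: M_def)
  have appr: "\<exists>x. norm x < M \<and> norm (y - T x) \<le> e" if yF: "y \<in> F n" and e: "e > 0" for y e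
  proof -
    have "\<forall>e>0. \<exists>z\<in>T ` ball 0 M. dist z y < e"
      using yF by (simp only: F_def M_def closure_approachable)
    then obtain z where "z \<in> T ` ball 0 M" "dist z y < e" using e by blast
    then obtain x where "norm x < M" "z = T x" by auto
    then show ?thesis using \<open>dist z y < e\<close>
      by (intro exI[of _ x]) (simp add: dist_norm norm_minus_commute)
  qed
  show ?thesis
  \<comment> \<open>The difference of two vectors of norm below \<open>M\<close> has norm below 2 *
    M, and the scale \<open>c = r / norm y\<close> moves \<open>y\<close> to length
    \<open>r\<close>.\<close>
  proof (rule that[of "2 * M / r"])
    show "2 * M / r > 0" using M r by simp
    fix y :: 'b and e :: real assume e: "e > 0"
    show "\<exists>x. norm x \<le> 2 * M / r * norm y \<and> norm (y - T x) \<le> e"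
    proof (cases "y = 0")
      case True then show ?thesis using e linear_0[OF lT] by (intro exI[of _ 0]) auto
    next
      case False
      define c where "c = r / norm y"
      have c: "c > 0" using False r by (simp add: c_def)
      have "y0 + c *\<^sub>R y \<in> F n" "y0 \<in> F n"
        using r False by (auto simp: c_def dist_norm intro!: subsetD[OF r(2)])
      moreover have "c * e / 2 > 0" using c e by simp
      ultimately obtain a b where ab: "norm a < M" "norm b < M"
        "norm (y0 + c *\<^sub>R y - T a) \<le> c * e / 2" "norm (y0 - T b) \<le> c * e / 2"
        using appr by metis
      define x where "x = (a - b) /\<^sub>R c"
      have "norm x \<le> 2 * M / c"
      proof -
        have "norm x = norm (a - b) / c" using c by (simp add: x_def divide_inverse mult.commute)
        also have "\<dots> \<le> 2 * M / c"
          by (rule divide_right_mono) (use c ab norm_triangle_ineq4[of a b] in auto)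
        finally show ?thesis .
      qed
      moreover have "2 * M / c = 2 * M / r * norm y" using r by (simp add: c_def)
      moreover have "norm (y - T x) \<le> e"
      proof -
        have Tx: "c *\<^sub>R T x = T a - T b"
          using c linear_scale[OF lT, of c x] linear_diff[OF lT] by (simp add: x_def)
        have "c * norm (y - T x) = norm (c *\<^sub>R y - c *\<^sub>R T x)"
          using c by (simp flip: scaleR_diff_right)
        also have "\<dots> = norm ((y0 + c *\<^sub>R y - T a) - (y0 - T b))"
          unfolding Tx by (simp add: algebra_simps)
        also have "\<dots> \<le> c * e" using ab norm_triangle_ineq4[of "y0 + c *\<^sub>R y - T a" "y0 - T b"] by simp
        finally show ?thesis using c by simp
      qed
      ultimately show ?thesis by auto
    qed
  qed
qed

text \<open>A bound on preimages takes the place of a bounded linear right inverse, which exists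
  only if the kernel is complemented. Solving up to half of the residual and iterating from 0
  doubles the constant.\<close>

lemma open_mapping:
  fixes T :: "'a::banach \<Rightarrow> 'b::banach"
  assumes "bounded_linear T" "surj T"
  obtains K where "K > 0" "\<And>y. \<exists>x. T x = y \<and> norm x \<le> K * norm y"
proof -
  note lT = bounded_linear.linear[OF assms(1)]
  obtain K where K: "K > 0" "\<And>y e. e > 0 \<Longrightarrow> \<exists>x. norm x \<le> K * norm y \<and> norm (y - T x) \<le> e"
    using open_mapping_approx[OF assms] by blast
  have "\<exists>x. T x = y \<and> norm x \<le> 2 * K * norm y" for y
  proof -
    have "\<exists>x. T x = y \<and> norm (x - 0) \<le> 2 * K * norm (y - T 0)"
    proof (rule newton_solve[where R="2 * K * norm y"])
      fix u
      show "\<exists>u'. norm (u' - u) \<le> K * norm (y - T u) \<and> norm (y - T u') \<le> norm (y - T u) / 2"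
      proof (cases "y = T u")
        case False
        then obtain x where "norm x \<le> K * norm (y - T u)" "norm (y - T u - T x) \<le> norm (y - T u) / 2"
          using K(2)[of "norm (y - T u) / 2" "y - T u"] by auto
        then show ?thesis by (intro exI[of _ "u + x"]) (simp add: linear_add[OF lT] algebra_simps)
      qed (auto intro!: exI[of _ u])
    qed (use K linear_0[OF lT] linear_continuous_on[OF assms(1)] in auto)
    then show ?thesis using linear_0[OF lT] by simp
  qed
  then show ?thesis using that[of "2 * K"] K by simp
qed

section \<open>Second derivatives, their symmetry, and strict differentiability\<close>

lemma smooth_on_second_order:
  fixes f :: "'a::real_normed_vector \<Rightarrow> 'b::real_normed_vector"
  assumes "smooth_on S f" "x \<in> S"
  obtains H C where "\<And>v. linear (\<lambda>h. H h v)" "\<And>h. linear (H h)" "C > 0"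
    "\<And>h v. norm (H h v) \<le> C * norm h * norm v"
    "\<And>e. e > 0 \<Longrightarrow> \<exists>d>0. \<forall>y\<in>S. norm (y - x) < d \<longrightarrow>
      (\<forall>v. norm (frechet_derivative f (at y) v - frechet_derivative f (at x) v - H (y - x) v)
         \<le> e * norm (y - x) * norm v)"
proof -
  obtain D where S: "open S" and D: "\<And>x. x \<in> S \<Longrightarrow> D x [] = f x"
    "\<And>n x. x \<in> S \<Longrightarrow> bounded_multilinear n (D x)"
    "\<And>n x e. x \<in> S \<Longrightarrow> e > 0 \<Longrightarrow> \<exists>d>0. \<forall>y\<in>S. norm (y - x) < d \<longrightarrow>
           (\<forall>vs. length vs = n \<longrightarrow>
              norm (D y vs - D x vs - D x ((y - x) # vs))
                \<le> e * norm (y - x) * prod_list (map norm vs))"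
    using assms(1) unfolding smooth_on_def by metis
  have hd: "(f has_derivative (\<lambda>h. D y [h])) (at y)" if y: "y \<in> S" for y
    unfolding has_derivative_at_alt
  proof (intro conjI allI impI)
    have b1: "\<forall>i<1. \<forall>vs. length vs = 1 \<longrightarrow> linear (\<lambda>v. D y (vs[i := v]))"
      "\<exists>C. \<forall>vs. length vs = 1 \<longrightarrow> norm (D y vs) \<le> C * prod_list (map norm vs)"
      using D(2)[OF y, of 1] unfolding bounded_multilinear_def by blast+
    have "linear (\<lambda>h. D y [h])" using b1(1)[rule_format, of 0 "[0]"] by simp
    moreover obtain C where "\<And>vs. length vs = 1 \<Longrightarrow> norm (D y vs) \<le> C * prod_list (map norm vs)"
      using b1(2) by blast
    from this[of "[_]"] have "norm (D y [h]) \<le> norm h * C" for h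
      by (simp add: mult.commute)
    ultimately show "bounded_linear (\<lambda>h. D y [h])"
      by (auto simp: bounded_linear_def bounded_linear_axioms_def)
    fix e :: real assume "e > 0"
    from D(3)[OF y this, of 0] obtain d where d: "d > 0" "\<And>z. z \<in> S \<Longrightarrow> norm (z - y) < d \<Longrightarrow>
        norm (D z [] - D y [] - D y [z - y]) \<le> e * norm (z - y)" by auto
    obtain r where r: "r > 0" "\<And>z. norm (z - y) < r \<Longrightarrow> z \<in> S"
      using S y by (metis open_dist dist_norm)
    show "\<exists>d>0. \<forall>z. norm (z - y) < d \<longrightarrow> norm (f z - f y - D y [z - y]) \<le> e * norm (z - y)"
      by (rule exI[of _ "min d r"]) (use d r D(1) y in auto)
  qed
  have fd: "frechet_derivative f (at y) v = D y [v]" if "y \<in> S" for y v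
    using frechet_derivative_at[OF hd[OF that]] by metis
  note b2 = D(2)[OF assms(2), of 2, unfolded bounded_multilinear_def]
  obtain C where C: "\<And>vs. length vs = 2 \<Longrightarrow> norm (D x vs) \<le> C * prod_list (map norm vs)"
    using b2 by metis
  have l: "linear (\<lambda>v. D x (vs[i := v]))" if "i < 2" "length vs = 2" for vs i
    using b2 that by blast
  show ?thesis
  proof (rule that[of "\<lambda>h v. D x [h, v]" "\<bar>C\<bar> + 1"])
    show "linear (\<lambda>h. D x [h, v])" for v using l[of 0 "[0, v]"] by simp
    show "linear (\<lambda>v. D x [h, v])" for h using l[of 1 "[h, 0]"] by simp
    show "norm (D x [h, v]) \<le> (\<bar>C\<bar> + 1) * norm h * norm v" for h v
    proof -
      have "norm (D x [h, v]) \<le> C * (norm h * norm v)" using C[of "[h, v]"] by simp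
      also have "\<dots> \<le> (\<bar>C\<bar> + 1) * (norm h * norm v)" by (intro mult_right_mono) auto
      finally show ?thesis by (simp add: mult.assoc)
    qed
    fix e :: real assume "e > 0"
    \<comment> \<open>Order 1 of the displayed derivatives is the Frechet derivative; the estimate
      for it is uniform in the direction \<open>v\<close>, which the mean value arguments below rely
      on.\<close>
    from D(3)[OF assms(2) this, of 1] obtain d where d: "d > 0" "\<And>z vs. z \<in> S \<Longrightarrow> norm (z - x) < d \<Longrightarrow>
        length vs = 1 \<Longrightarrow> norm (D z vs - D x vs - D x ((z - x) # vs)) \<le> e * norm (z - x) * prod_list (map norm vs)"
      by metis
    show "\<exists>d>0. \<forall>y\<in>S. norm (y - x) < d \<longrightarrow>
      (\<forall>v. norm (frechet_derivative f (at y) v - frechet_derivative f (at x) v - D x [y - x, v])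
         \<le> e * norm (y - x) * norm v)"
      using d(1) d(2)[of _ "[_]"] fd assms(2) by (intro exI[of _ d]) auto
  qed auto
qed

text \<open>The second difference of \<open>f\<close> over the parallelogram with sides t * u and t
  * v is symmetric in \<open>u\<close> and \<open>v\<close>, and it approximates t^2 times
  \<open>H u v\<close> and hence also t^2 times \<open>H v u\<close>, with an error that is small
  compared with t^2.\<close>

lemma second_derivative_symmetric:
  fixes f :: "'a::real_normed_vector \<Rightarrow> 'b::real_normed_vector"
  assumes f: "smooth_on S f" and x: "x \<in> S"
  obtains H where "\<And>v. ((\<lambda>y. frechet_derivative f (at y) v) has_derivative (\<lambda>h. H h v)) (at x)"
    "\<And>u v. H u v = H v u"
proof -
  obtain H C where H: "\<And>v. linear (\<lambda>h. H h v)" "\<And>h. linear (H h)" "C > 0"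
    "\<And>h v. norm (H h v) \<le> C * norm h * norm v"
    "\<And>e. e > 0 \<Longrightarrow> \<exists>d>0. \<forall>y\<in>S. norm (y - x) < d \<longrightarrow>
      (\<forall>v. norm (frechet_derivative f (at y) v - frechet_derivative f (at x) v - H (y - x) v)
         \<le> e * norm (y - x) * norm v)"
    using smooth_on_second_order[OF assms] by metis
  obtain r where r: "r > 0" "\<And>z. norm (z - x) < r \<Longrightarrow> z \<in> S"
    using smooth_on_open[OF f] x by (metis open_dist dist_norm)
  let ?d = "\<lambda>y. frechet_derivative f (at y)"
  show ?thesis
  proof (rule that)
    fix v
    show "((\<lambda>y. ?d y v) has_derivative (\<lambda>h. H h v)) (at x)"
      unfolding has_derivative_at_alt
    proof (intro conjI allI impI)
      show "bounded_linear (\<lambda>h. H h v)"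
        using H(1) H(4)[of _ v]
        by (auto simp: bounded_linear_def bounded_linear_axioms_def mult_ac intro!: exI[of _ "C * norm v"])
      fix e :: real assume e: "e > 0"
      then have "e / (norm v + 1) > 0" by (simp add: add_nonneg_pos)
      from H(5)[OF this] obtain d where d: "d > 0" "\<And>y. y \<in> S \<Longrightarrow> norm (y - x) < d \<Longrightarrow>
          norm (?d y v - ?d x v - H (y - x) v) \<le> e / (norm v + 1) * norm (y - x) * norm v" by metis
      have "0 < norm v + 1" by (simp add: add_nonneg_pos)
      then have "e / (norm v + 1) * norm v \<le> e" using e by (simp add: field_simps)
      then have le: "e / (norm v + 1) * norm (y - x) * norm v \<le> e * norm (y - x)" for y
        using mult_right_mono[of "e / (norm v + 1) * norm v" e "norm (y - x)"] by (simp only: mult_ac norm_ge_zero)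
      show "\<exists>d>0. \<forall>y. norm (y - x) < d \<longrightarrow> norm (?d y v - ?d x v - H (y - x) v) \<le> e * norm (y - x)"
        by (rule exI[of _ "min d r"]) (use d r order_trans[OF d(2) le] in simp)
    qed
  next
    fix u v :: 'a
    \<comment> \<open>All points involved lie within \<open>t * c\<close> of \<open>x\<close>; the
      summand 1 keeps \<open>c\<close> positive even if both vectors vanish.\<close>
    define c where "c = norm u + norm v + 1"
    have c: "c > 0" by (simp add: c_def add_nonneg_pos)
    have key: "norm (f (x + t *\<^sub>R u + t *\<^sub>R v) - f (x + t *\<^sub>R u) - f (x + t *\<^sub>R v) + f x - t\<^sup>2 *\<^sub>R H u v) \<le> 2 * e * (t * c)\<^sup>2"
      if t: "t > 0" "t * c < d" "t * c < r" and e: "e > 0"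
        and d: "\<And>y k. y \<in> S \<Longrightarrow> norm (y - x) < d \<Longrightarrow> norm (?d y k - ?d x k - H (y - x) k) \<le> e * norm (y - x) * norm k"
        and uv: "norm u + norm v < c"
      for t d e u v
    proof -
      have near: "norm (z + s - x) \<le> t * c" if "z \<in> cball x (t * norm v)" "norm s \<le> t * norm u" for z s
      proof -
        have "norm (z + s - x) \<le> norm (z - x) + norm s"
          using norm_triangle_ineq[of "z - x" s] by (simp add: algebra_simps)
        also have "\<dots> \<le> t * norm v + t * norm u" using that by (auto simp: dist_norm norm_minus_commute)
        also have "\<dots> = t * (norm u + norm v)" by (simp add: algebra_simps)
        also have "\<dots> \<le> t * c" using uv t by (intro mult_left_mono) auto
        finally show ?thesis .
      qed
      \<comment> \<open>The increment of \<open>?F\<close> over t * v is the second difference minus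
        t^2 times \<open>H u v\<close>. The derivative of \<open>?F\<close> compares the derivative
        of \<open>f\<close> at two points near \<open>x\<close> with its linearisation, whence the
        factor 2 in the bound.\<close>
      let ?F = "\<lambda>z. f (z + t *\<^sub>R u) - f z - t *\<^sub>R H u z"
      have "norm (?F (x + t *\<^sub>R v) - ?F x) \<le> (2 * e * (t * c)) * norm (x + t *\<^sub>R v - x)"
      proof (rule differentiable_bound[where S="cball x (t * norm v)" and f="?F"])
        fix z assume z: "z \<in> cball x (t * norm v)"
        have n1: "norm (z + t *\<^sub>R u - x) \<le> t * c" using near[OF z, of "t *\<^sub>R u"] t by simp
        have n2: "norm (z - x) \<le> t * c" using near[OF z, of 0] t by simp
        have zS: "z \<in> S" "z + t *\<^sub>R u \<in> S" using n1 n2 r t by auto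
        have blH: "bounded_linear (H u)"
          using H(2) H(4)[of u]
          by (auto simp: bounded_linear_def bounded_linear_axioms_def mult_ac intro!: exI[of _ "C * norm u"])
        have "((\<lambda>z. f (z + t *\<^sub>R u)) has_derivative (\<lambda>k. ?d (z + t *\<^sub>R u) k)) (at z)"
          by (rule has_derivative_compose[where f="\<lambda>z. z + t *\<^sub>R u" and g=f])
            (auto intro!: derivative_eq_intros smooth_on_has_derivative[OF f zS(2)])
        from has_derivative_at_withinI[OF has_derivative_diff[OF has_derivative_diff[OF this
              smooth_on_has_derivative[OF f zS(1)]]
              has_derivative_scaleR_right[OF bounded_linear_imp_has_derivative[OF blH]]]]
        show "(?F has_derivative (\<lambda>k. ?d (z + t *\<^sub>R u) k - ?d z k - t *\<^sub>R H u k)) (at z within cball x (t * norm v))" .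
        show "onorm (\<lambda>k. ?d (z + t *\<^sub>R u) k - ?d z k - t *\<^sub>R H u k) \<le> 2 * e * (t * c)"
        proof (rule onorm_bound)
          fix k
          have "H (z + t *\<^sub>R u - x) k = H (z - x) k + t *\<^sub>R H u k"
            using linear_add[OF H(1), of "z - x" "t *\<^sub>R u" k] linear_scale[OF H(1), of t u k]
            by (simp add: algebra_simps)
          then have "?d (z + t *\<^sub>R u) k - ?d z k - t *\<^sub>R H u k =
             (?d (z + t *\<^sub>R u) k - ?d x k - H (z + t *\<^sub>R u - x) k) - (?d z k - ?d x k - H (z - x) k)"
            by simp
          also have "norm \<dots> \<le> e * norm (z + t *\<^sub>R u - x) * norm k + e * norm (z - x) * norm k"
            by (rule order_trans[OF norm_triangle_ineq4 add_mono]) (use d zS n1 n2 t in auto)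
          also have "\<dots> \<le> e * (t * c) * norm k + e * (t * c) * norm k"
            using n1 n2 e by (intro add_mono mult_right_mono mult_left_mono) auto
          finally show "norm (?d (z + t *\<^sub>R u) k - ?d z k - t *\<^sub>R H u k) \<le> 2 * e * (t * c) * norm k"
            by (simp add: mult_ac)
        qed (use e t c in auto)
      qed (use t in \<open>auto simp: dist_norm\<close>)
      also have "\<dots> \<le> (2 * e * (t * c)) * (t * c)"
        using near[of "x + t *\<^sub>R v" 0] t e uv c by (intro mult_left_mono) (auto simp: dist_norm)
      finally have "norm (?F (x + t *\<^sub>R v) - ?F x) \<le> 2 * e * (t * c)\<^sup>2" by (simp add: power2_eq_square mult_ac)
      moreover have "?F (x + t *\<^sub>R v) - ?F x =
          f (x + t *\<^sub>R u + t *\<^sub>R v) - f (x + t *\<^sub>R u) - f (x + t *\<^sub>R v) + f x - t\<^sup>2 *\<^sub>R H u v"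
        using linear_add[OF H(2), of u x "t *\<^sub>R v"] linear_scale[OF H(2), of u t v]
        by (simp add: algebra_simps power2_eq_square)
      ultimately show ?thesis by simp
    qed
    have "norm (H u v - H v u) \<le> 4 * c\<^sup>2 * e" if e: "e > 0" for e
    proof -
      obtain d where d: "d > 0" "\<And>y k. y \<in> S \<Longrightarrow> norm (y - x) < d \<Longrightarrow> norm (?d y k - ?d x k - H (y - x) k) \<le> e * norm (y - x) * norm k"
        using H(5)[OF e] by metis
      define t where "t = min d r / (2 * c)"
      have t: "t > 0" "t * c < d" "t * c < r" using d r c by (auto simp: t_def field_simps min_def)
      let ?D = "f (x + t *\<^sub>R u + t *\<^sub>R v) - f (x + t *\<^sub>R u) - f (x + t *\<^sub>R v) + f x"
      have "norm (?D - t\<^sup>2 *\<^sub>R H u v) \<le> 2 * e * (t * c)\<^sup>2"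
        by (rule key[OF t e d(2)]) (auto simp: c_def)
      moreover have "norm (?D - t\<^sup>2 *\<^sub>R H v u) \<le> 2 * e * (t * c)\<^sup>2"
        using key[OF t e d(2), of v u] by (simp add: c_def algebra_simps)
      ultimately have "norm ((?D - t\<^sup>2 *\<^sub>R H v u) - (?D - t\<^sup>2 *\<^sub>R H u v)) \<le> 2 * (2 * e * (t * c)\<^sup>2)"
        using norm_triangle_ineq4[of "?D - t\<^sup>2 *\<^sub>R H v u" "?D - t\<^sup>2 *\<^sub>R H u v"] by linarith
      moreover have "(?D - t\<^sup>2 *\<^sub>R H v u) - (?D - t\<^sup>2 *\<^sub>R H u v) = t\<^sup>2 *\<^sub>R (H u v - H v u)"
        by (simp add: algebra_simps)
      ultimately have "t\<^sup>2 * norm (H u v - H v u) \<le> t\<^sup>2 * (4 * c\<^sup>2 * e)"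
        by (simp add: power_mult_distrib mult_ac)
      then show ?thesis using t(1) by simp
    qed
    from this[of "_ / (4 * c\<^sup>2)"] have "norm (H u v - H v u) \<le> e" if "e > 0" for e
      using that c by (auto simp: field_simps)
    then have "norm (H u v - H v u) \<le> 0" by (rule field_le_epsilon[of _ 0, simplified])
    then show "H u v = H v u" by simp
  qed
qed

lemma smooth_on_derivative_lipschitz:
  fixes f :: "'a::real_normed_vector \<Rightarrow> 'b::real_normed_vector"
  assumes "smooth_on S f" "x \<in> S"
  obtains r B where "r > 0" "B > 0" "ball x r \<subseteq> S"
    "\<And>y v. y \<in> ball x r \<Longrightarrow>
      norm (frechet_derivative f (at y) v - frechet_derivative f (at x) v) \<le> B * norm (y - x) * norm v"
proof -
  obtain H C where H: "C > 0" "\<And>h v. norm (H h v) \<le> C * norm h * norm v"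
    "\<And>e. e > 0 \<Longrightarrow> \<exists>d>0. \<forall>y\<in>S. norm (y - x) < d \<longrightarrow>
      (\<forall>v. norm (frechet_derivative f (at y) v - frechet_derivative f (at x) v - H (y - x) v)
         \<le> e * norm (y - x) * norm v)"
    using smooth_on_second_order[OF assms] by metis
  obtain d where d: "d > 0" "\<And>y v. y \<in> S \<Longrightarrow> norm (y - x) < d \<Longrightarrow>
      norm (frechet_derivative f (at y) v - frechet_derivative f (at x) v - H (y - x) v) \<le> norm (y - x) * norm v"
    using H(3)[of 1] by auto
  obtain r where r: "r > 0" "ball x r \<subseteq> S"
    using smooth_on_open[OF assms(1)] assms(2) open_contains_ball by blast
  show ?thesis
  proof (rule that[of "min d r" "C + 1"])
    fix y v assume "y \<in> ball x (min d r)"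
    then have "y \<in> S" "norm (y - x) < d" using r by (auto simp: dist_norm norm_minus_commute)
    from norm_triangle_ineq[of "frechet_derivative f (at y) v - frechet_derivative f (at x) v - H (y - x) v" "H (y - x) v"]
      d(2)[OF this, of v] H(2)[of "y - x" v]
    show "norm (frechet_derivative f (at y) v - frechet_derivative f (at x) v) \<le> (C + 1) * norm (y - x) * norm v"
      by (simp add: algebra_simps)
  qed (use d r H in auto)
qed

text \<open>Strict differentiability: both points vary while the derivative stays frozen at
  \<open>x\<close>. The Newton iteration needs this because it corrects moving points with one fixed
  linear map.\<close>

lemma smooth_on_strict:
  fixes f :: "'a::real_normed_vector \<Rightarrow> 'b::real_normed_vector"
  assumes "smooth_on S f" "x \<in> S" "e > 0"
  obtains r where "r > 0" "ball x r \<subseteq> S"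
    "\<And>u v. u \<in> ball x r \<Longrightarrow> v \<in> ball x r \<Longrightarrow>
      norm (f u - f v - frechet_derivative f (at x) (u - v)) \<le> e * norm (u - v)"
proof -
  obtain r B where r: "r > 0" "B > 0" "ball x r \<subseteq> S"
    "\<And>y v. y \<in> ball x r \<Longrightarrow>
      norm (frechet_derivative f (at y) v - frechet_derivative f (at x) v) \<le> B * norm (y - x) * norm v"
    using smooth_on_derivative_lipschitz[OF assms(1,2)] by metis
  let ?T = "frechet_derivative f (at x)"
  have bT: "bounded_linear ?T"
    using smooth_on_has_derivative[OF assms(1,2)] by (rule has_derivative_bounded_linear)
  define q where "q = min r (e / B)"
  show ?thesis
  proof (rule that)
    show "q > 0" "ball x q \<subseteq> S" using r assms(3) by (auto simp: q_def)
    fix u v assume uv: "u \<in> ball x q" "v \<in> ball x q"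
    have "norm ((f u - ?T u) - (f v - ?T v)) \<le> e * norm (u - v)"
    proof (rule differentiable_bound[where S="ball x q" and f="\<lambda>z. f z - ?T z"])
      fix z assume z: "z \<in> ball x q"
      then have zS: "z \<in> S" using r by (auto simp: q_def)
      show "((\<lambda>z. f z - ?T z) has_derivative (\<lambda>h. frechet_derivative f (at z) h - ?T h)) (at z within ball x q)"
        by (intro has_derivative_diff has_derivative_at_withinI[OF smooth_on_has_derivative[OF assms(1) zS]]
            bounded_linear_imp_has_derivative bT)
      have "B * norm (z - x) \<le> e"
      proof -
        have "norm (z - x) < e / B" using z by (simp add: q_def dist_norm norm_minus_commute)
        then show ?thesis using r by (simp add: field_simps)
      qed
      moreover have "z \<in> ball x r" using z by (simp add: q_def)
      ultimately have "norm (frechet_derivative f (at z) h - ?T h) \<le> e * norm h" for h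
        using r(4)[of z h] mult_right_mono[of "B * norm (z - x)" e "norm h"] by simp
      then show "onorm (\<lambda>h. frechet_derivative f (at z) h - ?T h) \<le> e"
        using assms(3) by (intro onorm_bound) auto
    qed (use uv in auto)
    then show "norm (f u - f v - ?T (u - v)) \<le> e * norm (u - v)"
      by (simp add: linear_diff[OF bounded_linear.linear[OF bT]] algebra_simps)
  qed
qed

section \<open>Submersions between Banach spaces, without splitting of kernels\<close>

definition submersion_on :: "'a::real_normed_vector set \<Rightarrow> ('a \<Rightarrow> 'b::real_normed_vector) \<Rightarrow> bool" where
  "submersion_on U P \<longleftrightarrow> smooth_on U P \<and> (\<forall>x\<in>U. surj (frechet_derivative P (at x)))"

lemma submersion_local_lift:
  fixes P :: "'a::banach \<Rightarrow> 'b::banach"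
  assumes "submersion_on U P" "x0 \<in> U"
  obtains r K where "r > 0" "K > 0" "ball x0 r \<subseteq> U"
    "\<And>x y. x \<in> ball x0 r \<Longrightarrow> norm (y - P x) < r \<Longrightarrow> \<exists>x'\<in>U. P x' = y \<and> norm (x' - x) \<le> K * norm (y - P x)"
proof -
  have sm: "smooth_on U P" and sj: "surj (frechet_derivative P (at x0))"
    using assms by (auto simp: submersion_on_def)
  let ?T = "frechet_derivative P (at x0)"
  have bT: "bounded_linear ?T"
    using smooth_on_has_derivative[OF sm assms(2)] by (rule has_derivative_bounded_linear)
  obtain K where K: "K > 0" "\<And>y. \<exists>x. ?T x = y \<and> norm x \<le> K * norm y"
    using open_mapping[OF bT sj] by blast
  have "1 / (2 * K) > 0" using K by simp
  then obtain r where r: "r > 0" "ball x0 r \<subseteq> U" "\<And>u v. u \<in> ball x0 r \<Longrightarrow> v \<in> ball x0 r \<Longrightarrow>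
      norm (P u - P v - ?T (u - v)) \<le> 1 / (2 * K) * norm (u - v)"
    using smooth_on_strict[OF sm assms(2)] by metis
  \<comment> \<open>The choice makes the Newton ball of radius at most r / 4 around \<open>x\<close>
    lie in the ball of radius r / 2 around \<open>x0\<close>, while a single correction has norm at
    most r / 8. So both ends of each Newton step stay where the strict estimate holds.\<close>
  define q where "q = min (r / 4) (r / (8 * K))"
  have q: "q > 0" "q \<le> r / 4" "4 * K * q \<le> r / 2" using r K by (auto simp: q_def field_simps min_def)
  show ?thesis
  proof (rule that)
    show "q > 0" "2 * K > 0" "ball x0 q \<subseteq> U" using q K r by auto
    fix x y assume x: "x \<in> ball x0 q" and y: "norm (y - P x) < q"
    define R where "R = 2 * K * norm (y - P x)"
    have R: "R \<le> r / 4" 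
    proof -
      have "K * norm (y - P x) \<le> K * q" using y K by (intro mult_left_mono) auto
      then show ?thesis using q(3) by (simp add: R_def)
    qed
    have Kq: "K * norm (y - P x) \<le> r / 8" using R by (simp add: R_def)
    have sub: "cball x R \<subseteq> ball x0 (r / 2)"
    proof
      fix u assume "u \<in> cball x R"
      then have "dist x0 u \<le> dist x0 x + R" using dist_triangle[of x0 u x] by simp
      then show "u \<in> ball x0 (r / 2)" using x R q r by simp
    qed
    then have sub': "cball x R \<subseteq> ball x0 r" using r by (auto dest!: subsetD)
    have "\<exists>x'. P x' = y \<and> norm (x' - x) \<le> 2 * K * norm (y - P x)"
    proof (rule newton_solve[where R=R])
      have "continuous_on U P"
        using smooth_on_has_derivative[OF sm] has_derivative_continuous
        by (intro continuous_at_imp_continuous_on) blast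
      then show "continuous_on (cball x R) P" using sub' r(2) continuous_on_subset by blast
      fix u assume u: "u \<in> cball x R" and le: "norm (y - P u) \<le> norm (y - P x)"
      obtain h where h: "?T h = y - P u" "norm h \<le> K * norm (y - P u)" using K by blast
      have "norm h \<le> r / 8" using h(2) Kq mult_left_mono[OF le, of K] K by linarith
      moreover have "norm (u - x0) < r / 2" using subsetD[OF sub u] by (simp add: dist_norm norm_minus_commute)
      ultimately have "norm (u + h - x0) < r"
        using norm_triangle_ineq[of "u - x0" h] r(1) by (simp add: algebra_simps)
      then have "u + h \<in> ball x0 r" by (simp add: dist_norm norm_minus_commute)
      moreover have "u \<in> ball x0 r" using u sub' by auto
      ultimately have "norm (P (u + h) - P u - ?T h) \<le> 1 / (2 * K) * norm h" using r(3)[of "u + h" u] by simp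
      also have "\<dots> \<le> 1 / (2 * K) * (K * norm (y - P u))" using h K by (intro mult_left_mono) auto
      also have "\<dots> = norm (y - P u) / 2" using K by simp
      finally have "norm (y - P (u + h)) \<le> norm (y - P u) / 2"
        unfolding h(1) by (simp add: norm_minus_commute)
      then show "\<exists>u'. norm (u' - u) \<le> K * norm (y - P u) \<and> norm (y - P u') \<le> norm (y - P u) / 2"
        using h by (intro exI[of _ "u + h"]) auto
    qed (use K in \<open>auto simp: R_def\<close>)
    then obtain x' where x': "P x' = y" "norm (x' - x) \<le> 2 * K * norm (y - P x)" by blast
    then have "x' \<in> cball x R" by (simp add: R_def dist_norm norm_minus_commute)
    then show "\<exists>x'\<in>U. P x' = y \<and> norm (x' - x) \<le> 2 * K * norm (y - P x)" using x' sub' r(2) by blast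
  qed
qed

section \<open>Descent along submersions\<close>

text \<open>Completeness of spaces of bounded functions is available in the library for metric domains only.\<close>

instantiation nat :: metric_space
begin

definition dist_nat :: "nat \<Rightarrow> nat \<Rightarrow> real" where
  "dist_nat m n = \<bar>real m - real n\<bar>"

definition uniformity_nat :: "(nat \<times> nat) filter" where
  "uniformity_nat = (INF e\<in>{0 <..}. principal {(x, y). dist x y < e})"

instance
proof
  fix U :: "nat set"
  have "eventually (\<lambda>(x', y). x' = x \<longrightarrow> y \<in> U) uniformity" if "x \<in> U" for x
    unfolding uniformity_nat_def
  proof (rule eventually_INF1[of 1])
    have "y = x" if "dist x y < 1" for y
      using that by (cases x y rule: linorder_cases) (auto simp: dist_nat_def)
    then show "eventually (\<lambda>(x', y). x' = x \<longrightarrow> y \<in> U) (principal {(x, y). dist x y < 1})"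
      using that by (auto simp: eventually_principal)
  qed simp
  then show "open U \<longleftrightarrow> (\<forall>x\<in>U. \<forall>\<^sub>F (x', y) in uniformity. x' = x \<longrightarrow> y \<in> U)"
    by (simp add: open_discrete)
qed (auto simp: dist_nat_def uniformity_nat_def)

end

instance bcontfun :: (metric_space, banach) banach ..

lemma submersion_on_subset: "submersion_on U P \<Longrightarrow> open V \<Longrightarrow> V \<subseteq> U \<Longrightarrow> submersion_on V P"
  unfolding submersion_on_def using smooth_on_subset by blast

lemma submersion_open_image:
  fixes P :: "'a::banach \<Rightarrow> 'b::banach"
  assumes "submersion_on U P"
  shows "open (P ` U)"
  unfolding open_contains_ball
proof
  fix y0 assume "y0 \<in> P ` U"
  then obtain x0 where x0: "x0 \<in> U" "y0 = P x0" by blast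
  obtain r K where r: "r > 0" "\<And>x y. x \<in> ball x0 r \<Longrightarrow> norm (y - P x) < r \<Longrightarrow> \<exists>x'\<in>U. P x' = y \<and> norm (x' - x) \<le> K * norm (y - P x)"
    using submersion_local_lift[OF assms x0(1)] by metis
  have "y \<in> P ` U" if "y \<in> ball y0 r" for y
    using r(2)[of x0 y] r(1) that x0 by (force simp: dist_norm norm_minus_commute)
  then show "\<exists>e>0. ball y0 e \<subseteq> P ` U" using r(1) by blast
qed

lemma submersion_kernel:
  fixes P :: "'a::banach \<Rightarrow> 'b::banach" and f :: "'b \<Rightarrow> 'c::real_normed_vector"
  assumes sub: "submersion_on U P" and x0: "x0 \<in> U"
    and F': "((\<lambda>x. f (P x)) has_derivative F') (at x0)"
    and v: "frechet_derivative P (at x0) v = 0"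
  shows "F' v = 0"
proof -
  let ?T = "frechet_derivative P (at x0)"
  have P': "(P has_derivative ?T) (at x0)"
    using sub x0 smooth_on_has_derivative unfolding submersion_on_def by blast
  have bF: "bounded_linear F'" using F' by (rule has_derivative_bounded_linear)
  note lF = bounded_linear.linear[OF bF]
  note lT = bounded_linear.linear[OF has_derivative_bounded_linear[OF P']]
  obtain B where B: "B > 0" "\<And>h. norm (F' h) \<le> norm h * B" using bounded_linear.pos_bounded[OF bF] by blast
  obtain r K where r: "r > 0" "K > 0" "\<And>x y. x \<in> ball x0 r \<Longrightarrow> norm (y - P x) < r \<Longrightarrow> \<exists>x'\<in>U. P x' = y \<and> norm (x' - x) \<le> K * norm (y - P x)"
    using submersion_local_lift[OF sub x0] by metis
  \<comment> \<open>The summand \<open>norm v + K\<close> comes from the differentiability error at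
    x', whose distance from \<open>x0\<close> is at most t * (norm v + K); the summand
    \<open>B * K\<close> is the effect of \<open>F'\<close> on the correction back to the
    fibre.\<close>
  have main: "norm (F' v) \<le> e * (norm v + K + B * K)" if e: "0 < e" "e \<le> 1" for e
  proof -
    have "e / (norm v + 1) > 0" using e by (simp add: add_nonneg_pos)
    then obtain d1 where d1: "d1 > 0" "\<And>z. norm (z - x0) < d1 \<Longrightarrow> norm (P z - P x0 - ?T (z - x0)) \<le> e / (norm v + 1) * norm (z - x0)"
      using P' unfolding has_derivative_at_alt by metis
    obtain d2 where d2: "d2 > 0" "\<And>z. norm (z - x0) < d2 \<Longrightarrow> norm (f (P z) - f (P x0) - F' (z - x0)) \<le> e * norm (z - x0)"
      using F' e unfolding has_derivative_at_alt by metis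
    define M where "M = norm v + K + 1"
    have M: "M \<ge> 1" "norm v \<le> M" "norm v + K \<le> M" using r(2) by (auto simp: M_def)
    define t where "t = min (min d1 d2) r / (2 * M)"
    have t: "t > 0" "t * M < d1" "t * M < d2" "t * M < r"
      using d1 d2 r M by (auto simp: t_def field_simps min_def)
    have tv: "t * norm v \<le> t * M" using t M by (intro mult_left_mono) auto
    have t1: "t < r" using t M by (smt (verit) mult_left_mono mult_cancel_left1)
    let ?x = "x0 + t *\<^sub>R v"
    have "norm (P ?x - P x0) \<le> e / (norm v + 1) * norm (t *\<^sub>R v)"
      using d1(2)[of ?x] tv t v linear_scale[OF lT, of t v] by simp
    also have "\<dots> = t * (e * (norm v / (norm v + 1)))" using t by simp
    also have "\<dots> \<le> t * e"
    proof -
      have "norm v / (norm v + 1) \<le> 1" by (simp add: divide_le_eq_1 add_nonneg_pos)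
      then have "e * (norm v / (norm v + 1)) \<le> e" using e by (intro mult_left_le) auto
      then show ?thesis by (rule mult_left_mono[OF _ less_imp_le[OF t(1)]])
    qed
    finally have Px: "norm (P x0 - P ?x) \<le> t * e" by (simp add: norm_minus_commute)
    also have "t * e < r" using t1 e t by (smt (verit) mult_left_le)
    finally have "norm (P x0 - P ?x) < r" .
    moreover have "t * norm v < r" using tv t by linarith
    then have "?x \<in> ball x0 r" using t(1) by (simp add: dist_norm)
    ultimately obtain x' where x': "P x' = P x0" "norm (x' - ?x) \<le> K * norm (P x0 - P ?x)"
      using r(3) by blast
    have x'': "norm (x' - ?x) \<le> K * (t * e)" using x'(2) mult_left_mono[OF Px, of K] r(2) by linarith
    also have "\<dots> \<le> K * t" using t e r by (simp add: mult_left_le)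
    finally have a: "norm (x' - x0) \<le> t * norm v + K * t"
      using norm_triangle_ineq[of "x' - ?x" "t *\<^sub>R v"] t by simp
    also have "\<dots> = t * (norm v + K)" by (simp add: algebra_simps)
    also have "\<dots> \<le> t * M" using M t by (intro mult_left_mono) auto
    finally have "norm (x' - x0) < d2" using t by simp
    from d2(2)[OF this] x'(1) have "norm (F' (x' - x0)) \<le> e * norm (x' - x0)" by simp
    also have "\<dots> \<le> e * (t * norm v + K * t)" using a e by (intro mult_left_mono) auto
    finally have b: "norm (F' (x' - x0)) \<le> e * (t * norm v + K * t)" .
    have c: "norm (F' (x' - ?x)) \<le> K * (t * e) * B" using B(2)[of "x' - ?x"] mult_right_mono[OF x'', of B] B(1) by linarith
    have "t *\<^sub>R F' v = F' (x' - x0) - F' (x' - ?x)"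
      by (simp add: linear_diff[OF lF, symmetric] linear_scale[OF lF, symmetric])
    then have "t * norm (F' v) = norm (F' (x' - x0) - F' (x' - ?x))" using t by (metis norm_scaleR abs_of_pos)
    also have "\<dots> \<le> e * (t * norm v + K * t) + K * (t * e) * B"
      using norm_triangle_ineq4 add_mono[OF b c] order_trans by blast
    also have "\<dots> = t * (e * (norm v + K + B * K))" by (simp add: algebra_simps)
    finally show ?thesis using t(1) by simp
  qed
  define M where "M = norm v + K + B * K"
  have M: "M > 0" using B r by (simp add: M_def add_nonneg_pos add_pos_pos)
  have "norm (F' v) \<le> 0 + e" if "e > 0" for e
  proof -
    have "norm (F' v) \<le> min 1 (e / M) * M" using main[of "min 1 (e / M)"] that M by (simp add: M_def)
    also have "\<dots> \<le> e / M * M" using M by (intro mult_right_mono) auto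
    finally show ?thesis using M by simp
  qed
  then have "norm (F' v) \<le> 0" by (rule field_le_epsilon)
  then show ?thesis by simp
qed

text \<open>The candidate \<open>L\<close> is \<open>F'\<close> after a norm-bounded right inverse
  \<open>s\<close> of the derivative of \<open>P\<close>. Such an \<open>s\<close> need be neither
  linear nor continuous, but \<open>F'\<close> vanishes on the kernel, so \<open>L\<close> does not
  depend on the choice and is linear; the bound on \<open>s\<close> makes it bounded.\<close>

lemma submersion_descend_derivative:
  fixes P :: "'a::banach \<Rightarrow> 'b::banach" and f :: "'b \<Rightarrow> 'c::real_normed_vector"
  assumes sub: "submersion_on U P" and x0: "x0 \<in> U"
    and F': "((\<lambda>x. f (P x)) has_derivative F') (at x0)"
  obtains L where "(f has_derivative L) (at (P x0))"
    "\<And>h. L (frechet_derivative P (at x0) h) = F' h"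
proof -
  let ?T = "frechet_derivative P (at x0)"
  have P': "(P has_derivative ?T) (at x0)" and sj: "surj ?T"
    using sub x0 smooth_on_has_derivative unfolding submersion_on_def by blast+
  have bF: "bounded_linear F'" using F' by (rule has_derivative_bounded_linear)
  note lF = bounded_linear.linear[OF bF]
  have bT: "bounded_linear ?T" using P' by (rule has_derivative_bounded_linear)
  note lT = bounded_linear.linear[OF bT]
  obtain B where B: "B > 0" "\<And>h. norm (F' h) \<le> norm h * B" using bounded_linear.pos_bounded[OF bF] by blast
  obtain C where C: "C > 0" "\<And>y. \<exists>x. ?T x = y \<and> norm x \<le> C * norm y"
    using open_mapping[OF bT sj] by blast
  then obtain s where s: "\<And>y. ?T (s y) = y" "\<And>y. norm (s y) \<le> C * norm y" by metis
  note ker = submersion_kernel[OF sub x0 F']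
  define L where "L y = F' (s y)" for y
  have LT: "L (?T h) = F' h" for h
    using ker[of "s (?T h) - h"] by (simp add: L_def linear_diff[OF lT] linear_diff[OF lF] s)
  have "linear L"
  proof (rule linearI)
    show "L (y + z) = L y + L z" for y z
      using LT[of "s y + s z"] by (simp add: linear_add[OF lT] linear_add[OF lF] s) (simp add: L_def)
    show "L (c *\<^sub>R y) = c *\<^sub>R L y" for c y
      using LT[of "c *\<^sub>R s y"] by (simp add: linear_scale[OF lT] linear_scale[OF lF] s) (simp add: L_def)
  qed
  moreover have "norm (L y) \<le> norm y * (C * B)" for y
  proof -
    have "norm (s y) * B \<le> C * norm y * B" using s(2) B(1) by (intro mult_right_mono) auto
    then show ?thesis using B(2)[of "s y"] unfolding L_def by (simp add: mult_ac)
  qed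
  ultimately have bL: "bounded_linear L" by (auto simp: bounded_linear_def bounded_linear_axioms_def)
  \<comment> \<open>Subtracting \<open>L\<close> reduces the claim to derivative 0. A remainder that
    is o(norm (x' - x0)) upstairs becomes o(norm (y - P x0)) downstairs, since points near
    \<open>P x0\<close> have preimages x' at comparable distance from \<open>x0\<close>.\<close>
  let ?g = "\<lambda>y. f y - L y"
  have "((\<lambda>x. f (P x) - L (P x)) has_derivative (\<lambda>h. F' h - L (?T h))) (at x0)"
    by (intro has_derivative_diff F' bounded_linear.has_derivative[OF bL P'])
  then have g': "((\<lambda>x. ?g (P x)) has_derivative (\<lambda>h. 0)) (at x0)" by (simp add: LT)
  obtain r K where r: "r > 0" "K > 0" "\<And>x y. x \<in> ball x0 r \<Longrightarrow> norm (y - P x) < r \<Longrightarrow> \<exists>x'\<in>U. P x' = y \<and> norm (x' - x) \<le> K * norm (y - P x)"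
    using submersion_local_lift[OF sub x0] by metis
  have "(?g has_derivative (\<lambda>h. 0)) (at (P x0))"
    unfolding has_derivative_at_alt
  proof (intro conjI allI impI)
    fix e :: real assume "e > 0"
    then have "e / K > 0" using r by simp
    then obtain d where d: "d > 0" "\<And>z. norm (z - x0) < d \<Longrightarrow> norm (?g (P z) - ?g (P x0) - 0) \<le> e / K * norm (z - x0)"
      using g' unfolding has_derivative_at_alt by metis
    show "\<exists>d>0. \<forall>y. norm (y - P x0) < d \<longrightarrow> norm (?g y - ?g (P x0) - 0) \<le> e * norm (y - P x0)"
    proof (intro exI[of _ "min r (d / K)"] conjI allI impI)
      show "min r (d / K) > 0" using r d by simp
      fix y assume y: "norm (y - P x0) < min r (d / K)"
      then obtain x' where x': "P x' = y" "norm (x' - x0) \<le> K * norm (y - P x0)"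
        using r(3)[of x0 y] r(1) by auto
      have "K * norm (y - P x0) < d" using y r(2) by (simp add: field_simps)
      then have "norm (x' - x0) < d" using x' by linarith
      from d(2)[OF this] have "norm (?g y - ?g (P x0) - 0) \<le> e / K * norm (x' - x0)" by (simp add: x'(1))
      also have "\<dots> \<le> e / K * (K * norm (y - P x0))"
        using x' \<open>e / K > 0\<close> by (intro mult_left_mono) auto
      finally show "norm (?g y - ?g (P x0) - 0) \<le> e * norm (y - P x0)" using r(2) by simp
    qed
  qed simp
  from has_derivative_add[OF this bounded_linear_imp_has_derivative[OF bL]]
  have "(f has_derivative L) (at (P x0))" by simp
  with LT that show ?thesis by blast
qed

text \<open>The derivative is block triangular: the base direction is covered by the derivative of
  \<open>P\<close>, and the fibre direction by \<open>A (x, _)\<close>, which is its own derivative.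
  Besides the tangent map of \<open>P\<close> this covers the frame map used for the smoothness of
  the induced bundle map.\<close>

lemma submersion_bundle:
  fixes P :: "'a::real_normed_vector \<Rightarrow> 'b::real_normed_vector"
    and A :: "'a \<times> 'c::real_normed_vector \<Rightarrow> 'd::real_normed_vector"
  assumes P: "submersion_on U P" and A: "smooth_on (U \<times> UNIV) A"
    and lin: "\<And>x. x \<in> U \<Longrightarrow> linear (\<lambda>v. A (x, v))" and sj: "\<And>x. x \<in> U \<Longrightarrow> surj (\<lambda>v. A (x, v))"
  shows "submersion_on (U \<times> UNIV) (\<lambda>(x, v). (P x, A (x, v)))"
proof -
  have oU: "open U" using P smooth_on_open unfolding submersion_on_def by blast
  then have oUV: "open (U \<times> (UNIV :: 'c set))" by (simp add: open_Times)
  have "smooth_on U P" using P by (simp add: submersion_on_def)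
  from smooth_on_compose[OF this smooth_on_bounded_linear[OF oUV bounded_linear_fst]]
  have "smooth_on (U \<times> (UNIV :: 'c set)) (\<lambda>z. P (fst z))" by auto
  from smooth_on_Pair[OF this A] have sm: "smooth_on (U \<times> UNIV) (\<lambda>(x, v). (P x, A (x, v)))"
    by (simp add: case_prod_unfold)
  moreover have "surj (frechet_derivative (\<lambda>(x, v). (P x, A (x, v))) (at z))" if z: "z \<in> U \<times> UNIV" for z
  proof -
    obtain x v where xv: "z = (x, v)" "x \<in> U" using z by auto
    let ?P' = "frechet_derivative P (at x)" and ?A' = "frechet_derivative A (at z)"
    have P': "(P has_derivative ?P') (at x)"
      using P xv smooth_on_has_derivative unfolding submersion_on_def by blast
    have A': "(A has_derivative ?A') (at z)" using smooth_on_has_derivative[OF A z] .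
    note lA' = bounded_linear.linear[OF has_derivative_bounded_linear[OF A']]
    have Pf: "((\<lambda>z. P (fst z)) has_derivative (\<lambda>h. ?P' (fst h))) (at z)"
      by (rule has_derivative_compose[of fst fst z UNIV P ?P'])
        (use P' xv in \<open>auto intro!: bounded_linear_imp_has_derivative bounded_linear_fst\<close>)
    have "((\<lambda>z. (P (fst z), A z)) has_derivative (\<lambda>h. (?P' (fst h), ?A' h))) (at z)"
      by (rule has_derivative_Pair[OF Pf A'])
    from frechet_derivative_at[OF this]
    have fd: "frechet_derivative (\<lambda>(x, v). (P x, A (x, v))) (at z) = (\<lambda>h. (?P' (fst h), ?A' h))"
      by (simp add: case_prod_unfold)
    \<comment> \<open>Along the line through \<open>z\<close> in direction \<open>(0, w)\<close> the
      map \<open>A\<close> is affine, so its slope is read off exactly.\<close>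
    have vert: "?A' (0, w) = A (x, w)" for w
    proof -
      have l: "((\<lambda>t::real. z + t *\<^sub>R (0, w)) has_derivative (\<lambda>t. t *\<^sub>R (0, w))) (at 0)"
        by (auto intro!: derivative_eq_intros)
      have "(A has_derivative ?A') (at (z + 0 *\<^sub>R (0, w)))" using A' by (simp add: zero_prod_def[symmetric])
      from has_derivative_compose[OF l this]
      have d1: "((\<lambda>t. A (z + t *\<^sub>R (0, w))) has_derivative (\<lambda>t. ?A' (t *\<^sub>R (0, w)))) (at 0)" .
      have e1: "A (z + t *\<^sub>R (0, w)) = A (x, v) + t *\<^sub>R A (x, w)" for t
        using linear_add[OF lin[OF xv(2)], of v "t *\<^sub>R w"] linear_scale[OF lin[OF xv(2)], of t w] xv by simp
      have d2: "((\<lambda>t::real. A (x, v) + t *\<^sub>R A (x, w)) has_derivative (\<lambda>t. t *\<^sub>R A (x, w))) (at 0)"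
        by (auto intro!: derivative_eq_intros)
      have "(\<lambda>t. ?A' (t *\<^sub>R (0, w))) = (\<lambda>t. t *\<^sub>R A (x, w))"
        by (rule has_derivative_unique[OF d1[unfolded e1] d2])
      from fun_cong[OF this, of 1] show ?thesis by simp
    qed
    have "\<exists>h. (?P' (fst h), ?A' h) = (a, b)" for a b
    proof -
      obtain k where k: "?P' k = a" using P xv unfolding submersion_on_def by (metis surjD)
      obtain w where "A (x, w) = b - ?A' (k, 0)" using sj[OF xv(2)] by (metis surjD)
      then have "?A' (k, w) = b"
        using linear_add[OF lA', of "(k, 0)" "(0, w)"] vert by simp
      then show ?thesis using k by (intro exI[of _ "(k, w)"]) simp
    qed
    then show ?thesis unfolding fd surj_def by (metis surj_pair)
  qed
  ultimately show ?thesis by (simp add: submersion_on_def)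
qed

lemma submersion_tangent:
  fixes P :: "'a::real_normed_vector \<Rightarrow> 'b::real_normed_vector"
  assumes "submersion_on U P"
  shows "submersion_on (U \<times> UNIV) (\<lambda>(x, v). (P x, frechet_derivative P (at x) v))"
proof -
  have sm: "smooth_on U P" using assms by (simp add: submersion_on_def)
  have "submersion_on (U \<times> UNIV) (\<lambda>(x, v). (P x, (\<lambda>(x, v). frechet_derivative P (at x) v) (x, v)))"
  proof (rule submersion_bundle[OF assms smooth_on_derivative[OF sm]])
    show "linear (\<lambda>v. case (x, v) of (x, v) \<Rightarrow> frechet_derivative P (at x) v)" if "x \<in> U" for x
      using bounded_linear.linear[OF has_derivative_bounded_linear[OF smooth_on_has_derivative[OF sm that]]] by simp
  qed (use assms in \<open>auto simp: submersion_on_def\<close>)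
  then show ?thesis by simp
qed

lemma submersion_linear_outer:
  assumes "submersion_on U P" "bounded_linear l" "surj l"
  shows "submersion_on U (\<lambda>x. l (P x))"
  unfolding submersion_on_def
proof (intro conjI ballI)
  have "smooth_on U P" using assms(1) by (simp add: submersion_on_def)
  from smooth_on_compose[OF smooth_on_bounded_linear[OF open_UNIV assms(2)] this]
  show "smooth_on U (\<lambda>x. l (P x))" by simp
  fix x assume x: "x \<in> U"
  then have "(P has_derivative frechet_derivative P (at x)) (at x)"
    using assms(1) smooth_on_has_derivative unfolding submersion_on_def by blast
  from frechet_derivative_at[OF bounded_linear.has_derivative[OF assms(2) this]]
  have eq: "frechet_derivative (\<lambda>x. l (P x)) (at x) = l \<circ> frechet_derivative P (at x)" by (simp add: o_def)
  show "surj (frechet_derivative (\<lambda>x. l (P x)) (at x))"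
    unfolding eq by (rule comp_surj) (use assms x in \<open>auto simp: submersion_on_def\<close>)
qed

lemma submersion_linear_inner:
  assumes "submersion_on U P" "bounded_linear m" "surj m"
  shows "submersion_on (m -` U) (\<lambda>x. P (m x))"
  unfolding submersion_on_def
proof (intro conjI ballI)
  have "open U" using assms(1) smooth_on_open unfolding submersion_on_def by blast
  then have "open (m -` U)" using assms(2) by (rule open_vimage_linear[rotated])
  moreover have "smooth_on U P" using assms(1) by (simp add: submersion_on_def)
  ultimately show "smooth_on (m -` U) (\<lambda>x. P (m x))"
    using smooth_on_compose[OF _ smooth_on_bounded_linear[OF _ assms(2)], of U P "m -` U"] by auto
  fix x assume x: "x \<in> m -` U"
  then have "(P has_derivative frechet_derivative P (at (m x))) (at (m x))"
    using assms(1) smooth_on_has_derivative unfolding submersion_on_def by blast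
  from frechet_derivative_at[OF has_derivative_compose[OF bounded_linear_imp_has_derivative[OF assms(2)] this]]
  have eq: "frechet_derivative (\<lambda>x. P (m x)) (at x) = frechet_derivative P (at (m x)) \<circ> m" by (simp add: o_def)
  show "surj (frechet_derivative (\<lambda>x. P (m x)) (at x))"
    unfolding eq by (rule comp_surj) (use assms x in \<open>auto simp: submersion_on_def\<close>)
qed

text \<open>Both spaces are sequence spaces, so \<open>TP\<close> is again a map between the same
  types and the induction hypothesis applies to it. Order 0 is the statement that an open continuous
  surjection is a quotient map.\<close>

lemma Ck_descend:
  fixes P :: "'a::banach seq \<Rightarrow> 'b::banach seq" and f :: "'b seq \<Rightarrow> 'c::real_normed_vector"
  assumes "submersion_on U P" "Ck k U (\<lambda>x. f (P x))"
  shows "Ck k (P ` U) f"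
  using assms
proof (induction k arbitrary: U P f)
  case 0
  show ?case unfolding Ck.simps
  proof (rule continuous_on_open_vimage[THEN iffD2, rule_format])
    show oPU: "open (P ` U)" by (rule submersion_open_image[OF 0(1)])
    fix W :: "'c set" assume W: "open W"
    have oU: "open U" using 0(1) smooth_on_open unfolding submersion_on_def by blast
    have "open (U \<inter> (\<lambda>x. f (P x)) -` W)"
      using 0(2) W oU by (simp add: continuous_on_open_vimage Int_commute)
    then have "open (P ` (U \<inter> (\<lambda>x. f (P x)) -` W))"
      by (intro submersion_open_image[OF submersion_on_subset[OF 0(1)]]) auto
    also have "P ` (U \<inter> (\<lambda>x. f (P x)) -` W) = f -` W \<inter> P ` U" by auto
    finally show "open (f -` W \<inter> P ` U)" .
  qed
next
  case (Suc k)
  note sub = Suc.prems(1)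
  from Suc.prems(2) obtain F' where F': "\<And>x. x \<in> U \<Longrightarrow> ((\<lambda>x. f (P x)) has_derivative F' x) (at x)"
    "Ck k (fstS -` U) (\<lambda>z. F' (fstS z) (sndS z))" by (rule Ck_SucE) blast
  have oU: "open U" using sub smooth_on_open unfolding submersion_on_def by blast
  let ?f' = "\<lambda>y. frechet_derivative f (at y)" and ?P' = "\<lambda>x. frechet_derivative P (at x)"
  have f': "(f has_derivative ?f' (P x)) (at (P x)) \<and> (\<forall>h. ?f' (P x) (?P' x h) = F' x h)" if x: "x \<in> U" for x
  proof -
    obtain L where L: "(f has_derivative L) (at (P x))" "\<And>h. L (?P' x h) = F' x h"
      using submersion_descend_derivative[OF sub x F'(1)[OF x]] by blast
    have "?f' (P x) = L" using frechet_derivative_at[OF L(1)] by simp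
    then show ?thesis using L by simp
  qed
  let ?TP = "\<lambda>z. pairS (P (fstS z)) (?P' (fstS z) (sndS z))"
  let ?m = "\<lambda>z :: 'a seq. (fstS z, sndS z)"
  have m: "bounded_linear ?m" "surj ?m"
    by (intro bounded_linear_Pair bounded_linear_fstS bounded_linear_sndS)
      (auto simp: surj_def intro: exI[of _ "pairS _ _"])
  have l: "surj (\<lambda>(x, y). pairS x y :: 'b seq)"
    unfolding surj_def by (metis pairS_surj case_prod_conv)
  have "submersion_on (?m -` (U \<times> UNIV)) (\<lambda>z. (\<lambda>(x, y). pairS x y) ((\<lambda>(x, v). (P x, ?P' x v)) (?m z)))"
    by (intro submersion_linear_outer[OF _ bounded_linear_pairS l]
        submersion_linear_inner[OF submersion_tangent[OF sub] m])
  moreover have "?m -` (U \<times> UNIV) = fstS -` U" by auto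
  ultimately have TP: "submersion_on (fstS -` U) ?TP" by simp
  have img: "?TP ` (fstS -` U) = fstS -` (P ` U)"
  proof (intro equalityI subsetI)
    fix y assume "y \<in> fstS -` (P ` U)"
    then obtain x where x: "x \<in> U" "fstS y = P x" by auto
    obtain h where h: "?P' x h = sndS y" using sub x(1) unfolding submersion_on_def by (metis surjD)
    have "y = ?TP (pairS x h)" using x h pairS_surj[of y] by simp
    then show "y \<in> ?TP ` (fstS -` U)" using x by (intro image_eqI[of _ _ "pairS x h"]) auto
  qed auto
  have "Ck k (fstS -` U) (\<lambda>z. (\<lambda>z. ?f' (fstS z) (sndS z)) (?TP z))"
    by (rule Ck_cong[THEN iffD1, OF open_fstS[OF oU] _ F'(2)]) (use f' in auto)
  from Suc.IH[OF TP this] have "Ck k (fstS -` (P ` U)) (\<lambda>z. ?f' (fstS z) (sndS z))"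
    unfolding img .
  then show ?case
    by (rule Ck_SucI[rotated -1]) (use f' submersion_open_image[OF sub] in auto)
qed

definition sndmap :: "('a::real_normed_vector \<times> 'b::real_normed_vector) seq \<Rightarrow> 'b seq" where
  "sndmap z = Bcontfun (\<lambda>n. snd (z n))"

text \<open>Used to exhibit preimages: the first component is read at coordinate 0 only, and a
  constant one keeps the sequence bounded.\<close>

definition conspair :: "'a::real_normed_vector \<Rightarrow> 'b::real_normed_vector seq \<Rightarrow> ('a \<times> 'b) seq" where
  "conspair x z = Bcontfun (\<lambda>n. (x, z n))"

lemma sndmap_apply [simp]: "sndmap z n = snd (z n)"
  unfolding sndmap_def
proof (subst apply_Bcontfun_nat[where b="norm z"])
  show "norm (snd (z n)) \<le> norm z" for n
    using norm_snd_le[of "snd (z n)" "fst (z n)"] norm_bounded[of z n] by simp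
qed simp

lemma conspair_apply [simp]: "conspair x z n = (x, z n)"
  unfolding conspair_def
proof (subst apply_Bcontfun_nat[where b="norm x + norm z"])
  show "norm (x, z n) \<le> norm x + norm z" for n
    using norm_Pair_le[of x "z n"] norm_bounded[of z n] by simp
qed simp

lemma bounded_linear_sndmap: "bounded_linear sndmap"
proof (rule bounded_linear_intro[where K=1])
  fix z :: "('a \<times> 'b) seq"
  show "norm (sndmap z) \<le> norm z * 1"
  proof (rule norm_bound)
    fix n show "norm (sndmap z n) \<le> norm z * 1"
      using norm_snd_le[of "snd (z n)" "fst (z n)"] norm_bounded[of z n] by simp
  qed
qed (auto intro!: bcontfun_eqI)

text \<open>
  \<open>P\<close> acts on coordinate \<open>0\<close> only, so its lift to sequences is not a submersion; the other
  coordinates of the target are filled from a second, free sequence.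
\<close>

theorem smooth_on_descend:
  fixes P :: "'a::banach \<Rightarrow> 'b::banach" and f :: "'b \<Rightarrow> 'c::real_normed_vector"
  assumes sub: "submersion_on U P" and smooth: "smooth_on U (\<lambda>x. f (P x))"
  shows "smooth_on (P ` U) f"
  unfolding smooth_on_iff_Ck
proof (intro conjI allI)
  show "open (P ` U)" using submersion_open_image[OF sub] .
  fix k
  have oU: "open U" using sub smooth_on_open unfolding submersion_on_def by blast
  have smP: "smooth_on U P" using sub by (simp add: submersion_on_def)
  let ?p0 = "\<lambda>z :: ('a \<times> 'b) seq. fst (coord0 z)"
  have p0: "bounded_linear ?p0" by (rule bounded_linear_compose[OF bounded_linear_fst bounded_linear_apply])
  let ?U = "?p0 -` U"
  have oU': "open ?U" using open_vimage_linear[OF p0 oU] .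
  let ?l = "\<lambda>z :: ('a \<times> 'b) seq. sndmap z - single (snd (coord0 z))"
  have l: "bounded_linear ?l"
    by (intro bounded_linear_sub bounded_linear_sndmap bounded_linear_compose[OF bounded_linear_single]
        bounded_linear_compose[OF bounded_linear_snd bounded_linear_apply])
  let ?Q = "\<lambda>z. single (P (?p0 z)) + ?l z"
  have Q': "(?Q has_derivative (\<lambda>h. single (frechet_derivative P (at (?p0 z)) (?p0 h)) + ?l h)) (at z)" if "z \<in> ?U" for z
  proof -
    have "(P has_derivative frechet_derivative P (at (?p0 z))) (at (?p0 z))"
      using smooth_on_has_derivative[OF smP] that by simp
    from has_derivative_compose[OF bounded_linear_imp_has_derivative[OF p0] this]
    show ?thesis
      by (rule has_derivative_add[OF bounded_linear.has_derivative[OF bounded_linear_single]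
            bounded_linear_imp_has_derivative[OF l]])
  qed
  have "smooth_on ?U (\<lambda>z. (P (?p0 z), ?l z))"
    by (intro smooth_on_Pair smooth_on_bounded_linear[OF oU' l]
        smooth_on_compose[OF smP smooth_on_bounded_linear[OF oU' p0]]) auto
  moreover have "bounded_linear (\<lambda>(y, w). single y + w)"
    unfolding case_prod_unfold
    by (intro bounded_linear_add bounded_linear_snd bounded_linear_compose[OF bounded_linear_single bounded_linear_fst])
  ultimately have smQ: "smooth_on ?U ?Q"
    using smooth_on_compose[OF smooth_on_bounded_linear[OF open_UNIV], of "\<lambda>(y, w). single y + w" ?U "\<lambda>z. (P (?p0 z), ?l z)"]
    by simp
  have "submersion_on ?U ?Q"
    unfolding submersion_on_def
  proof (intro conjI ballI smQ)
    fix z assume z: "z \<in> ?U"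
    let ?P' = "frechet_derivative P (at (?p0 z))"
    have fd: "frechet_derivative ?Q (at z) = (\<lambda>h. single (?P' (?p0 h)) + ?l h)"
      using frechet_derivative_at[OF Q'[OF z]] by simp
    have "surj ?P'" using sub z by (simp add: submersion_on_def)
    then have "\<exists>h. t = single (?P' (?p0 h)) + ?l h" for t
    proof -
      obtain x where "?P' x = t 0" using \<open>surj ?P'\<close> by (metis surjD)
      \<comment> \<open>The map \<open>?l\<close> reproduces \<open>t\<close> except at coordinate
        0, which it sets to 0; the preimage \<open>x\<close> of \<open>t 0\<close> under
        \<open>?P'\<close> supplies that coordinate.\<close>
      then have "t = single (?P' (?p0 (conspair x t))) + ?l (conspair x t)"
        by (intro bcontfun_eqI) simp
      then show ?thesis by blast
    qed
    then show "surj (frechet_derivative ?Q (at z))" unfolding fd surj_def by blast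
  qed
  moreover have "Ck k ?U (\<lambda>z. f (coord0 (?Q z)))"
  proof -
    have "Ck k (coord0 -` U) (\<lambda>x. f (P (coord0 x)))"
      using smooth unfolding smooth_on_iff_Ck by blast
    from Ck_linear_inner[OF bounded_linear_compose[OF bounded_linear_single p0] open_coord0[OF oU] this]
    have "Ck k ((\<lambda>z. single (?p0 z)) -` coord0 -` U) (\<lambda>z. f (P (?p0 z)))" by simp
    moreover have "(\<lambda>z. single (?p0 z)) -` coord0 -` U = ?U" by auto
    ultimately show ?thesis by simp
  qed
  ultimately have "Ck k (?Q ` ?U) (\<lambda>y. f (coord0 y))"
    by (rule Ck_descend[where f="\<lambda>y. f (coord0 y)"])
  moreover have "coord0 -` (P ` U) \<subseteq> ?Q ` ?U"
  proof
    fix y :: "'b seq" assume "y \<in> coord0 -` (P ` U)"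
    then obtain x where x: "x \<in> U" "y 0 = P x" by auto
    then have "y = ?Q (conspair x y)" by (intro bcontfun_eqI) simp
    then show "y \<in> ?Q ` ?U" using x by (intro image_eqI[of _ _ "conspair x y"]) auto
  qed
  ultimately show "Ck k (coord0 -` (P ` U)) (\<lambda>z. f (coord0 z))"
    by (rule Ck_subset)
qed

section \<open>Maps between Banach manifolds\<close>

lemma smooth_on_continuous_on: "smooth_on S f \<Longrightarrow> continuous_on S f"
  using smooth_on_has_derivative has_derivative_continuous
  by (intro continuous_at_imp_continuous_on) blast

lemma smooth_on_vimage_open:
  assumes "smooth_on S f" "open T"
  shows "open (S \<inter> f -` T)"
  using assms smooth_on_continuous_on[OF assms(1)] smooth_on_open[OF assms(1)]
  by (simp add: continuous_on_open_vimage Int_commute)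

lemma smooth_on_id: "open S \<Longrightarrow> smooth_on S (\<lambda>x. x)"
  by (rule smooth_on_bounded_linear) (auto intro: bounded_linear_ident)

abbreviation chart_rep :: "('p, 'e) chart \<Rightarrow> ('q, 'f) chart \<Rightarrow> ('p \<Rightarrow> 'q) \<Rightarrow> 'e \<Rightarrow> 'f" where
  "chart_rep c d f \<equiv> snd d \<circ> f \<circ> chart_inv c"

text \<open>Enough to compute with \<open>chart_inv\<close>, and inherited by
  \<open>prod_atlas\<close> at once. Stated separately, it lets the composition lemma act on maps
  out of a product such as the group multiplication.\<close>

definition inj_charts :: "('p, 'e) chart set \<Rightarrow> bool" where
  "inj_charts A \<longleftrightarrow> (\<forall>c\<in>A. inj_on (snd c) (fst c))"

lemma banach_atlas_inj_charts: "banach_atlas A \<Longrightarrow> inj_charts A"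
  by (simp add: banach_atlas_def inj_charts_def)

lemma chart_inv_left: "inj_charts A \<Longrightarrow> c \<in> A \<Longrightarrow> p \<in> fst c \<Longrightarrow> chart_inv c (snd c p) = p"
  by (simp add: chart_inv_def inj_charts_def)

lemma chart_inv_right: "x \<in> snd c ` fst c \<Longrightarrow> snd c (chart_inv c x) = x"
  and chart_inv_in: "x \<in> snd c ` fst c \<Longrightarrow> chart_inv c x \<in> fst c"
  by (simp_all add: chart_inv_def f_inv_into_f inv_into_into)

lemma chart_image_iff:
  assumes "inj_charts A" "c \<in> A"
  shows "x \<in> snd c ` (fst c \<inter> W) \<longleftrightarrow> x \<in> snd c ` fst c \<and> chart_inv c x \<in> W"
  using chart_inv_left[OF assms] by auto

lemma open_chart_image: "banach_atlas A \<Longrightarrow> c \<in> A \<Longrightarrow> open (snd c ` fst c)"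
  unfolding banach_atlas_def using smooth_on_open by (metis Int_absorb)

lemma chart_at:
  assumes "p \<in> points A"
  shows "chart_at A p \<in> A" "p \<in> fst (chart_at A p)"
proof -
  have "\<exists>c. c \<in> A \<and> p \<in> fst c" using assms by (auto simp: points_def)
  then have "chart_at A p \<in> A \<and> p \<in> fst (chart_at A p)" unfolding chart_at_def by (rule someI_ex)
  then show "chart_at A p \<in> A" "p \<in> fst (chart_at A p)" by auto
qed

lemma in_points: "c \<in> A \<Longrightarrow> p \<in> fst c \<Longrightarrow> p \<in> points A"
  by (auto simp: points_def)

lemma chart_change_has_derivative:
  assumes "banach_atlas A" "c \<in> A" "d \<in> A" "p \<in> fst c" "p \<in> fst d"
  shows "((snd d \<circ> chart_inv c) has_derivative chart_change c d p) (at (snd c p))"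
proof -
  have "smooth_on (snd c ` (fst c \<inter> fst d)) (snd d \<circ> chart_inv c)"
    using assms by (auto simp: banach_atlas_def)
  moreover have "snd c p \<in> snd c ` (fst c \<inter> fst d)" using assms by auto
  ultimately show ?thesis unfolding chart_change_def by (rule smooth_on_has_derivative)
qed

lemma chart_change_linear:
  assumes "banach_atlas A" "c \<in> A" "d \<in> A" "p \<in> fst c" "p \<in> fst d"
  shows "bounded_linear (chart_change c d p)"
  using chart_change_has_derivative[OF assms] by (rule has_derivative_bounded_linear)

lemma open_chart_overlap:
  assumes "banach_atlas A" "c \<in> A" "d \<in> A"
  shows "open (snd c ` (fst c \<inter> fst d))"
  using assms smooth_on_open unfolding banach_atlas_def by blast

lemma chart_change_comp:
  assumes A: "banach_atlas A" and c: "c \<in> A" "p \<in> fst c" and d: "d \<in> A" "p \<in> fst d" and e: "e \<in> A" "p \<in> fst e"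
  shows "chart_change d e p (chart_change c d p v) = chart_change c e p v"
proof -
  note ic = banach_atlas_inj_charts[OF A]
  have "((\<lambda>x. (snd e \<circ> chart_inv d) ((snd d \<circ> chart_inv c) x)) has_derivative
      (\<lambda>h. chart_change d e p (chart_change c d p h))) (at (snd c p))"
    by (rule has_derivative_compose[OF chart_change_has_derivative[OF A c(1) d(1) c(2) d(2)]])
      (use chart_change_has_derivative[OF A d(1) e(1) d(2) e(2)] chart_inv_left[OF ic c] in \<open>simp add: o_def\<close>)
  then have "((snd e \<circ> chart_inv c) has_derivative
      (\<lambda>h. chart_change d e p (chart_change c d p h))) (at (snd c p))"
    by (rule has_derivative_open_cong[OF open_chart_overlap[OF A c(1) d(1)], THEN iffD1, rotated -1])
      (use c d in \<open>auto simp: chart_inv_left[OF ic]\<close>)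
  from has_derivative_unique[OF this chart_change_has_derivative[OF A c(1) e(1) c(2) e(2)]]
  show ?thesis by metis
qed

lemma chart_change_same:
  assumes A: "banach_atlas A" and c: "c \<in> A" "p \<in> fst c"
  shows "chart_change c c p v = v"
proof -
  have "((\<lambda>x. x) has_derivative (\<lambda>h. h)) (at (snd c p))" by simp
  then have "((snd c \<circ> chart_inv c) has_derivative (\<lambda>h. h)) (at (snd c p))"
    by (rule has_derivative_open_cong[OF open_chart_image[OF A c(1)], THEN iffD1, rotated -1])
      (use c in \<open>auto simp: chart_inv_right\<close>)
  from has_derivative_unique[OF this chart_change_has_derivative[OF A c(1) c(1) c(2) c(2)]]
  show ?thesis by metis
qed

lemma chart_change_inverse:
  assumes A: "banach_atlas A" and c: "c \<in> A" "p \<in> fst c" and d: "d \<in> A" "p \<in> fst d"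
  shows "chart_change d c p (chart_change c d p v) = v"
  using chart_change_comp[OF A c d c] chart_change_same[OF A c] by simp

lemma chart_change_surj:
  assumes A: "banach_atlas A" and c: "c \<in> A" "p \<in> fst c" and d: "d \<in> A" "p \<in> fst d"
  shows "surj (chart_change c d p)"
  using chart_change_inverse[OF A d c] by (metis surjI)

lemma smooth_map_points: "smooth_map A B f \<Longrightarrow> p \<in> points A \<Longrightarrow> f p \<in> points B"
  by (auto simp: smooth_map_def)

lemma smooth_map_rep:
  "smooth_map A B f \<Longrightarrow> c \<in> A \<Longrightarrow> d \<in> B \<Longrightarrow> smooth_on (snd c ` (fst c \<inter> f -` fst d)) (chart_rep c d f)"
  by (simp add: smooth_map_def)

lemma mderiv_has_derivative:
  assumes "smooth_map A B f" "p \<in> points A"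
  shows "(chart_rep (chart_at A p) (chart_at B (f p)) f has_derivative mderiv A B f p)
    (at (snd (chart_at A p) p))"
  unfolding mderiv_def
proof (rule smooth_on_has_derivative[OF smooth_map_rep[OF assms(1)]])
  note fp = smooth_map_points[OF assms]
  show "chart_at A p \<in> A" by (rule chart_at(1)[OF assms(2)])
  show "chart_at B (f p) \<in> B" by (rule chart_at(1)[OF fp])
  show "snd (chart_at A p) p \<in> snd (chart_at A p) ` (fst (chart_at A p) \<inter> f -` fst (chart_at B (f p)))"
    using chart_at(2)[OF assms(2)] chart_at(2)[OF fp] by auto
qed

lemma mderiv_bounded_linear:
  "smooth_map A B f \<Longrightarrow> p \<in> points A \<Longrightarrow> bounded_linear (mderiv A B f p)"
  using mderiv_has_derivative by (rule has_derivative_bounded_linear)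

text \<open>The bridge between \<open>mderiv\<close>, which refers to the chosen chart of each
  point, and fixed charts, in which alone dependence on the point can be differentiated.\<close>

lemma chart_rep_has_derivative:
  assumes A: "banach_atlas A" and B: "banach_atlas B" and f: "smooth_map A B f"
    and c: "c \<in> A" "p \<in> fst c" and d: "d \<in> B" "f p \<in> fst d"
  shows "(chart_rep c d f has_derivative
    (\<lambda>h. chart_change (chart_at B (f p)) d (f p) (mderiv A B f p (chart_change c (chart_at A p) p h)))) (at (snd c p))"
proof -
  note iA = banach_atlas_inj_charts[OF A] and iB = banach_atlas_inj_charts[OF B]
  have p: "p \<in> points A" by (rule in_points[OF c])
  note fp = smooth_map_points[OF f p]
  let ?c = "chart_at A p" and ?d = "chart_at B (f p)"
  note c' = chart_at[OF p] and d' = chart_at[OF fp]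
  have 1: "((snd ?c \<circ> chart_inv c) has_derivative chart_change c ?c p) (at (snd c p))"
    by (rule chart_change_has_derivative[OF A c(1) c'(1) c(2) c'(2)])
  have 2: "(chart_rep ?c ?d f has_derivative mderiv A B f p) (at ((snd ?c \<circ> chart_inv c) (snd c p)))"
    using mderiv_has_derivative[OF f p] chart_inv_left[OF iA c] by simp
  have 3: "((snd d \<circ> chart_inv ?d) has_derivative chart_change ?d d (f p)) (at (chart_rep ?c ?d f ((snd ?c \<circ> chart_inv c) (snd c p))))"
    using chart_change_has_derivative[OF B d'(1) d(1) d'(2) d(2)] chart_inv_left[OF iA c] chart_inv_left[OF iA c']
    by simp
  let ?O = "snd c ` (fst c \<inter> fst ?c) \<inter> snd c ` (fst c \<inter> f -` fst ?d)"
  have O: "open ?O"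
    by (intro open_Int open_chart_overlap[OF A c(1) c'(1)] smooth_on_open[OF smooth_map_rep[OF f c(1) d'(1)]])
  show ?thesis
  proof (rule has_derivative_open_cong[OF O, THEN iffD1, rotated -1])
    show "((\<lambda>x. (snd d \<circ> chart_inv ?d) (chart_rep ?c ?d f ((snd ?c \<circ> chart_inv c) x))) has_derivative
      (\<lambda>h. chart_change ?d d (f p) (mderiv A B f p (chart_change c ?c p h)))) (at (snd c p))"
      by (rule has_derivative_compose[OF has_derivative_compose[OF 1 2] 3])
    show "snd c p \<in> ?O" using c c' d' by auto
    fix x assume "x \<in> ?O"
    then have "chart_inv c x \<in> fst ?c" "chart_inv c x \<in> f -` fst ?d"
      using chart_image_iff[OF iA c(1), of x] by blast+
    then show "(snd d \<circ> chart_inv ?d) (chart_rep ?c ?d f ((snd ?c \<circ> chart_inv c) x)) = chart_rep c d f x"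
      using chart_inv_left[OF iA c'(1)] chart_inv_left[OF iB d'(1)] by simp
  qed
qed

lemma smooth_map_cong:
  assumes "inj_charts A" "\<And>p. p \<in> points A \<Longrightarrow> f p = g p"
  shows "smooth_map A B f \<longleftrightarrow> smooth_map A B g"
proof -
  have "smooth_on (snd c ` (fst c \<inter> f -` fst d)) (chart_rep c d f) \<longleftrightarrow>
      smooth_on (snd c ` (fst c \<inter> g -` fst d)) (chart_rep c d g)" if "c \<in> A" for c d
  proof -
    have "fst c \<inter> f -` fst d = fst c \<inter> g -` fst d" using assms(2) in_points[OF that] by auto
    moreover have "chart_rep c d f x = chart_rep c d g x" if "x \<in> snd c ` (fst c \<inter> g -` fst d)" for x
      using that assms(2) in_points[OF \<open>c \<in> A\<close>] chart_inv_left[OF assms(1) \<open>c \<in> A\<close>] by auto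
    ultimately show ?thesis using smooth_on_cong by metis
  qed
  moreover have im: "f ` points A = g ` points A" using assms(2) by (rule image_cong[OF refl])
  ultimately show ?thesis unfolding smooth_map_def im by blast
qed

lemma mderiv_cong:
  assumes "banach_atlas A" "\<And>p. p \<in> points A \<Longrightarrow> f p = g p" "p \<in> points A"
  shows "mderiv A B f p = mderiv A B g p"
  unfolding mderiv_def
proof -
  let ?c = "chart_at A p"
  note c = chart_at[OF assms(3)]
  have "frechet_derivative (chart_rep ?c (chart_at B (f p)) f) (at (snd ?c p)) =
     frechet_derivative (chart_rep ?c (chart_at B (f p)) g) (at (snd ?c p))"
  proof (rule frechet_derivative_open_cong[OF open_chart_image[OF assms(1) c(1)]])
    show "snd ?c p \<in> snd ?c ` fst ?c" using c(2) by blast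
    fix y assume "y \<in> snd ?c ` fst ?c"
    then have "chart_inv ?c y \<in> points A" by (intro in_points[OF c(1)] chart_inv_in)
    then show "chart_rep ?c (chart_at B (f p)) f y = chart_rep ?c (chart_at B (f p)) g y"
      using assms(2) by simp
  qed
  then show "frechet_derivative (chart_rep ?c (chart_at B (f p)) f) (at (snd ?c p)) =
     frechet_derivative (chart_rep ?c (chart_at B (g p)) g) (at (snd ?c p))"
    using assms by simp
qed

lemma smooth_map_compose:
  assumes iA: "inj_charts A" and B: "banach_atlas B" and f: "smooth_map A B f" and g: "smooth_map B C g"
  shows "smooth_map A C (\<lambda>p. g (f p))"
  unfolding smooth_map_def
proof (intro conjI ballI)
  show "(\<lambda>p. g (f p)) ` points A \<subseteq> points C" using f g by (force simp: smooth_map_def)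
  fix c e assume c: "c \<in> A" and e: "e \<in> C"
  note iB = banach_atlas_inj_charts[OF B]
  show "smooth_on (snd c ` (fst c \<inter> (\<lambda>p. g (f p)) -` fst e)) (chart_rep c e (\<lambda>p. g (f p)))"
  proof (rule smooth_on_localI)
    fix x assume "x \<in> snd c ` (fst c \<inter> (\<lambda>p. g (f p)) -` fst e)"
    then obtain p where p: "p \<in> fst c" "g (f p) \<in> fst e" "x = snd c p" by auto
    have "f p \<in> points B" using smooth_map_points[OF f in_points[OF c p(1)]] .
    then obtain d where d: "d \<in> B" "f p \<in> fst d" by (auto simp: points_def)
    let ?S = "snd c ` (fst c \<inter> f -` fst d)" and ?V = "snd d ` (fst d \<inter> g -` fst e)"
    note fs = smooth_map_rep[OF f c d(1)] and gs = smooth_map_rep[OF g d(1) e]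
    let ?T = "?S \<inter> chart_rep c d f -` ?V"
    have T: "open ?T" by (rule smooth_on_vimage_open[OF fs smooth_on_open[OF gs]])
    have comp: "smooth_on ?T (\<lambda>x. chart_rep d e g (chart_rep c d f x))"
      by (rule smooth_on_compose[OF gs smooth_on_subset[OF fs T]]) auto
    have inT: "chart_inv c y \<in> fst c" "f (chart_inv c y) \<in> fst d" "g (f (chart_inv c y)) \<in> fst e" if "y \<in> ?T" for y
    proof -
      from that have y: "y \<in> snd c ` fst c" "f (chart_inv c y) \<in> fst d"
        using chart_image_iff[OF iA c, of y] by auto
      show "chart_inv c y \<in> fst c" by (rule chart_inv_in[OF y(1)])
      show "f (chart_inv c y) \<in> fst d" by (rule y(2))
      have "chart_inv d (snd d (f (chart_inv c y))) \<in> g -` fst e"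
        using that chart_image_iff[OF iB d(1), of "snd d (f (chart_inv c y))" "g -` fst e"] by auto
      then show "g (f (chart_inv c y)) \<in> fst e" using chart_inv_left[OF iB d(1) y(2)] by simp
    qed
    have s3: "smooth_on ?T (chart_rep c e (\<lambda>p. g (f p)))"
    proof (rule smooth_on_cong[THEN iffD1, OF _ comp])
      fix y assume "y \<in> ?T"
      from chart_inv_left[OF iB d(1) inT(2)[OF this]]
      show "chart_rep d e g (chart_rep c d f y) = chart_rep c e (\<lambda>p. g (f p)) y" by simp
    qed
    have s1: "x \<in> ?T" using p d by (auto simp: chart_inv_left[OF iA c])
    have s2: "?T \<subseteq> snd c ` (fst c \<inter> (\<lambda>p. g (f p)) -` fst e)"
    proof
      fix y assume y: "y \<in> ?T"
      then have "y \<in> snd c ` fst c" by auto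
      then show "y \<in> snd c ` (fst c \<inter> (\<lambda>p. g (f p)) -` fst e)"
        using chart_image_iff[OF iA c] inT[OF y] by simp
    qed
    show "\<exists>T. x \<in> T \<and> T \<subseteq> snd c ` (fst c \<inter> (\<lambda>p. g (f p)) -` fst e) \<and>
        smooth_on T (chart_rep c e (\<lambda>p. g (f p)))" by (intro exI[of _ ?T] conjI s1 s2 s3)
  qed
qed

lemma mderiv_compose:
  assumes A: "banach_atlas A" and B: "banach_atlas B" and f: "smooth_map A B f" and g: "smooth_map B C g"
    and p: "p \<in> points A"
  shows "mderiv A C (\<lambda>p. g (f p)) p v = mderiv B C g (f p) (mderiv A B f p v)"
proof -
  note iA = banach_atlas_inj_charts[OF A] and iB = banach_atlas_inj_charts[OF B]
  note fp = smooth_map_points[OF f p]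
  let ?c = "chart_at A p" and ?d = "chart_at B (f p)" and ?e = "chart_at C (g (f p))"
  note c = chart_at[OF p] and d = chart_at[OF fp]
  have "(chart_rep ?d ?e g has_derivative mderiv B C g (f p)) (at (chart_rep ?c ?d f (snd ?c p)))"
    using mderiv_has_derivative[OF g fp] chart_inv_left[OF iA c] by simp
  from has_derivative_compose[OF mderiv_has_derivative[OF f p] this]
  have "(chart_rep ?c ?e (\<lambda>p. g (f p)) has_derivative (\<lambda>h. mderiv B C g (f p) (mderiv A B f p h))) (at (snd ?c p))"
  proof (rule has_derivative_open_cong[THEN iffD1, rotated -1])
    show "open (snd ?c ` (fst ?c \<inter> f -` fst ?d))" using smooth_on_open[OF smooth_map_rep[OF f c(1) d(1)]] .
    show "snd ?c p \<in> snd ?c ` (fst ?c \<inter> f -` fst ?d)" using c d by auto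
    fix y assume "y \<in> snd ?c ` (fst ?c \<inter> f -` fst ?d)"
    then have "f (chart_inv ?c y) \<in> fst ?d" using chart_image_iff[OF iA c(1), of y] by auto
    then show "chart_rep ?d ?e g (chart_rep ?c ?d f y) = chart_rep ?c ?e (\<lambda>p. g (f p)) y"
      using chart_inv_left[OF iB d(1)] by simp
  qed
  from frechet_derivative_at[OF this] show ?thesis by (simp add: mderiv_def) metis
qed

lemma mderiv_ident:
  assumes A: "banach_atlas A" and p: "p \<in> points A"
  shows "mderiv A A (\<lambda>p. p) p v = v"
proof -
  have "mderiv A A (\<lambda>p. p) p = chart_change (chart_at A p) (chart_at A p) p"
    by (simp add: mderiv_def chart_change_def o_def)
  then show ?thesis using chart_change_same[OF A chart_at[OF p]] by simp
qed

lemma submersion_chart_rep: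
  assumes A: "banach_atlas A" and B: "banach_atlas B" and f: "smooth_map A B f"
    and sj: "\<And>p. p \<in> points A \<Longrightarrow> surj (mderiv A B f p)" and c: "c \<in> A" and d: "d \<in> B"
  shows "submersion_on (snd c ` (fst c \<inter> f -` fst d)) (chart_rep c d f)"
  unfolding submersion_on_def
proof (intro conjI ballI)
  show "smooth_on (snd c ` (fst c \<inter> f -` fst d)) (chart_rep c d f)" by (rule smooth_map_rep[OF f c d])
  fix x assume "x \<in> snd c ` (fst c \<inter> f -` fst d)"
  then obtain p where p: "p \<in> fst c" "f p \<in> fst d" "x = snd c p" by auto
  have pA: "p \<in> points A" using in_points[OF c p(1)] .
  note fp = smooth_map_points[OF f pA]
  have eq: "frechet_derivative (chart_rep c d f) (at x) =
    chart_change (chart_at B (f p)) d (f p) \<circ> (mderiv A B f p \<circ> chart_change c (chart_at A p) p)"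
    using frechet_derivative_at[OF chart_rep_has_derivative[OF A B f c p(1) d p(2)]] p(3) by (simp add: o_def)
  show "surj (frechet_derivative (chart_rep c d f) (at x))"
    unfolding eq
    by (intro comp_surj sj[OF pA] chart_change_surj[OF A c p(1) chart_at[OF pA]]
        chart_change_surj[OF B chart_at[OF fp] d p(2)])
qed

text \<open>Each point of \<open>Q\<close> is reached by a chart representative of \<pi> that is a
  submersion; its image is an open neighbourhood on which \<open>smooth_on_descend\<close>
  applies.\<close>

lemma smooth_map_descend:
  assumes A: "banach_atlas A" and Q: "banach_atlas Q" and \<pi>: "smooth_map A Q \<pi>"
    and sj: "\<And>p. p \<in> points A \<Longrightarrow> surj (mderiv A Q \<pi> p)" and onto: "\<pi> ` points A = points Q"
    and f\<pi>: "smooth_map A C (\<lambda>p. f (\<pi> p))"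
  shows "smooth_map Q C f"
  unfolding smooth_map_def
proof (intro conjI ballI)
  note iA = banach_atlas_inj_charts[OF A] and iQ = banach_atlas_inj_charts[OF Q]
  show "f ` points Q \<subseteq> points C" using f\<pi> onto by (auto simp: smooth_map_def simp flip: onto)
  fix c e assume c: "c \<in> Q" and e: "e \<in> C"
  show "smooth_on (snd c ` (fst c \<inter> f -` fst e)) (chart_rep c e f)"
  proof (rule smooth_on_localI)
    fix x assume "x \<in> snd c ` (fst c \<inter> f -` fst e)"
    then obtain q where q: "q \<in> fst c" "f q \<in> fst e" "x = snd c q" by auto
    then obtain a where a: "a \<in> points A" "q = \<pi> a" using onto in_points[OF c] by blast
    then obtain d where d: "d \<in> A" "a \<in> fst d" by (auto simp: points_def)
    let ?U = "snd d ` (fst d \<inter> \<pi> -` fst c) \<inter> snd d ` (fst d \<inter> (\<lambda>p. f (\<pi> p)) -` fst e)"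
    let ?P = "chart_rep d c \<pi>"
    have sub: "submersion_on (snd d ` (fst d \<inter> \<pi> -` fst c)) ?P"
      by (rule submersion_chart_rep[OF A Q \<pi> _ d(1) c]) (rule sj)
    note sm = smooth_map_rep[OF f\<pi> d(1) e]
    have "smooth_on (snd d ` (fst d \<inter> \<pi> -` fst c)) ?P" using sub by (simp add: submersion_on_def)
    then have oU: "open ?U" by (intro open_Int smooth_on_open[OF sm] smooth_on_open)
    have sub': "submersion_on ?U ?P" by (rule submersion_on_subset[OF sub oU]) auto
    have inU: "\<pi> (chart_inv d y) \<in> fst c" "f (\<pi> (chart_inv d y)) \<in> fst e" if "y \<in> ?U" for y
      using that chart_image_iff[OF iA d(1), of y "\<pi> -` fst c"]
        chart_image_iff[OF iA d(1), of y "(\<lambda>p. f (\<pi> p)) -` fst e"] by simp_all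
    have "smooth_on ?U (chart_rep d e (\<lambda>p. f (\<pi> p)))" by (rule smooth_on_subset[OF sm oU]) auto
    then have "smooth_on ?U (\<lambda>y. chart_rep c e f (?P y))"
      by (rule smooth_on_cong[THEN iffD1, rotated]) (use inU chart_inv_left[OF iQ c] in auto)
    from smooth_on_descend[OF sub' this]
    have s3: "smooth_on (?P ` ?U) (chart_rep c e f)" .
    have s1: "x \<in> ?P ` ?U"
      by (rule image_eqI[of _ _ "snd d a"]) (use q a d in \<open>auto simp: chart_inv_left[OF iA d(1)]\<close>)
    have s2: "?P ` ?U \<subseteq> snd c ` (fst c \<inter> f -` fst e)"
    proof
      fix z assume "z \<in> ?P ` ?U"
      then obtain y where y: "y \<in> ?U" "z = ?P y" by blast
      show "z \<in> snd c ` (fst c \<inter> f -` fst e)"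
        by (rule image_eqI[of _ _ "\<pi> (chart_inv d y)"]) (use inU[OF y(1)] y(2) in auto)
    qed
    show "\<exists>T. x \<in> T \<and> T \<subseteq> snd c ` (fst c \<inter> f -` fst e) \<and> smooth_on T (chart_rep c e f)"
      by (intro exI[of _ "?P ` ?U"] conjI s1 s2 s3)
  qed
qed

section \<open>Product manifolds and partial maps\<close>

lemma points_prod_atlas: "points (prod_atlas A B) = points A \<times> points B"
  by (force simp: points_def prod_atlas_def)

lemma inj_charts_prod: "inj_charts A \<Longrightarrow> inj_charts B \<Longrightarrow> inj_charts (prod_atlas A B)"
  by (auto simp: inj_charts_def prod_atlas_def inj_on_def)

lemma smooth_map_prod_rep:
  assumes iA: "inj_charts A" and iB: "inj_charts B" and f: "smooth_map (prod_atlas A B) C f"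
    and c: "c \<in> A" and d: "d \<in> B" and e: "e \<in> C"
  shows "smooth_on {(x, y). x \<in> snd c ` fst c \<and> y \<in> snd d ` fst d \<and> f (chart_inv c x, chart_inv d y) \<in> fst e}
    (\<lambda>(x, y). snd e (f (chart_inv c x, chart_inv d y)))" (is "smooth_on ?S ?g")
proof -
  let ?cd = "(fst c \<times> fst d, map_prod (snd c) (snd d))"
  have cd: "?cd \<in> prod_atlas A B" using c d unfolding prod_atlas_def by blast
  note i = inj_charts_prod[OF iA iB]
  have inv: "chart_inv ?cd (x, y) = (chart_inv c x, chart_inv d y)"
    if x: "x \<in> snd c ` fst c" and y: "y \<in> snd d ` fst d" for x y
    using chart_inv_left[OF i cd, of "(chart_inv c x, chart_inv d y)"]
      chart_inv_in[OF x] chart_inv_in[OF y] chart_inv_right[OF x] chart_inv_right[OF y] by simp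
  have eq: "snd ?cd ` (fst ?cd \<inter> f -` fst e) = ?S"
  proof (rule Set.set_eqI)
    fix z
    have im: "z \<in> snd ?cd ` fst ?cd \<longleftrightarrow> fst z \<in> snd c ` fst c \<and> snd z \<in> snd d ` fst d"
      by (cases z) (auto simp: map_prod_surj_on)
    show "z \<in> snd ?cd ` (fst ?cd \<inter> f -` fst e) \<longleftrightarrow> z \<in> ?S"
      unfolding chart_image_iff[OF i cd] im using inv[of "fst z" "snd z"] by auto
  qed
  have "smooth_on ?S (chart_rep ?cd e f)" using smooth_map_rep[OF f cd e] unfolding eq .
  then show ?thesis by (rule smooth_on_cong[THEN iffD1, rotated]) (auto simp: inv)
qed

lemma smooth_map_slice:
  assumes iA: "inj_charts A" and iB: "inj_charts B" and f: "smooth_map (prod_atlas A B) C f"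
  shows smooth_map_slice_right: "a \<in> points A \<Longrightarrow> smooth_map B C (\<lambda>b. f (a, b))"
    and smooth_map_slice_left: "b \<in> points B \<Longrightarrow> smooth_map A C (\<lambda>a. f (a, b))"
proof -
  note fp = smooth_map_points[OF f, unfolded points_prod_atlas]
  assume a: "a \<in> points A"
  show "smooth_map B C (\<lambda>b. f (a, b))"
    unfolding smooth_map_def
  proof (intro conjI ballI)
    show "(\<lambda>b. f (a, b)) ` points B \<subseteq> points C" using fp a by auto
    fix d e assume d: "d \<in> B" and e: "e \<in> C"
    obtain c where c: "c \<in> A" "a \<in> fst c" using a by (auto simp: points_def)
    note sm = smooth_map_prod_rep[OF iA iB f c(1) d e]
    let ?S = "{(x, y). x \<in> snd c ` fst c \<and> y \<in> snd d ` fst d \<and> f (chart_inv c x, chart_inv d y) \<in> fst e}"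
    have l: "smooth_on UNIV (\<lambda>y. (snd c a, y))" by (intro smooth_on_Pair smooth_on_const smooth_on_id) auto
    have T: "(UNIV \<inter> (\<lambda>y. (snd c a, y)) -` ?S) = snd d ` (fst d \<inter> (\<lambda>b. f (a, b)) -` fst e)" (is "?T = ?R")
    proof (rule Set.set_eqI)
      fix y show "y \<in> ?T \<longleftrightarrow> y \<in> ?R"
        unfolding chart_image_iff[OF iB d] using c chart_inv_left[OF iA c] by auto
    qed
    have oR: "open ?R" using smooth_on_vimage_open[OF l smooth_on_open[OF sm]] unfolding T .
    have sub: "(\<lambda>y. (snd c a, y)) ` ?R \<subseteq> ?S" unfolding T[symmetric] by auto
    have "smooth_on ?R (\<lambda>y. (\<lambda>(x, y). snd e (f (chart_inv c x, chart_inv d y))) (snd c a, y))"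
      by (rule smooth_on_compose[OF sm smooth_on_subset[OF l oR subset_UNIV] sub])
    then show "smooth_on ?R (chart_rep d e (\<lambda>b. f (a, b)))"
      by (rule smooth_on_cong[THEN iffD1, rotated]) (simp add: chart_inv_left[OF iA c])
  qed
next
  note fp = smooth_map_points[OF f, unfolded points_prod_atlas]
  assume b: "b \<in> points B"
  show "smooth_map A C (\<lambda>a. f (a, b))"
    unfolding smooth_map_def
  proof (intro conjI ballI)
    show "(\<lambda>a. f (a, b)) ` points A \<subseteq> points C" using fp b by auto
    fix c e assume c: "c \<in> A" and e: "e \<in> C"
    obtain d where d: "d \<in> B" "b \<in> fst d" using b by (auto simp: points_def)
    note sm = smooth_map_prod_rep[OF iA iB f c d(1) e]
    let ?S = "{(x, y). x \<in> snd c ` fst c \<and> y \<in> snd d ` fst d \<and> f (chart_inv c x, chart_inv d y) \<in> fst e}"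
    have l: "smooth_on UNIV (\<lambda>x. (x, snd d b))" by (intro smooth_on_Pair smooth_on_const smooth_on_id) auto
    have T: "(UNIV \<inter> (\<lambda>x. (x, snd d b)) -` ?S) = snd c ` (fst c \<inter> (\<lambda>a. f (a, b)) -` fst e)" (is "?T = ?R")
    proof (rule Set.set_eqI)
      fix y show "y \<in> ?T \<longleftrightarrow> y \<in> ?R"
        unfolding chart_image_iff[OF iA c] using d chart_inv_left[OF iB d] by auto
    qed
    have oR: "open ?R" using smooth_on_vimage_open[OF l smooth_on_open[OF sm]] unfolding T .
    have sub: "(\<lambda>x. (x, snd d b)) ` ?R \<subseteq> ?S" unfolding T[symmetric] by auto
    have "smooth_on ?R (\<lambda>x. (\<lambda>(x, y). snd e (f (chart_inv c x, chart_inv d y))) (x, snd d b))"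
      by (rule smooth_on_compose[OF sm smooth_on_subset[OF l oR subset_UNIV] sub])
    then show "smooth_on ?R (chart_rep c e (\<lambda>a. f (a, b)))"
      by (rule smooth_on_cong[THEN iffD1, rotated]) (simp add: chart_inv_left[OF iB d])
  qed
qed

section \<open>Homogeneous spaces\<close>

abbreviation prod_rep :: "('p, 'e) chart \<Rightarrow> ('q, 'f) chart \<Rightarrow> ('r, 'h) chart \<Rightarrow> ('p \<times> 'q \<Rightarrow> 'r) \<Rightarrow> 'e \<times> 'f \<Rightarrow> 'h" where
  "prod_rep c d e f \<equiv> \<lambda>(x, y). snd e (f (chart_inv c x, chart_inv d y))"

abbreviation prod_dom :: "('p, 'e) chart \<Rightarrow> ('q, 'f) chart \<Rightarrow> ('r, 'h) chart \<Rightarrow> ('p \<times> 'q \<Rightarrow> 'r) \<Rightarrow> ('e \<times> 'f) set" where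
  "prod_dom c d e f \<equiv> {(x, y). x \<in> snd c ` fst c \<and> y \<in> snd d ` fst d \<and> f (chart_inv c x, chart_inv d y) \<in> fst e}"

text \<open>A field obtained from a separate \<open>mderiv\<close> at every point is hereby a
  partial derivative of one jointly smooth map, and so depends smoothly on the point.\<close>

lemma prod_rep_has_derivative_slice:
  assumes iA: "inj_charts A" and iB: "inj_charts B" and f: "smooth_map (prod_atlas A B) C f"
    and c: "c \<in> A" "a \<in> fst c" and d: "d \<in> B" "b \<in> fst d" and e: "e \<in> C" "f (a, b) \<in> fst e"
  shows "(chart_rep d e (\<lambda>b. f (a, b)) has_derivative
      (\<lambda>v. frechet_derivative (prod_rep c d e f) (at (snd c a, snd d b)) (0, v))) (at (snd d b))"
    and "(chart_rep c e (\<lambda>a. f (a, b)) has_derivative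
      (\<lambda>v. frechet_derivative (prod_rep c d e f) (at (snd c a, snd d b)) (v, 0))) (at (snd c a))"
proof -
  have "(snd c a, snd d b) \<in> prod_dom c d e f"
    using c d e chart_inv_left[OF iA c] chart_inv_left[OF iB d] by simp
  from smooth_on_has_derivative[OF smooth_map_prod_rep[OF iA iB f c(1) d(1) e(1)] this]
  have D: "(prod_rep c d e f has_derivative frechet_derivative (prod_rep c d e f) (at (snd c a, snd d b))) (at (snd c a, snd d b))" .
  have "((\<lambda>y. (snd c a, y)) has_derivative (\<lambda>v. (0, v))) (at (snd d b))"
    by (auto intro!: derivative_eq_intros)
  from has_derivative_compose[OF this D] chart_inv_left[OF iA c]
  show "(chart_rep d e (\<lambda>b. f (a, b)) has_derivative
      (\<lambda>v. frechet_derivative (prod_rep c d e f) (at (snd c a, snd d b)) (0, v))) (at (snd d b))"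
    by (simp add: o_def)
  have "((\<lambda>x. (x, snd d b)) has_derivative (\<lambda>v. (v, 0))) (at (snd c a))"
    by (auto intro!: derivative_eq_intros)
  from has_derivative_compose[OF this D] chart_inv_left[OF iB d]
  show "(chart_rep c e (\<lambda>a. f (a, b)) has_derivative
      (\<lambda>v. frechet_derivative (prod_rep c d e f) (at (snd c a, snd d b)) (v, 0))) (at (snd c a))"
    by (simp add: o_def)
qed

locale homogeneous_quotient =
  fixes G :: "('a, 's) monoid_scheme" and A :: "('a, 'g::banach) chart set" and K :: "'a set"
    and Q :: "('a set, 'm::banach) chart set"
  assumes lie_group: "banach_lie_group G A" and subgroup_K: "subgroup K G"
    and homogeneous: "homogeneous_space G A K Q"
begin

abbreviation mul (infixl \<open>\<cdot>\<close> 70) where "g \<cdot> h \<equiv> g \<otimes>\<^bsub>G\<^esub> h"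
abbreviation unit (\<open>\<e>\<close>) where "\<e> \<equiv> \<one>\<^bsub>G\<^esub>"
abbreviation proj (\<open>\<pi>\<close>) where "\<pi> \<equiv> coset_proj G K"
abbreviation act (infixr \<open>\<triangleright>\<close> 75) where "g \<triangleright> q \<equiv> g <#\<^bsub>G\<^esub> q"

lemma group_G: "group G" and atlas_A: "banach_atlas A" and points_A: "points A = carrier G"
  and smooth_mult: "smooth_map (prod_atlas A A) A (\<lambda>(g, h). g \<cdot> h)"
  using lie_group by (auto simp: banach_lie_group_def banach_manifold_def)

lemma atlas_Q: "banach_atlas Q" and points_Q: "points Q = \<pi> ` carrier G" and smooth_proj: "smooth_map A Q \<pi>"
  and surj_proj: "g \<in> carrier G \<Longrightarrow> surj (mderiv A Q \<pi> g)"
  using homogeneous by (auto simp: homogeneous_space_def banach_manifold_def)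

lemmas inj_A = banach_atlas_inj_charts[OF atlas_A] and inj_Q = banach_atlas_inj_charts[OF atlas_Q]

lemma closed [simp]: "g \<in> carrier G \<Longrightarrow> h \<in> carrier G \<Longrightarrow> g \<cdot> h \<in> carrier G" "\<e> \<in> carrier G"
  "g \<in> carrier G \<Longrightarrow> inv\<^bsub>G\<^esub> g \<in> carrier G"
  using group_G by (auto simp: group.is_monoid monoid.m_closed)

lemma K_carrier: "k \<in> K \<Longrightarrow> k \<in> carrier G"
  using subgroup_K subgroup.mem_carrier by metis

lemma act_proj: "g \<in> carrier G \<Longrightarrow> h \<in> carrier G \<Longrightarrow> g \<triangleright> \<pi> h = \<pi> (g \<cdot> h)"
  unfolding coset_proj_def using group.lcos_m_assoc[OF group_G] subgroup.subset[OF subgroup_K] by metis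

lemma proj_mult_K: "g \<in> carrier G \<Longrightarrow> k \<in> K \<Longrightarrow> \<pi> (g \<cdot> k) = \<pi> g"
proof -
  assume "g \<in> carrier G" "k \<in> K"
  moreover from this have "\<pi> k = K"
    unfolding coset_proj_def using group.coset_join3[OF group_G K_carrier subgroup_K] by blast
  ultimately show ?thesis using act_proj[of g k] K_carrier by (simp add: coset_proj_def)
qed

lemma proj_eqE:
  assumes "g \<in> carrier G" "h \<in> carrier G" "\<pi> g = \<pi> h"
  obtains k where "k \<in> K" "g = h \<cdot> k"
proof -
  have "\<e> \<in> K" using subgroup_K by (rule subgroup.one_closed)
  then have "g \<in> \<pi> g" using monoid.r_one[OF group.is_monoid[OF group_G] assms(1)]
    unfolding coset_proj_def l_coset_def by (auto intro!: bexI[of _ "\<e>"])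
  then show ?thesis using that assms(3) unfolding coset_proj_def l_coset_def by auto
qed

lemma proj_points: "g \<in> carrier G \<Longrightarrow> \<pi> g \<in> points Q"
  by (simp add: points_Q)

lemma smooth_left: "g \<in> carrier G \<Longrightarrow> smooth_map A A (\<lambda>h. g \<cdot> h)"
  using smooth_map_slice_right[OF inj_A inj_A smooth_mult] points_A by simp

lemma smooth_right: "g \<in> carrier G \<Longrightarrow> smooth_map A A (\<lambda>h. h \<cdot> g)"
  using smooth_map_slice_left[OF inj_A inj_A smooth_mult] points_A by simp

lemma smooth_conj: "g \<in> carrier G \<Longrightarrow> smooth_map A A (\<lambda>h. g \<cdot> h \<cdot> inv\<^bsub>G\<^esub> g)"
  using smooth_map_compose[OF inj_A atlas_A smooth_left[of g] smooth_right[of "inv\<^bsub>G\<^esub> g"]] by simp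

lemma smooth_proj_left: "g \<in> carrier G \<Longrightarrow> smooth_map A Q (\<lambda>h. \<pi> (g \<cdot> h))"
  by (rule smooth_map_compose[OF inj_A atlas_A smooth_left smooth_proj])

lemma smooth_proj_mult: "smooth_map (prod_atlas A A) Q (\<lambda>(g, h). \<pi> (g \<cdot> h))"
  using smooth_map_compose[OF inj_charts_prod[OF inj_A inj_A] atlas_A smooth_mult smooth_proj]
  by (simp add: case_prod_unfold)

lemma smooth_orbit:
  assumes "g \<in> carrier G"
  shows "smooth_map A Q (\<lambda>h. h \<triangleright> \<pi> g)"
proof -
  have "smooth_map A Q (\<lambda>h. \<pi> (h \<cdot> g))"
    by (rule smooth_map_compose[OF inj_A atlas_A smooth_right[OF assms] smooth_proj])
  then show ?thesis
    by (rule smooth_map_cong[OF inj_A, THEN iffD1, rotated]) (simp add: act_proj assms points_A)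
qed

text \<open>Composed with \<pi>, the action of \<open>g\<close> is \<pi> after a left translation,
  which is smooth; descent does the rest.\<close>

lemma smooth_act:
  assumes g: "g \<in> carrier G"
  shows "smooth_map Q Q (\<lambda>q. g \<triangleright> q)"
proof (rule smooth_map_descend[OF atlas_A atlas_Q smooth_proj])
  show "surj (mderiv A Q \<pi> p)" if "p \<in> points A" for p using surj_proj that points_A by simp
  show "\<pi> ` points A = points Q" by (simp add: points_A points_Q)
  show "smooth_map A Q (\<lambda>p. g \<triangleright> \<pi> p)"
    by (rule smooth_map_cong[OF inj_A, THEN iffD1, OF _ smooth_proj_left[OF g]]) (simp add: act_proj g points_A)
qed

section \<open>The frame of left translates and its behaviour under \<open>K\<close>\<close>

definition \<Theta> :: "'a \<Rightarrow> 'g \<Rightarrow> 'm" where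
  "\<Theta> g = mderiv A Q (\<lambda>h. \<pi> (g \<cdot> h)) \<e>"

definition act_deriv :: "'a \<Rightarrow> 'm \<Rightarrow> 'm" where
  "act_deriv g = mderiv Q Q (\<lambda>q. g \<triangleright> q) (\<pi> \<e>)"

lemma one_points: "\<e> \<in> points A" by (simp add: points_A)

lemma mult_one [simp]: "g \<in> carrier G \<Longrightarrow> g \<cdot> \<e> = g" "g \<in> carrier G \<Longrightarrow> \<e> \<cdot> g = g"
  using group_G by (auto simp: group.is_monoid monoid.r_one monoid.l_one)

lemma \<Theta>_one: "\<Theta> \<e> v = mderiv A Q \<pi> \<e> v"
  unfolding \<Theta>_def by (rule fun_cong[OF mderiv_cong[OF atlas_A _ one_points]]) (simp add: points_A)

lemma \<Theta>_linear: "g \<in> carrier G \<Longrightarrow> bounded_linear (\<Theta> g)"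
  unfolding \<Theta>_def by (rule mderiv_bounded_linear[OF smooth_proj_left one_points])

lemma act_deriv_linear: "g \<in> carrier G \<Longrightarrow> bounded_linear (act_deriv g)"
  unfolding act_deriv_def by (rule mderiv_bounded_linear[OF smooth_act proj_points]) auto

lemma \<Theta>_act_deriv:
  assumes g: "g \<in> carrier G"
  shows "\<Theta> g v = act_deriv g (\<Theta> \<e> v)"
proof -
  have "\<Theta> g v = mderiv A Q (\<lambda>h. g \<triangleright> \<pi> h) \<e> v"
    unfolding \<Theta>_def
    by (rule fun_cong[OF mderiv_cong[OF atlas_A _ one_points]]) (simp add: act_proj g points_A)
  also have "\<dots> = act_deriv g (mderiv A Q \<pi> \<e> v)"
    unfolding act_deriv_def by (rule mderiv_compose[OF atlas_A atlas_Q smooth_proj smooth_act[OF g] one_points])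
  finally show ?thesis by (simp add: \<Theta>_one)
qed

lemma act_inv:
  assumes "g \<in> carrier G" "q \<in> points Q"
  shows "inv\<^bsub>G\<^esub> g \<triangleright> g \<triangleright> q = q" "g \<triangleright> inv\<^bsub>G\<^esub> g \<triangleright> q = q"
proof -
  obtain h where h: "h \<in> carrier G" "q = \<pi> h" using assms(2) points_Q by auto
  have "inv\<^bsub>G\<^esub> g \<cdot> (g \<cdot> h) = h" "g \<cdot> (inv\<^bsub>G\<^esub> g \<cdot> h) = h"
    using group.inv_solve_left' group_G assms(1) h(1) group.is_monoid[OF group_G]
    by (simp_all add: monoid.m_assoc[symmetric] group.l_inv group.r_inv)
  then show "inv\<^bsub>G\<^esub> g \<triangleright> g \<triangleright> q = q" "g \<triangleright> inv\<^bsub>G\<^esub> g \<triangleright> q = q"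
    by (simp_all add: h act_proj assms(1))
qed

lemma act_deriv_bij:
  assumes g: "g \<in> carrier G"
  shows "bij (act_deriv g)"
proof -
  let ?g' = "inv\<^bsub>G\<^esub> g"
  have g': "?g' \<in> carrier G" using g by simp
  let ?D = "mderiv Q Q (\<lambda>q. ?g' \<triangleright> q) (\<pi> g)"
  have p1: "\<pi> \<e> \<in> points Q" and pg: "\<pi> g \<in> points Q" using proj_points g by auto
  have ga: "g \<triangleright> \<pi> \<e> = \<pi> g" using act_proj[OF g, of "\<e>"] g by simp
  have g'a: "?g' \<triangleright> \<pi> g = \<pi> \<e>" using act_inv(1)[OF g p1] ga by simp
  have "?D (act_deriv g v) = v" for v
  proof -
    have "mderiv Q Q (\<lambda>q. ?g' \<triangleright> g \<triangleright> q) (\<pi> \<e>) v = ?D (act_deriv g v)"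
      using mderiv_compose[OF atlas_Q atlas_Q smooth_act[OF g] smooth_act[OF g'] p1] unfolding ga act_deriv_def .
    moreover have "mderiv Q Q (\<lambda>q. ?g' \<triangleright> g \<triangleright> q) (\<pi> \<e>) = mderiv Q Q (\<lambda>q. q) (\<pi> \<e>)"
      by (rule mderiv_cong[OF atlas_Q _ p1]) (rule act_inv(1)[OF g])
    ultimately show ?thesis using mderiv_ident[OF atlas_Q p1] by metis
  qed
  moreover have "act_deriv g (?D v) = v" for v
  proof -
    have "mderiv Q Q (\<lambda>q. g \<triangleright> ?g' \<triangleright> q) (\<pi> g) v = act_deriv g (?D v)"
      using mderiv_compose[OF atlas_Q atlas_Q smooth_act[OF g'] smooth_act[OF g] pg] unfolding g'a act_deriv_def .
    moreover have "mderiv Q Q (\<lambda>q. g \<triangleright> ?g' \<triangleright> q) (\<pi> g) = mderiv Q Q (\<lambda>q. q) (\<pi> g)"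
      by (rule mderiv_cong[OF atlas_Q _ pg]) (rule act_inv(2)[OF g])
    ultimately show ?thesis using mderiv_ident[OF atlas_Q pg] by metis
  qed
  ultimately show ?thesis by (metis bijI' )
qed

lemma \<Theta>_surj:
  assumes g: "g \<in> carrier G"
  shows "surj (\<Theta> g)"
proof -
  have "\<Theta> g = act_deriv g \<circ> mderiv A Q \<pi> \<e>" using \<Theta>_act_deriv[OF g] \<Theta>_one by (auto simp: fun_eq_iff)
  then show ?thesis using comp_surj[OF surj_proj bij_is_surj[OF act_deriv_bij[OF g]]] by simp
qed

lemma \<Theta>_eq_0_iff: "g \<in> carrier G \<Longrightarrow> \<Theta> g v = 0 \<longleftrightarrow> \<Theta> \<e> v = 0"
  using \<Theta>_act_deriv[of g v] bij_is_inj[OF act_deriv_bij[of g]]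
    linear_0[OF bounded_linear.linear[OF act_deriv_linear[of g]]]
  by (metis injD)

text \<open>Inserting the inverse of \<open>k\<close> on the right does not change a coset, so
  \<open>g \<cdot> k \<cdot> h\<close> may be replaced by \<open>g\<close> times the conjugate of
  \<open>h\<close> by \<open>k\<close>. Thus changing the representative of a coset twists the frame
  by \<open>Ad\<close>.\<close>

lemma \<Theta>_mult_K:
  assumes g: "g \<in> carrier G" and k: "k \<in> K"
  shows "\<Theta> (g \<cdot> k) v = \<Theta> g (Ad G A k v)"
proof -
  have kc: "k \<in> carrier G" using k by (rule K_carrier)
  have ki: "inv\<^bsub>G\<^esub> k \<in> K" using subgroup.m_inv_closed[OF subgroup_K k] .
  have e: "k \<cdot> \<e> \<cdot> inv\<^bsub>G\<^esub> k = \<e>" using kc group.r_inv[OF group_G] by simp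
  have "\<pi> (g \<cdot> k \<cdot> h) = \<pi> (g \<cdot> (k \<cdot> h \<cdot> inv\<^bsub>G\<^esub> k))" if h: "h \<in> carrier G" for h
  proof -
    have "g \<cdot> (k \<cdot> h \<cdot> inv\<^bsub>G\<^esub> k) = g \<cdot> k \<cdot> h \<cdot> inv\<^bsub>G\<^esub> k"
      using g kc h group.is_monoid[OF group_G] by (simp add: monoid.m_assoc)
    then show ?thesis using proj_mult_K[of "g \<cdot> k \<cdot> h" "inv\<^bsub>G\<^esub> k"] g kc h ki by simp
  qed
  then have "\<Theta> (g \<cdot> k) v = mderiv A Q (\<lambda>h. \<pi> (g \<cdot> (k \<cdot> h \<cdot> inv\<^bsub>G\<^esub> k))) \<e> v"
    unfolding \<Theta>_def by (intro fun_cong[OF mderiv_cong[OF atlas_A _ one_points]]) (simp add: points_A)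
  also have "\<dots> = \<Theta> g (Ad G A k v)"
    using mderiv_compose[OF atlas_A atlas_A smooth_conj[OF kc] smooth_proj_left[OF g] one_points]
    unfolding \<Theta>_def Ad_def e .
  finally show ?thesis .
qed

text \<open>The infinitesimal generator of the action of \<open>G\<close> on cosets; at the coset of
  \<open>g\<close> it is the image under \<pi> of the right-invariant field with value
  \<open>v\<close> at the unit. Only cosets enter, so it is a genuine field on
  \<open>Q\<close>.\<close>

definition fundamental_field :: "'g \<Rightarrow> 'a set \<Rightarrow> 'm" where
  "fundamental_field v q = mderiv A Q (\<lambda>h. h \<triangleright> q) \<e> v"

lemma fundamental_field_base: "fundamental_field v (\<pi> \<e>) = \<Theta> \<e> v"
  unfolding fundamental_field_def \<Theta>_def
  by (rule fun_cong[OF mderiv_cong[OF atlas_A _ one_points]]) (simp add: points_A act_proj)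

text \<open>Frame and fundamental field are the two partial derivatives of (g, h) \<mapsto>
  \<open>\<pi> (g \<cdot> h)\<close>, taken at the unit in the second and in the first factor
  respectively.\<close>

lemma chart_frame:
  assumes c: "c \<in> Q" and d: "d \<in> A" "g \<in> fst d" and q: "\<pi> g \<in> fst c"
  shows "frechet_derivative (prod_rep d (chart_at A \<e>) c (\<lambda>(g, h). \<pi> (g \<cdot> h))) (at (snd d g, snd (chart_at A \<e>) \<e>)) (0, v)
    = chart_change (chart_at Q (\<pi> g)) c (\<pi> g) (\<Theta> g v)"
    and "frechet_derivative (prod_rep (chart_at A \<e>) d c (\<lambda>(g, h). \<pi> (g \<cdot> h))) (at (snd (chart_at A \<e>) \<e>, snd d g)) (v, 0)
    = chart_change (chart_at Q (\<pi> g)) c (\<pi> g) (fundamental_field v (\<pi> g))"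
proof -
  let ?e = "chart_at A \<e>"
  note e = chart_at[OF one_points]
  have g: "g \<in> carrier G" using in_points[OF d] points_A by simp
  let ?f = "\<lambda>(g, h). \<pi> (g \<cdot> h)"
  have D1: "(chart_rep ?e c (\<lambda>h. \<pi> (g \<cdot> h)) has_derivative
      (\<lambda>v. frechet_derivative (prod_rep d ?e c ?f) (at (snd d g, snd ?e \<e>)) (0, v))) (at (snd ?e \<e>))"
    using prod_rep_has_derivative_slice(1)[OF inj_A inj_A smooth_proj_mult d e c] q g by simp
  have D2: "(chart_rep ?e c (\<lambda>h. \<pi> (g \<cdot> h)) has_derivative
      (\<lambda>v. chart_change (chart_at Q (\<pi> g)) c (\<pi> g) (\<Theta> g (chart_change ?e ?e \<e> v)))) (at (snd ?e \<e>))"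
    using chart_rep_has_derivative[OF atlas_A atlas_Q smooth_proj_left[OF g] e c] q g by (simp add: \<Theta>_def)
  from has_derivative_unique[OF D1 D2]
  show "frechet_derivative (prod_rep d ?e c ?f) (at (snd d g, snd ?e \<e>)) (0, v)
    = chart_change (chart_at Q (\<pi> g)) c (\<pi> g) (\<Theta> g v)"
    using chart_change_same[OF atlas_A e] by metis
  have D3: "(chart_rep ?e c (\<lambda>h. \<pi> (h \<cdot> g)) has_derivative
      (\<lambda>v. frechet_derivative (prod_rep ?e d c ?f) (at (snd ?e \<e>, snd d g)) (v, 0))) (at (snd ?e \<e>))"
    using prod_rep_has_derivative_slice(2)[OF inj_A inj_A smooth_proj_mult e d c] q g by simp
  have eg: "\<e> \<triangleright> \<pi> g = \<pi> g" using g by (simp add: act_proj)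
  have D4: "(chart_rep ?e c (\<lambda>h. h \<triangleright> \<pi> g) has_derivative
      (\<lambda>v. chart_change (chart_at Q (\<pi> g)) c (\<pi> g) (fundamental_field v (\<pi> g)))) (at (snd ?e \<e>))"
    using chart_rep_has_derivative[OF atlas_A atlas_Q smooth_orbit[OF g] e c] q
    by (simp add: eg fundamental_field_def chart_change_same[OF atlas_A e])
  have "(chart_rep ?e c (\<lambda>h. \<pi> (h \<cdot> g)) has_derivative
      (\<lambda>v. chart_change (chart_at Q (\<pi> g)) c (\<pi> g) (fundamental_field v (\<pi> g)))) (at (snd ?e \<e>))"
  proof (rule has_derivative_open_cong[OF open_chart_image[OF atlas_A e(1)], THEN iffD1, OF _ _ D4])
    show "snd ?e \<e> \<in> snd ?e ` fst ?e" using e(2) by blast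
    fix y assume "y \<in> snd ?e ` fst ?e"
    then have "chart_inv ?e y \<in> carrier G" using in_points[OF e(1) chart_inv_in] points_A by simp
    then show "chart_rep ?e c (\<lambda>h. h \<triangleright> \<pi> g) y = chart_rep ?e c (\<lambda>h. \<pi> (h \<cdot> g)) y"
      using act_proj g by simp
  qed
  from has_derivative_unique[OF D3 this]
  show "frechet_derivative (prod_rep ?e d c ?f) (at (snd ?e \<e>, snd d g)) (v, 0)
    = chart_change (chart_at Q (\<pi> g)) c (\<pi> g) (fundamental_field v (\<pi> g))" by metis
qed

lemma chart_submersion:
  assumes c: "c \<in> Q" and x: "x \<in> snd c ` fst c"
  obtains d U where "d \<in> A" "submersion_on U (chart_rep d c \<pi>)" "x \<in> chart_rep d c \<pi> ` U"
    "chart_rep d c \<pi> ` U \<subseteq> snd c ` fst c"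
    "\<And>y. y \<in> U \<Longrightarrow> y \<in> snd d ` fst d \<and> chart_inv d y \<in> fst d \<and> \<pi> (chart_inv d y) \<in> fst c"
proof -
  obtain q where q: "q \<in> fst c" "x = snd c q" using x by auto
  then obtain g where g: "g \<in> carrier G" "q = \<pi> g" using in_points[OF c q(1)] points_Q by auto
  then obtain d where d: "d \<in> A" "g \<in> fst d" using chart_at[of g A] points_A by metis
  let ?U = "snd d ` (fst d \<inter> \<pi> -` fst c)"
  show ?thesis
  proof (rule that[OF d(1)])
    show "submersion_on ?U (chart_rep d c \<pi>)"
      by (rule submersion_chart_rep[OF atlas_A atlas_Q smooth_proj _ d(1) c]) (simp add: surj_proj points_A)
    show "x \<in> chart_rep d c \<pi> ` ?U"
      by (rule image_eqI[of _ _ "snd d g"]) (use q g d chart_inv_left[OF inj_A d] in auto)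
    show 1: "y \<in> snd d ` fst d \<and> chart_inv d y \<in> fst d \<and> \<pi> (chart_inv d y) \<in> fst c" if "y \<in> ?U" for y
      using that chart_image_iff[OF inj_A d(1), of y "\<pi> -` fst c"] chart_inv_in[of y d] by auto
    show "chart_rep d c \<pi> ` ?U \<subseteq> snd c ` fst c"
    proof
      fix z assume "z \<in> chart_rep d c \<pi> ` ?U"
      then obtain y where y: "y \<in> ?U" "z = chart_rep d c \<pi> y" by blast
      then show "z \<in> snd c ` fst c" using 1[OF y(1)] by auto
    qed
  qed
qed

text \<open>Read in a chart of \<open>Q\<close> and pulled back along \<pi>, the field is a partial
  derivative of multiplication followed by \<pi>, hence smooth on a chart of \<open>G\<close>;
  smoothness descends to \<open>Q\<close>.\<close>

lemma fundamental_field_smooth: "smooth_vector_field Q (fundamental_field v)"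
  unfolding smooth_vector_field_def
proof
  fix c assume c: "c \<in> Q"
  let ?e = "chart_at A \<e>" and ?f = "\<lambda>(g, h). \<pi> (g \<cdot> h)"
  note e = chart_at[OF one_points]
  show "smooth_on (snd c ` fst c) (in_chart Q c (fundamental_field v))"
  proof (rule smooth_on_localI)
    fix x assume "x \<in> snd c ` fst c"
    from chart_submersion[OF c this] obtain d U where d: "d \<in> A" and sub: "submersion_on U (chart_rep d c \<pi>)"
      and x: "x \<in> chart_rep d c \<pi> ` U" and im: "chart_rep d c \<pi> ` U \<subseteq> snd c ` fst c"
      and U: "\<And>y. y \<in> U \<Longrightarrow> y \<in> snd d ` fst d \<and> chart_inv d y \<in> fst d \<and> \<pi> (chart_inv d y) \<in> fst c"
      by metis
    have oU: "open U" using sub smooth_on_open unfolding submersion_on_def by blast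
    let ?M = "prod_rep ?e d c ?f"
    have M: "smooth_on (prod_dom ?e d c ?f) ?M"
      by (rule smooth_map_prod_rep[OF inj_A inj_A smooth_proj_mult e(1) d c])
    have dom: "(snd ?e \<e>, y) \<in> prod_dom ?e d c ?f" if y: "y \<in> U" for y
    proof -
      have "chart_inv d y \<in> carrier G" using in_points[OF d] U[OF y] points_A by blast
      then show ?thesis using U[OF y] e(2) chart_inv_left[OF inj_A e] by simp
    qed
    have l: "smooth_on U (\<lambda>y. ((snd ?e \<e>, y), (v, 0)))"
      by (intro smooth_on_Pair smooth_on_const smooth_on_id oU)
    have "smooth_on U (\<lambda>y. (\<lambda>(z, w). frechet_derivative ?M (at z) w) ((snd ?e \<e>, y), (v, 0)))"
      by (rule smooth_on_compose[OF smooth_on_derivative[OF M] l]) (use dom in auto)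
    then have "smooth_on U (\<lambda>y. in_chart Q c (fundamental_field v) (chart_rep d c \<pi> y))"
    proof (rule smooth_on_cong[THEN iffD1, rotated])
      fix y assume y: "y \<in> U"
      let ?g = "chart_inv d y"
      have "snd d ?g = y" "\<pi> ?g \<in> fst c" "?g \<in> fst d" using U[OF y] chart_inv_right[of y d] by auto
      then show "(\<lambda>(z, w). frechet_derivative ?M (at z) w) ((snd ?e \<e>, y), (v, 0)) =
          in_chart Q c (fundamental_field v) (chart_rep d c \<pi> y)"
        using chart_frame(2)[OF c d, of ?g v] chart_inv_left[OF inj_Q c, of "\<pi> ?g"]
        by (simp add: in_chart_def Let_def)
    qed
    from smooth_on_descend[OF sub this]
    show "\<exists>T. x \<in> T \<and> T \<subseteq> snd c ` fst c \<and> smooth_on T (in_chart Q c (fundamental_field v))"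
      using x im by (intro exI[of _ "chart_rep d c \<pi> ` U"] conjI)
  qed
qed

text \<open>Admissibility of \<open>N\<close>, expressed through the kernel of
  \<open>\<Theta> \<e>\<close> instead of the Lie subalgebra of \<open>K\<close>.\<close>

context
  fixes N :: "'g \<Rightarrow> 'g"
  assumes N_linear: "bounded_linear N"
    and N_kernel: "\<And>v. \<Theta> \<e> v = 0 \<Longrightarrow> \<Theta> \<e> (N v) = 0"
    and N_Ad: "\<And>k v. k \<in> K \<Longrightarrow> \<Theta> \<e> (Ad G A k (N v) - N (Ad G A k v)) = 0"
begin

lemma induced_map_base_\<Theta>: "induced_map_base G A K Q N (\<Theta> \<e> v) = \<Theta> \<e> (N v)"
proof -
  let ?w = "SOME w. \<Theta> \<e> w = \<Theta> \<e> v"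
  have w: "\<Theta> \<e> ?w = \<Theta> \<e> v" by (rule someI) (rule refl)
  note l = bounded_linear.linear[OF \<Theta>_linear[OF closed(2)]] and lN = bounded_linear.linear[OF N_linear]
  have "\<Theta> \<e> (N (?w - v)) = 0" by (rule N_kernel) (simp add: linear_diff[OF l] w)
  then have "\<Theta> \<e> (N ?w) = \<Theta> \<e> (N v)" by (simp add: linear_diff[OF l] linear_diff[OF lN])
  then show ?thesis by (simp add: induced_map_base_def \<Theta>_one Let_def)
qed

text \<open>The representative \<open>h\<close> chosen by \<open>induced_map\<close> differs from
  \<open>g\<close> by some \<open>k\<close> in \<open>K\<close>, which twists the frame by
  \<open>Ad\<close>. Admissibility lets \<open>N\<close> pass through \<open>Ad\<close> modulo the
  kernel, so the twist cancels.\<close>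

lemma induced_map_\<Theta>:
  assumes g: "g \<in> carrier G"
  shows "induced_map G A K Q N (\<pi> g) (\<Theta> g v) = \<Theta> g (N v)"
proof -
  define h where "h = (SOME h. h \<in> carrier G \<and> \<pi> h = \<pi> g)"
  have h: "h \<in> carrier G" "\<pi> h = \<pi> g"
    using someI[of "\<lambda>h. h \<in> carrier G \<and> \<pi> h = \<pi> g" g] g by (auto simp: h_def)
  obtain k where k: "k \<in> K" "g = h \<cdot> k" using proj_eqE[OF g h(1) h(2)[symmetric]] by metis
  note l = bounded_linear.linear[OF \<Theta>_linear[OF closed(2)]]
  have eq: "\<Theta> g v = act_deriv h (\<Theta> \<e> (Ad G A k v))" for v
    unfolding k(2) \<Theta>_mult_K[OF h(1) k(1)] by (rule \<Theta>_act_deriv[OF h(1)])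
  have "induced_map G A K Q N (\<pi> g) (\<Theta> g v) = act_deriv h (induced_map_base G A K Q N (inv_into UNIV (act_deriv h) (\<Theta> g v)))"
    by (simp add: induced_map_def Let_def h_def act_deriv_def)
  also have "inv_into UNIV (act_deriv h) (\<Theta> g v) = \<Theta> \<e> (Ad G A k v)"
    unfolding eq by (rule inv_f_f[OF bij_is_inj[OF act_deriv_bij[OF h(1)]]])
  also have "act_deriv h (induced_map_base G A K Q N (\<Theta> \<e> (Ad G A k v))) = act_deriv h (\<Theta> \<e> (N (Ad G A k v)))"
    by (simp add: induced_map_base_\<Theta>)
  also have "\<Theta> \<e> (N (Ad G A k v)) = \<Theta> \<e> (Ad G A k (N v))"
    using N_Ad[OF k(1), of v] by (simp add: linear_diff[OF l])
  finally show ?thesis by (simp add: eq)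
qed

lemma induced_map_linear:
  assumes "q \<in> points Q"
  shows "linear (induced_map G A K Q N q)"
proof -
  obtain g where g: "g \<in> carrier G" "q = \<pi> g" using assms points_Q by auto
  note l = bounded_linear.linear[OF \<Theta>_linear[OF g(1)]] and lN = bounded_linear.linear[OF N_linear]
  obtain s where s: "\<And>u. \<Theta> g (s u) = u" using \<Theta>_surj[OF g(1)] by (metis surjD)
  show ?thesis unfolding g(2)
  proof (rule linearI)
    fix u w c
    show "induced_map G A K Q N (\<pi> g) (u + w) = induced_map G A K Q N (\<pi> g) u + induced_map G A K Q N (\<pi> g) w"
      using induced_map_\<Theta>[OF g(1), of "s u + s w"] induced_map_\<Theta>[OF g(1), of "s u"] induced_map_\<Theta>[OF g(1), of "s w"]
      by (simp add: linear_add[OF l] linear_add[OF lN] s)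
    show "induced_map G A K Q N (\<pi> g) (c *\<^sub>R u) = c *\<^sub>R induced_map G A K Q N (\<pi> g) u"
      using induced_map_\<Theta>[OF g(1), of "c *\<^sub>R s u"] induced_map_\<Theta>[OF g(1), of "s u"]
      by (simp add: linear_scale[OF l] linear_scale[OF lN] s)
  qed
qed

text \<open>The frame in charts gives a submersion \<open>?\<Phi>\<close> from U \<times> \<g> into
  the tangent bundle of \<open>Q\<close>, and \<open>?\<N> \<circ> ?\<Phi>\<close> sends (y, v) to
  \<open>F (y, N v)\<close>, which is smooth because \<open>N\<close> does not depend on the
  point.\<close>

lemma induced_map_smooth: "smooth_bundle_map Q (induced_map G A K Q N)"
  unfolding smooth_bundle_map_def
proof (intro conjI ballI)
  show "linear (induced_map G A K Q N q)" if "q \<in> points Q" for q using induced_map_linear[OF that] .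
  fix c assume c: "c \<in> Q"
  let ?e = "chart_at A \<e>" and ?f = "\<lambda>(g, h). \<pi> (g \<cdot> h)"
  note e = chart_at[OF one_points]
  let ?\<N> = "\<lambda>(x, u). let p = chart_inv c x in
           chart_change (chart_at Q p) c p (induced_map G A K Q N p (chart_change c (chart_at Q p) p u))"
  show "smooth_on ((snd c ` fst c) \<times> UNIV) ?\<N>"
  proof (rule smooth_on_localI)
    fix z :: "'m \<times> 'm" assume z: "z \<in> (snd c ` fst c) \<times> UNIV"
    then have "fst z \<in> snd c ` fst c" by auto
    from chart_submersion[OF c this] obtain d U where d: "d \<in> A" and sub: "submersion_on U (chart_rep d c \<pi>)"
      and x: "fst z \<in> chart_rep d c \<pi> ` U" and im: "chart_rep d c \<pi> ` U \<subseteq> snd c ` fst c"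
      and U: "\<And>y. y \<in> U \<Longrightarrow> y \<in> snd d ` fst d \<and> chart_inv d y \<in> fst d \<and> \<pi> (chart_inv d y) \<in> fst c"
      by metis
    have oU: "open U" using sub smooth_on_open unfolding submersion_on_def by blast
    then have oUV: "open (U \<times> (UNIV :: 'g set))" by (simp add: open_Times)
    let ?M = "prod_rep d ?e c ?f"
    have M: "smooth_on (prod_dom d ?e c ?f) ?M"
      by (rule smooth_map_prod_rep[OF inj_A inj_A smooth_proj_mult d e(1) c])
    have carr: "chart_inv d y \<in> carrier G" if y: "y \<in> U" for y
      using in_points[OF d] U[OF y] points_A by blast
    have dom: "(y, snd ?e \<e>) \<in> prod_dom d ?e c ?f" if y: "y \<in> U" for y
      using carr[OF y] U[OF y] e(2) chart_inv_left[OF inj_A e] by simp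
    define F where "F = (\<lambda>(y, v). frechet_derivative ?M (at (y, snd ?e \<e>)) (0, v))"
    have F: "F (y, v) = chart_change (chart_at Q (\<pi> (chart_inv d y))) c (\<pi> (chart_inv d y)) (\<Theta> (chart_inv d y) v)"
      if y: "y \<in> U" for y v
    proof -
      have "snd d (chart_inv d y) = y" "\<pi> (chart_inv d y) \<in> fst c" "chart_inv d y \<in> fst d"
        using U[OF y] chart_inv_right[of y d] by auto
      then show ?thesis using chart_frame(1)[OF c d, of "chart_inv d y" v] by (simp add: F_def)
    qed
    have l: "smooth_on (U \<times> (UNIV :: 'g set)) (\<lambda>z. ((fst z, snd ?e \<e>), (0 :: 'g, snd z)))"
      by (intro smooth_on_Pair smooth_on_const smooth_on_bounded_linear oUV bounded_linear_fst bounded_linear_snd)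
    have "smooth_on (U \<times> UNIV) (\<lambda>z. (\<lambda>(z, w). frechet_derivative ?M (at z) w) ((fst z, snd ?e \<e>), (0, snd z)))"
      by (rule smooth_on_compose[OF smooth_on_derivative[OF M] l]) (use dom in auto)
    then have smF: "smooth_on (U \<times> UNIV) F" by (simp add: F_def case_prod_unfold)
    have qpt: "\<pi> (chart_inv d y) \<in> points Q" if "y \<in> U" for y using proj_points[OF carr[OF that]] .
    have linF: "linear (\<lambda>v. F (y, v))" if y: "y \<in> U" for y
    proof -
      have "linear (\<lambda>v. chart_change (chart_at Q (\<pi> (chart_inv d y))) c (\<pi> (chart_inv d y)) (\<Theta> (chart_inv d y) v))"
        using linear_compose[OF bounded_linear.linear[OF \<Theta>_linear[OF carr[OF y]]]
          bounded_linear.linear[OF chart_change_linear[OF atlas_Q chart_at(1)[OF qpt[OF y]] c chart_at(2)[OF qpt[OF y]]]]]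
          U[OF y] by (simp add: o_def)
      then show ?thesis by (simp add: F[OF y])
    qed
    have sjF: "surj (\<lambda>v. F (y, v))" if y: "y \<in> U" for y
    proof -
      have "\<pi> (chart_inv d y) \<in> fst c" using U[OF y] by blast
      from comp_surj[OF \<Theta>_surj[OF carr[OF y]] chart_change_surj[OF atlas_Q chart_at[OF qpt[OF y]] c this]]
      show ?thesis by (simp add: F[OF y] o_def)
    qed
    let ?\<Phi> = "\<lambda>(y, v). (chart_rep d c \<pi> y, F (y, v))"
    have \<Phi>: "submersion_on (U \<times> UNIV) ?\<Phi>" by (rule submersion_bundle[OF sub smF linF sjF])
    have l2: "smooth_on (U \<times> UNIV) (\<lambda>z. (fst z, N (snd z)))"
      by (intro smooth_on_Pair smooth_on_bounded_linear oUV bounded_linear_fst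
          bounded_linear_compose[OF N_linear bounded_linear_snd])
    have "smooth_on (U \<times> UNIV) (\<lambda>z. F (fst z, N (snd z)))"
      by (rule smooth_on_compose[OF smF l2]) auto
    then have "smooth_on (U \<times> UNIV) (\<lambda>z. ?\<N> (?\<Phi> z))"
    proof (rule smooth_on_cong[THEN iffD1, rotated])
      fix z :: "'g \<times> 'g" assume "z \<in> U \<times> UNIV"
      then obtain y v where z: "z = (y, v)" and y: "y \<in> U" by auto
      let ?g = "chart_inv d y"
      let ?q = "\<pi> ?g"
      have q: "?q \<in> fst c" using U[OF y] by blast
      have "chart_change c (chart_at Q ?q) ?q (F (y, v)) = \<Theta> ?g v"
        unfolding F[OF y] by (rule chart_change_inverse[OF atlas_Q chart_at[OF qpt[OF y]] c q])
      then show "F (fst z, N (snd z)) = ?\<N> (?\<Phi> z)"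
        using induced_map_\<Theta>[OF carr[OF y], of v] chart_inv_left[OF inj_Q c q] F[OF y, of "N v"]
        by (simp add: z Let_def)
    qed
    from smooth_on_descend[OF \<Phi> this]
    have s3: "smooth_on (?\<Phi> ` (U \<times> UNIV)) ?\<N>" .
    have s2: "?\<Phi> ` (U \<times> UNIV) \<subseteq> (snd c ` fst c) \<times> UNIV" using im by auto
    have s1: "z \<in> ?\<Phi> ` (U \<times> UNIV)"
    proof -
      obtain y where y: "y \<in> U" "fst z = chart_rep d c \<pi> y" using x by blast
      obtain v where "F (y, v) = snd z" using sjF[OF y(1)] by (metis surjD)
      then show ?thesis using y by (intro image_eqI[of _ _ "(y, v)"]) (auto simp: prod_eq_iff)
    qed
    show "\<exists>T. z \<in> T \<and> T \<subseteq> (snd c ` fst c) \<times> UNIV \<and> smooth_on T ?\<N>"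
      by (intro exI[of _ "?\<Phi> ` (U \<times> UNIV)"] conjI s1 s2 s3)
  qed
qed

end

end

section \<open>Nijenhuis torsion\<close>

text \<open>The product rule for bundle maps. In the second variable \<open>n\<close> is affine
  along lines, so its partial derivative there is \<open>n (x, _)\<close> itself.\<close>

lemma derivative_linear_second:
  fixes n :: "'a::real_normed_vector \<times> 'b::real_normed_vector \<Rightarrow> 'c::real_normed_vector"
  assumes D: "(n has_derivative D) (at (x, u))" and lin: "linear (\<lambda>w. n (x, w))"
  shows "D (h, w) = frechet_derivative (\<lambda>y. n (y, u)) (at x) h + n (x, w)"
proof -
  have "((\<lambda>y. (y, u)) has_derivative (\<lambda>h. (h, 0))) (at x)" by (auto intro!: derivative_eq_intros)
  from fun_cong[OF frechet_derivative_at[OF has_derivative_compose[OF this D]], of h]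
  have 1: "frechet_derivative (\<lambda>y. n (y, u)) (at x) h = D (h, 0)" by (rule sym)
  have "((\<lambda>w. (x, w)) has_derivative (\<lambda>w. (0, w))) (at u)" by (auto intro!: derivative_eq_intros)
  from has_derivative_compose[OF this D]
  have d: "((\<lambda>w. n (x, w)) has_derivative (\<lambda>w. D (0, w))) (at u)" .
  have "((\<lambda>t::real. u + t *\<^sub>R w) has_derivative (\<lambda>t. t *\<^sub>R w)) (at 0)" by (auto intro!: derivative_eq_intros)
  from has_derivative_compose[OF this, of "\<lambda>w. n (x, w)"] d
  have d1: "((\<lambda>t. n (x, u + t *\<^sub>R w)) has_derivative (\<lambda>t. D (0, t *\<^sub>R w))) (at 0)" by simp
  have e1: "n (x, u + t *\<^sub>R w) = n (x, u) + t *\<^sub>R n (x, w)" for t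
    by (simp add: linear_add[OF lin] linear_scale[OF lin])
  have d2: "((\<lambda>t::real. n (x, u) + t *\<^sub>R n (x, w)) has_derivative (\<lambda>t. t *\<^sub>R n (x, w))) (at 0)"
    by (auto intro!: derivative_eq_intros)
  from fun_cong[OF has_derivative_unique[OF d1[unfolded e1] d2], of 1]
  have 2: "D (0, w) = n (x, w)" by simp
  have "D (h, w) = D (h, 0) + D (0, w)"
    using linear_add[OF bounded_linear.linear[OF has_derivative_bounded_linear[OF D]], of "(h, 0)" "(0, w)"] by simp
  then show ?thesis using 1 2 by simp
qed

definition bundle_rep :: "('p, 'e::banach) chart set \<Rightarrow> ('p \<Rightarrow> 'e \<Rightarrow> 'e) \<Rightarrow> ('p, 'e) chart \<Rightarrow> 'e \<times> 'e \<Rightarrow> 'e" where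
  "bundle_rep A \<N> c = (\<lambda>(x, u). let p = chart_inv c x in
     chart_change (chart_at A p) c p (\<N> p (chart_change c (chart_at A p) p u)))"

text \<open>Tensoriality of the torsion: by the product rule each bracket splits into derivatives of
  \<open>X\<close> and \<open>Y\<close> and derivatives of \<N> with a frozen argument. The former
  cancel among the four brackets, which leaves an expression in the values \<open>X p\<close> and
  \<open>Y p\<close>.\<close>

lemma nijenhuis_torsion_in_chart:
  assumes A: "banach_atlas A" and \<N>: "smooth_bundle_map A \<N>"
    and X: "smooth_vector_field A X" and Y: "smooth_vector_field A Y" and p: "p \<in> points A"
  defines "c \<equiv> chart_at A p"
  defines "DN \<equiv> \<lambda>h u. frechet_derivative (\<lambda>x. bundle_rep A \<N> c (x, u)) (at (snd c p)) h"
  shows "nijenhuis_torsion A \<N> X Y p =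
    \<N> p (DN (X p) (Y p)) - \<N> p (DN (Y p) (X p)) - DN (\<N> p (X p)) (Y p) + DN (\<N> p (Y p)) (X p)"
proof -
  define n where "n = bundle_rep A \<N> c"
  define x0 where "x0 = snd c p"
  note c = chart_at[OF p, folded c_def]
  note iA = banach_atlas_inj_charts[OF A]
  have inv0: "chart_inv c x0 = p" unfolding x0_def by (rule chart_inv_left[OF iA c])
  have x0: "x0 \<in> snd c ` fst c" using c by (auto simp: x0_def)
  have oc: "open (snd c ` fst c)" by (rule open_chart_image[OF A c(1)])
  have sm: "smooth_on ((snd c ` fst c) \<times> UNIV) n"
    using \<N> c(1) unfolding smooth_bundle_map_def n_def bundle_rep_def by blast
  have lN: "linear (\<N> p)" using \<N> p unfolding smooth_bundle_map_def by blast
  have n0: "n (x0, u) = \<N> p u" for u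
    by (simp add: n_def bundle_rep_def Let_def inv0 c_def[symmetric] chart_change_same[OF A c])
  have pt0: "in_chart A c Z x0 = Z p" for Z
    by (simp add: in_chart_def Let_def inv0 c_def[symmetric] chart_change_same[OF A c])
  have rep: "in_chart A c (\<lambda>q. \<N> q (Z q)) x = n (x, in_chart A c Z x)" if x: "x \<in> snd c ` fst c" for Z x
  proof -
    let ?q = "chart_inv c x"
    have q: "?q \<in> fst c" by (rule chart_inv_in[OF x])
    from chart_change_inverse[OF A chart_at[OF in_points[OF c(1) q]] c(1) q]
    show ?thesis by (simp add: n_def bundle_rep_def in_chart_def Let_def)
  qed
  have field: "(in_chart A c Z has_derivative frechet_derivative (in_chart A c Z) (at x0)) (at x0)"
    if "smooth_vector_field A Z" for Z
    by (rule smooth_on_has_derivative[OF _ x0]) (use that c(1) in \<open>auto simp: smooth_vector_field_def\<close>)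
  have fieldN: "frechet_derivative (in_chart A c (\<lambda>q. \<N> q (Z q))) (at x0) h =
      DN h (Z p) + \<N> p (frechet_derivative (in_chart A c Z) (at x0) h)"
    if Z: "smooth_vector_field A Z" for Z h
  proof -
    let ?Z = "in_chart A c Z"
    let ?D = "frechet_derivative n (at (x0, ?Z x0))"
    have D: "(n has_derivative ?D) (at (x0, ?Z x0))"
      by (rule smooth_on_has_derivative[OF sm]) (use x0 in auto)
    have "((\<lambda>x. (x, ?Z x)) has_derivative (\<lambda>h. (h, frechet_derivative ?Z (at x0) h))) (at x0)"
      by (intro has_derivative_Pair has_derivative_ident field[OF Z])
    from has_derivative_compose[OF this D]
    have "((\<lambda>x. n (x, ?Z x)) has_derivative (\<lambda>h. ?D (h, frechet_derivative ?Z (at x0) h))) (at x0)" .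
    then have "(in_chart A c (\<lambda>q. \<N> q (Z q)) has_derivative (\<lambda>h. ?D (h, frechet_derivative ?Z (at x0) h))) (at x0)"
      by (rule has_derivative_open_cong[OF oc x0, THEN iffD1, rotated]) (simp add: rep)
    from fun_cong[OF frechet_derivative_at[OF this], of h]
    have "frechet_derivative (in_chart A c (\<lambda>q. \<N> q (Z q))) (at x0) h = ?D (h, frechet_derivative ?Z (at x0) h)"
      by (rule sym)
    also have "\<dots> = DN h (Z p) + \<N> p (frechet_derivative ?Z (at x0) h)"
      using derivative_linear_second[OF D] lN unfolding n0 pt0 by (simp add: DN_def n_def x0_def)
    finally show ?thesis .
  qed
  have br: "lie_bracket A V W p = frechet_derivative (in_chart A c W) (at x0) (V p) - frechet_derivative (in_chart A c V) (at x0) (W p)"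
    for V W
    by (simp add: lie_bracket_def Let_def c_def[symmetric] x0_def[symmetric] pt0)
  show ?thesis
    unfolding nijenhuis_torsion_def br fieldN[OF X] fieldN[OF Y]
    by (simp add: linear_add[OF lN] linear_diff[OF lN])
qed

context homogeneous_quotient
begin

text \<open>As for the frame on \<open>Q\<close>, the field is a partial derivative of
  multiplication. The derivatives at the unit that enter \<open>lie_algebra_bracket\<close> thereby
  exist.\<close>

lemma left_invariant_in_chart:
  fixes v :: 'g
  defines "d \<equiv> chart_at A \<e>"
  shows "smooth_on (snd d ` fst d) (in_chart A d (left_invariant_field G A v))"
    and "in_chart A d (left_invariant_field G A v) (snd d \<e>) = v"
proof -
  note d = chart_at[OF one_points, folded d_def]
  let ?f = "\<lambda>(g, h). g \<cdot> h"
  let ?M = "prod_rep d d d ?f"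
  have M: "smooth_on (prod_dom d d d ?f) ?M"
    by (rule smooth_map_prod_rep[OF inj_A inj_A smooth_mult d(1) d(1) d(1)])
  have oU: "open (snd d ` fst d)" by (rule open_chart_image[OF atlas_A d(1)])
  have carr: "chart_inv d y \<in> carrier G" if "y \<in> snd d ` fst d" for y
    using in_points[OF d(1) chart_inv_in[OF that]] points_A by simp
  have dom: "(y, snd d \<e>) \<in> prod_dom d d d ?f" if y: "y \<in> snd d ` fst d" for y
    using carr[OF y] y d(2) chart_inv_left[OF inj_A d] chart_inv_in[OF y] by simp
  have l: "smooth_on (snd d ` fst d) (\<lambda>y. ((y, snd d \<e>), (0 :: 'g, v)))"
    by (intro smooth_on_Pair smooth_on_const smooth_on_id oU)
  have "smooth_on (snd d ` fst d) (\<lambda>y. (\<lambda>(z, w). frechet_derivative ?M (at z) w) ((y, snd d \<e>), (0, v)))"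
    by (rule smooth_on_compose[OF smooth_on_derivative[OF M] l]) (use dom in auto)
  then show "smooth_on (snd d ` fst d) (in_chart A d (left_invariant_field G A v))"
  proof (rule smooth_on_cong[THEN iffD1, rotated])
    fix y assume y: "y \<in> snd d ` fst d"
    let ?h = "chart_inv d y"
    have h: "?h \<in> fst d" "snd d ?h = y" "?h \<in> carrier G" using chart_inv_in[OF y] chart_inv_right[OF y] carr[OF y] by auto
    have D1: "(chart_rep d d (\<lambda>k. ?h \<cdot> k) has_derivative
        (\<lambda>v. frechet_derivative ?M (at (y, snd d \<e>)) (0, v))) (at (snd d \<e>))"
      using prod_rep_has_derivative_slice(1)[OF inj_A inj_A smooth_mult d(1) h(1) d d(1)] h by simp
    have D2: "(chart_rep d d (\<lambda>k. ?h \<cdot> k) has_derivative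
        (\<lambda>v. chart_change (chart_at A ?h) d ?h (left_invariant_field G A v ?h))) (at (snd d \<e>))"
      using chart_rep_has_derivative[OF atlas_A atlas_A smooth_left[OF h(3)] d d(1)] h
      by (simp add: left_invariant_field_def d_def[symmetric] chart_change_same[OF atlas_A d])
    from has_derivative_unique[OF D1 D2]
    show "(\<lambda>(z, w). frechet_derivative ?M (at z) w) ((y, snd d \<e>), (0, v)) =
        in_chart A d (left_invariant_field G A v) y"
      by (simp add: in_chart_def Let_def) metis
  qed
  have "left_invariant_field G A v \<e> = v"
  proof -
    have "mderiv A A (\<lambda>h. \<e> \<cdot> h) \<e> = mderiv A A (\<lambda>h. h) \<e>"
      by (rule mderiv_cong[OF atlas_A _ one_points]) (simp add: points_A)
    then show ?thesis by (simp add: left_invariant_field_def mderiv_ident[OF atlas_A one_points])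
  qed
  then show "in_chart A d (left_invariant_field G A v) (snd d \<e>) = v"
    by (simp add: in_chart_def Let_def chart_inv_left[OF inj_A d] d_def[symmetric] chart_change_same[OF atlas_A d])
qed

text \<open>The chain rule for \<open>\<pi> (g \<cdot> (h \<cdot> k))\<close> in \<open>k\<close>.
  It writes the frame in charts as the derivative of a fixed map applied to a left-invariant field;
  differentiating this product gives a second derivative, which is symmetric, and a term that
  produces the bracket of the Lie algebra.\<close>

lemma frame_factorization:
  fixes v :: 'g
  defines "d \<equiv> chart_at A \<e>"
  assumes g: "g \<in> carrier G" and c: "c \<in> Q" and x: "x \<in> snd d ` (fst d \<inter> (\<lambda>h. \<pi> (g \<cdot> h)) -` fst c)"
  defines "h \<equiv> chart_inv d x"
  shows "frechet_derivative (chart_rep d c (\<lambda>h. \<pi> (g \<cdot> h))) (at x) (in_chart A d (left_invariant_field G A v) x)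
    = chart_change (chart_at Q (\<pi> (g \<cdot> h))) c (\<pi> (g \<cdot> h)) (\<Theta> (g \<cdot> h) v)"
proof -
  note d = chart_at[OF one_points, folded d_def]
  have h: "h \<in> fst d" "\<pi> (g \<cdot> h) \<in> fst c" "x = snd d h"
    using x chart_inv_left[OF inj_A d(1)] unfolding h_def by auto
  have hc: "h \<in> carrier G" and hp: "h \<in> points A" using in_points[OF d(1) h(1)] points_A by simp_all
  from frechet_derivative_at[OF chart_rep_has_derivative[OF atlas_A atlas_Q smooth_proj_left[OF g] d(1) h(1) c h(2)]]
  have 1: "frechet_derivative (chart_rep d c (\<lambda>h. \<pi> (g \<cdot> h))) (at x) w =
    chart_change (chart_at Q (\<pi> (g \<cdot> h))) c (\<pi> (g \<cdot> h)) (mderiv A Q (\<lambda>h. \<pi> (g \<cdot> h)) h (chart_change d (chart_at A h) h w))" for w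
    unfolding h(3) by metis
  have 2: "chart_change d (chart_at A h) h (in_chart A d (left_invariant_field G A v) x) = mderiv A A (\<lambda>k. h \<cdot> k) \<e> v"
    using chart_change_inverse[OF atlas_A chart_at[OF hp] d(1) h(1)]
    by (simp add: in_chart_def Let_def h_def[symmetric] left_invariant_field_def)
  have "\<Theta> (g \<cdot> h) v = mderiv A Q (\<lambda>k. \<pi> (g \<cdot> (h \<cdot> k))) \<e> v"
    unfolding \<Theta>_def
    by (rule fun_cong[OF mderiv_cong[OF atlas_A _ one_points]])
      (simp add: points_A g hc monoid.m_assoc[OF group.is_monoid[OF group_G]])
  also have "\<dots> = mderiv A Q (\<lambda>h. \<pi> (g \<cdot> h)) h (mderiv A A (\<lambda>k. h \<cdot> k) \<e> v)"
    using mderiv_compose[OF atlas_A atlas_A smooth_left[OF hc] smooth_proj_left[OF g] one_points] hc by simp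
  finally show ?thesis unfolding 1 2 by simp
qed

text \<open>The remaining derivatives of \<N> are obtained by differentiating the intertwining
  relation \<open>nF\<close> at the unit. The frame vectors span the tangent space at
  \<open>\<pi> g\<close>, so this determines them on all the arguments that occur.\<close>

lemma nijenhuis_torsion_induced_map:
  fixes N :: "'g \<Rightarrow> 'g" and a b :: 'g
  defines "\<N> \<equiv> induced_map G A K Q N"
    and "br \<equiv> lie_algebra_bracket G A"
  assumes N: "bounded_linear N"
    and N_kernel: "\<And>v. \<Theta> \<e> v = 0 \<Longrightarrow> \<Theta> \<e> (N v) = 0"
    and N_Ad: "\<And>k v. k \<in> K \<Longrightarrow> \<Theta> \<e> (Ad G A k (N v) - N (Ad G A k v)) = 0"
    and X: "smooth_vector_field Q X" and Y: "smooth_vector_field Q Y"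
    and g: "g \<in> carrier G" and a: "X (\<pi> g) = \<Theta> g a" and b: "Y (\<pi> g) = \<Theta> g b"
  shows "nijenhuis_torsion Q \<N> X Y (\<pi> g) =
    \<Theta> g (N (br a (N b)) + N (br (N a) b) - br (N a) (N b) - N (N (br a b)))"
proof -
  let ?p = "\<pi> g"
  define c where "c = chart_at Q ?p"
  define d where "d = chart_at A \<e>"
  define e1 where "e1 = snd d \<e>"
  define n where "n = bundle_rep Q \<N> c"
  define x0 where "x0 = snd c ?p"
  define P where "P = chart_rep d c (\<lambda>h. \<pi> (g \<cdot> h))"
  define U where "U = snd d ` (fst d \<inter> (\<lambda>h. \<pi> (g \<cdot> h)) -` fst c)"
  define S where "S v = in_chart A d (left_invariant_field G A v)" for v
  define F where "F v x = frechet_derivative P (at x) (S v x)" for v x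
  define DN where "DN h u = frechet_derivative (\<lambda>x. n (x, u)) (at x0) h" for h u
  have p: "?p \<in> points Q" using proj_points[OF g] .
  note c = chart_at[OF p, folded c_def] and d = chart_at[OF one_points, folded d_def]
  have ind: "\<N> (\<pi> h) (\<Theta> h v) = \<Theta> h (N v)" if "h \<in> carrier G" for h v
    unfolding \<N>_def by (rule induced_map_\<Theta>[OF N _ _ that]) (erule N_kernel, erule N_Ad)
  have \<N>: "smooth_bundle_map Q \<N>" unfolding \<N>_def by (rule induced_map_smooth[OF N N_kernel N_Ad])
  have lN: "linear (\<N> ?p)" using \<N> p unfolding smooth_bundle_map_def by blast
  have smP: "smooth_on U P" unfolding U_def P_def by (rule smooth_map_rep[OF smooth_proj_left[OF g] d(1) c(1)])
  have oU: "open U" by (rule smooth_on_open[OF smP])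
  have e1U: "e1 \<in> U" unfolding U_def e1_def using d c g by auto
  have e1d: "e1 \<in> snd d ` fst d" using d by (auto simp: e1_def)
  have inve1: "chart_inv d e1 = \<e>" unfolding e1_def by (rule chart_inv_left[OF inj_A d])
  have Pe1: "P e1 = x0" using g by (simp add: P_def inve1 x0_def)
  let ?S' = "\<lambda>v. frechet_derivative (S v) (at e1)"
  have S': "(S v has_derivative ?S' v) (at e1)" for v
    unfolding S_def d_def by (rule smooth_on_has_derivative[OF left_invariant_in_chart(1)]) (use e1d d_def in simp)
  have Se1: "S v e1 = v" for v unfolding S_def d_def e1_def by (rule left_invariant_in_chart(2))
  have br_eq: "br v w = ?S' w v - ?S' v w" for v w
    by (simp add: br_def lie_algebra_bracket_def lie_bracket_def Let_def d_def[symmetric] e1_def[symmetric] S_def[symmetric] Se1)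
  have F_eq: "F v x = chart_change (chart_at Q (\<pi> (g \<cdot> chart_inv d x))) c (\<pi> (g \<cdot> chart_inv d x)) (\<Theta> (g \<cdot> chart_inv d x) v)"
    if "x \<in> U" for v x
    unfolding F_def S_def P_def d_def
    by (rule frame_factorization[OF g c(1)]) (use that in \<open>simp add: U_def d_def\<close>)
  have Fe1: "F v e1 = \<Theta> g v" for v
    using F_eq[OF e1U] g by (simp add: inve1 c_def[symmetric] chart_change_same[OF atlas_Q c])
  then have P'e1: "frechet_derivative P (at e1) v = \<Theta> g v" for v by (simp add: F_def Se1)
  have nF: "n (P x, F v x) = F (N v) x" if x: "x \<in> U" for v x
  proof -
    let ?h = "chart_inv d x"
    let ?q = "\<pi> (g \<cdot> ?h)"
    have h: "?h \<in> fst d" "?q \<in> fst c"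
      using x chart_inv_left[OF inj_A d(1)] unfolding U_def by auto
    have gh: "g \<cdot> ?h \<in> carrier G" using in_points[OF d(1) h(1)] points_A g by simp
    have "chart_inv c (P x) = ?q" by (simp add: P_def chart_inv_left[OF inj_Q c(1) h(2)])
    then show ?thesis
      unfolding n_def bundle_rep_def F_eq[OF x]
      by (simp add: Let_def chart_change_inverse[OF atlas_Q chart_at[OF proj_points[OF gh]] c(1) h(2)] ind[OF gh])
  qed
  have "((\<lambda>x. n (P x, F v x)) has_derivative D) (at e1) \<longleftrightarrow> (F (N v) has_derivative D) (at e1)" for v D
    by (rule has_derivative_open_cong[OF oU e1U]) (rule nF)
  note nF_der = this[THEN iffD1]
  obtain H where H: "\<And>v. ((\<lambda>y. frechet_derivative P (at y) v) has_derivative (\<lambda>h. H h v)) (at e1)"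
    "\<And>u v. H u v = H v u"
    using second_derivative_symmetric[OF smP e1U] by metis
  \<comment> \<open>The product rule for \<open>F v x = frechet_derivative P (at x) (S v x)\<close>:
    the Hessian \<open>H\<close> of \<open>P\<close>, plus the derivative of \<open>P\<close> at the
    unit, which is \<open>\<Theta> g\<close>, applied to the derivative of the left-invariant
    field.\<close>
  have F': "(F v has_derivative (\<lambda>h. H h v + \<Theta> g (?S' v h))) (at e1)" for v
  proof -
    let ?G = "\<lambda>(x, w). frechet_derivative P (at x) w"
    let ?D = "frechet_derivative ?G (at (e1, S v e1))"
    have D: "(?G has_derivative ?D) (at (e1, S v e1))"
      by (rule smooth_on_has_derivative[OF smooth_on_derivative[OF smP]]) (use e1U in auto)
    have "((\<lambda>x. (x, S v x)) has_derivative (\<lambda>h. (h, ?S' v h))) (at e1)"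
      by (intro has_derivative_Pair has_derivative_ident S')
    from has_derivative_compose[OF this D]
    have "(F v has_derivative (\<lambda>h. ?D (h, ?S' v h))) (at e1)" by (simp add: F_def[abs_def])
    moreover have "linear (\<lambda>w. ?G (e1, w))"
      using bounded_linear.linear[OF has_derivative_bounded_linear[OF smooth_on_has_derivative[OF smP e1U]]] by simp
    note derivative_linear_second[OF D this]
    moreover have "frechet_derivative (\<lambda>y. ?G (y, S v e1)) (at e1) h = H h v" for h
      using frechet_derivative_at[OF H(1)[of v]] by (simp add: Se1) metis
    ultimately show ?thesis by (simp add: P'e1)
  qed
  let ?F' = "\<lambda>v h. H h v + \<Theta> g (?S' v h)"
  note lT = bounded_linear.linear[OF \<Theta>_linear[OF g]]
  \<comment> \<open>The Hessian terms cancel by symmetry, and the derivatives of the left-invariant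
    fields form their bracket at the unit.\<close>
  have bracket: "?F' w v - ?F' v w = \<Theta> g (br v w)" for v w
    using H(2)[of v w] by (simp add: br_eq linear_diff[OF lT])
  have inv0: "chart_inv c x0 = ?p" unfolding x0_def by (rule chart_inv_left[OF inj_Q c])
  have n0: "n (x0, u) = \<N> ?p u" for u
    by (simp add: n_def bundle_rep_def Let_def inv0 c_def[symmetric] chart_change_same[OF atlas_Q c])
  \<comment> \<open>Both sides of \<open>nF\<close> are differentiated in direction
    \<open>h\<close>: on the left the moving base point gives \<open>DN\<close> and the moving
    vector gives \<N> of its derivative.\<close>
  have DN: "DN (\<Theta> g h) (\<Theta> g v) = ?F' (N v) h - \<N> ?p (?F' v h)" for h v
  proof -
    have "smooth_on ((snd c ` fst c) \<times> UNIV) n"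
      using \<N> c(1) unfolding smooth_bundle_map_def n_def bundle_rep_def by blast
    moreover have "(x0, \<Theta> g v) \<in> (snd c ` fst c) \<times> UNIV" using c by (auto simp: x0_def)
    ultimately have D: "(n has_derivative frechet_derivative n (at (x0, \<Theta> g v))) (at (x0, \<Theta> g v))"
      by (rule smooth_on_has_derivative)
    have "((\<lambda>x. (P x, F v x)) has_derivative (\<lambda>h. (frechet_derivative P (at e1) h, ?F' v h))) (at e1)"
      by (intro has_derivative_Pair smooth_on_has_derivative[OF smP e1U] F')
    from has_derivative_compose[OF this, of n] D
    have "((\<lambda>x. n (P x, F v x)) has_derivative (\<lambda>h. frechet_derivative n (at (x0, \<Theta> g v)) (\<Theta> g h, ?F' v h))) (at e1)"
      by (simp add: Pe1 Fe1 P'e1)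
    from fun_cong[OF has_derivative_unique[OF nF_der[OF this] F'], of h]
    have "frechet_derivative n (at (x0, \<Theta> g v)) (\<Theta> g h, ?F' v h) = ?F' (N v) h" .
    moreover have "linear (\<lambda>w. n (x0, w))" unfolding n0 by (rule lN)
    note derivative_linear_second[OF D this]
    ultimately show ?thesis by (simp add: DN_def n0 eq_diff_eq)
  qed
  have "nijenhuis_torsion Q \<N> X Y ?p =
      \<N> ?p (DN (\<Theta> g a) (\<Theta> g b)) - \<N> ?p (DN (\<Theta> g b) (\<Theta> g a))
      - DN (\<N> ?p (\<Theta> g a)) (\<Theta> g b) + DN (\<N> ?p (\<Theta> g b)) (\<Theta> g a)"
    using nijenhuis_torsion_in_chart[OF atlas_Q \<N> X Y p]
    by (simp add: DN_def n_def c_def[symmetric] x0_def a b)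
  \<comment> \<open>Each of the four \<open>DN\<close> terms contributes two derivatives of frame
    fields; the eight are regrouped into the differences that \<open>bracket\<close>
    evaluates.\<close>
  also have "\<dots> = \<N> ?p (?F' (N b) a - ?F' a (N b)) + \<N> ?p (?F' b (N a) - ?F' (N a) b)
      - (?F' (N b) (N a) - ?F' (N a) (N b)) - \<N> ?p (\<N> ?p (?F' b a - ?F' a b))"
    unfolding ind[OF g] DN linear_diff[OF lN] by simp
  also have "\<dots> = \<Theta> g (N (br a (N b)) + N (br (N a) b) - br (N a) (N b) - N (N (br a b)))"
    unfolding bracket by (simp add: ind[OF g] linear_add[OF lT] linear_diff[OF lT])
  finally show ?thesis .
qed

end

theorem theoremA:
  fixes G :: "('a, 's) monoid_scheme"
    and A :: "('a, 'g::banach) chart set"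
    and K :: "'a set"
    and B :: "('a, 'k::banach) chart set"
    and Q :: "('a set, 'm::banach) chart set"
    and N :: "'g \<Rightarrow> 'g"
  assumes "banach_lie_group G A"
    and "immersed_lie_subgroup G A K B"
    and "homogeneous_space G A K Q"
    and "{v. mderiv A Q (coset_proj G K) \<one>\<^bsub>G\<^esub> v = 0} = lie_subalgebra G A B"
    and "N \<in> admissible_ops G A K B"
  shows "nijenhuis_operator Q (induced_map G A K Q N) \<longleftrightarrow>
    (\<forall>v w. N (lie_algebra_bracket G A v (N w)) + N (lie_algebra_bracket G A (N v) w)
        - lie_algebra_bracket G A (N v) (N w) - N (N (lie_algebra_bracket G A v w))
      \<in> lie_subalgebra G A B)"
proof -
  interpret homogeneous_quotient G A K Q
    by (rule homogeneous_quotient.intro) (use assms(1-3) in \<open>simp_all add: immersed_lie_subgroup_def\<close>)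
  have ker: "v \<in> lie_subalgebra G A B \<longleftrightarrow> \<Theta> \<one>\<^bsub>G\<^esub> v = 0" for v
    using assms(4) by (auto simp: \<Theta>_one)
  have N: "bounded_linear N" "\<And>v. \<Theta> \<one>\<^bsub>G\<^esub> v = 0 \<Longrightarrow> \<Theta> \<one>\<^bsub>G\<^esub> (N v) = 0"
    "\<And>k v. k \<in> K \<Longrightarrow> \<Theta> \<one>\<^bsub>G\<^esub> (Ad G A k (N v) - N (Ad G A k v)) = 0"
    using assms(5) unfolding admissible_ops_def ker[symmetric] by blast+
  let ?E = "\<lambda>v w. N (lie_algebra_bracket G A v (N w)) + N (lie_algebra_bracket G A (N v) w)
        - lie_algebra_bracket G A (N v) (N w) - N (N (lie_algebra_bracket G A v w))"
  have torsion: "nijenhuis_torsion Q (induced_map G A K Q N) X Y (coset_proj G K g) = \<Theta> g (?E a b)"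
    if "smooth_vector_field Q X" "smooth_vector_field Q Y" "g \<in> carrier G"
      "X (coset_proj G K g) = \<Theta> g a" "Y (coset_proj G K g) = \<Theta> g b" for X Y g a b
    by (rule nijenhuis_torsion_induced_map[OF N(1) _ _ that]) (erule N(2), erule N(3))
  show ?thesis
  proof
    assume nij: "nijenhuis_operator Q (induced_map G A K Q N)"
    show "\<forall>v w. ?E v w \<in> lie_subalgebra G A B"
    proof (intro allI)
      fix v w
      let ?X = "fundamental_field v" and ?Y = "fundamental_field w"
      have "nijenhuis_torsion Q (induced_map G A K Q N) ?X ?Y (coset_proj G K \<one>\<^bsub>G\<^esub>) = 0"
        using nij fundamental_field_smooth proj_points[OF closed(2)] unfolding nijenhuis_operator_def by blast
      with torsion[OF fundamental_field_smooth fundamental_field_smooth closed(2)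
          fundamental_field_base fundamental_field_base, of v w]
      have "\<Theta> \<one>\<^bsub>G\<^esub> (?E v w) = 0" by (rule trans[OF sym])
      then show "?E v w \<in> lie_subalgebra G A B" by (simp only: ker)
    qed
  next
    assume E: "\<forall>v w. ?E v w \<in> lie_subalgebra G A B"
    show "nijenhuis_operator Q (induced_map G A K Q N)"
      unfolding nijenhuis_operator_def
    proof (intro conjI allI impI ballI)
      show "smooth_bundle_map Q (induced_map G A K Q N)" by (rule induced_map_smooth[OF N])
      fix X Y q assume X: "smooth_vector_field Q X" and Y: "smooth_vector_field Q Y" and "q \<in> points Q"
      then obtain g where g: "g \<in> carrier G" "q = coset_proj G K g" using points_Q by auto
      obtain a b where ab: "X (coset_proj G K g) = \<Theta> g a" "Y (coset_proj G K g) = \<Theta> g b"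
        using \<Theta>_surj[OF g(1)] by (metis surjD)
      have "?E a b \<in> lie_subalgebra G A B" using E by blast
      \<comment> \<open>The kernel of \<open>\<Theta> g\<close> is the same for all
        \<open>g\<close>, since \<open>\<Theta> g\<close> is the frame at the unit followed by an
        isomorphism of tangent spaces.\<close>
      then have "\<Theta> g (?E a b) = 0" by (simp only: ker \<Theta>_eq_0_iff[OF g(1)])
      with torsion[OF X Y g(1) ab] show "nijenhuis_torsion Q (induced_map G A K Q N) X Y q = 0"
        unfolding g(2) by (rule trans)
    qed
  qed
qed

end
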